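(* Let $X$ be the squarefree flow with the left shift $\sigma$, let $G=\prod_{p}\mathbb{Z}/p^2\mathbb{Z}$ with mass-one Haar measure $m$, let $\omega_{(1/2,1/2)}$ be the $(1/2,1/2)$ Bernoulli measure on $\Omega^{(2)}$, and let $\iota:G\times\Omega^{(2)}\to X$ be the insertion map. Then the pushforward $\iota_{*}(m\times\omega_{(1/2,1/2)})$ is the only measure of maximal entropy on $(X,\sigma)$.
   Context: $\mathbb{N}=\{1,2,3,\dots\}$; $\Omega^{(2)}=\{0,1\}^{\mathbb{N}}$ with the product topology, and $\sigma$ is the left shift $(\sigma x)_n=x_{n+1}$. For $x\in\Omega^{(2)}$, $\operatorname{supp}(x)=\{n\in\mathbb{N}:x_n=1\}$. The squarefree flow $X\subset\Omega^{(2)}$ is the closed shift-invariant set of all $x$ such that for every prime $p$ the reduction of $\operatorname{supp}(x)$ modulo $p^2$ is a proper subset of $\mathbb{Z}/p^2\mathbb{Z}$. The product defining the compact group $G=\prod_p\mathbb{Z}/p^2\mathbb{Z}$ is over all primes $p$. The measure $\omega_{(1/2,1/2)}$ is the product measure on $\{0,1\}^{\mathbb{N}}$ giving each symbol mass $1/2$ in each coordinate. For $g=(g_p)_p\in G$ and $k\in\mathbb{N}$ put $\alpha_g(k)=|\{1\le n\le k: n\equiv g_p \bmod p^2\text{ for some prime }p\}|$. The insertion map $\iota:G\times\Omega^{(2)}\to X$ is the Borel measurable map defined by $\iota(g,y)_k=0$ if $k\equiv g_p\bmod p^2$ for some prime $p$, and $\iota(g,y)_k=y_{k-\alpha_g(k)}$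 otherwise. A measure of maximal entropy on $X$ is a $\sigma$-invariant Borel probability measure whose measure-theoretic entropy equals the topological entropy of $(X,\sigma)$. *)

theory Defs
  imports
    "HOL-Probability.Probability"
    "HOL-Algebra.Elementary_Groups"
    "HOL-Algebra.Product_Groups"
    "HOL-Number_Theory.Cong"
    "HOL-Library.Disjoint_Sets"
begin

definition borel_of :: "'a topology \<Rightarrow> 'a measure" where
  "borel_of X = sigma (topspace X) {U. openin X U}"

text \<open>
  Entropy of a map \<open>T\<close> on a set \<open>S\<close>, for finite measurable partitions and for open covers.
  \<open>iterated_join S T P n\<close> is the common refinement of
  the preimages of \<open>P\<close> under \<open>T ^^ k\<close> for \<open>k < n\<close>. It may contain the empty set, which
  contributes nothing to the entropy of a partition and does not affect minimal subcovers.
\<close>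

primrec iterated_join :: "'a set \<Rightarrow> ('a \<Rightarrow> 'a) \<Rightarrow> 'a set set \<Rightarrow> nat \<Rightarrow> 'a set set" where
  "iterated_join S T P 0 = {S}"
| "iterated_join S T P (Suc n) =
     {A \<inter> ((T ^^ n) -` B \<inter> S) | A B. A \<in> iterated_join S T P n \<and> B \<in> P}"

definition partition_entropy :: "'a measure \<Rightarrow> 'a set set \<Rightarrow> real" where
  "partition_entropy M P = - (\<Sum>A\<in>P. measure M A * ln (measure M A))"

text \<open>
  The sequences below are of the form \<open>a n / n\<close> with \<open>a\<close> subadditive, so they converge and
  the upper limit is the limit; the values at \<open>n = 0\<close> are irrelevant.
\<close>

definition entropy_wrt_partition :: "'a measure \<Rightarrow> ('a \<Rightarrow> 'a) \<Rightarrow> 'a set set \<Rightarrow> ereal" where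
  "entropy_wrt_partition M T P =
     limsup (\<lambda>n. ereal (partition_entropy M (iterated_join (space M) T P n) / real n))"

definition measure_entropy :: "'a measure \<Rightarrow> ('a \<Rightarrow> 'a) \<Rightarrow> ereal" where
  "measure_entropy M T =
     (SUP P \<in> {P. finite P \<and> partition_on (space M) P \<and> P \<subseteq> sets M}.
        entropy_wrt_partition M T P)"

definition min_subcover_card :: "'a set \<Rightarrow> 'a set set \<Rightarrow> nat" where
  "min_subcover_card S U = Inf {card V | V. V \<subseteq> U \<and> finite V \<and> S \<subseteq> \<Union>V}"

definition entropy_wrt_cover :: "'a topology \<Rightarrow> ('a \<Rightarrow> 'a) \<Rightarrow> 'a set set \<Rightarrow> ereal" where
  "entropy_wrt_cover X T U =
     limsup (\<lambda>n. ereal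
       (ln (real (min_subcover_card (topspace X) (iterated_join (topspace X) T U n))) / real n))"

text \<open>Intended for compact \<open>X\<close>, where every open cover has a finite subcover.\<close>

definition topological_entropy :: "'a topology \<Rightarrow> ('a \<Rightarrow> 'a) \<Rightarrow> ereal" where
  "topological_entropy X T =
     (SUP U \<in> {U. (\<forall>V\<in>U. openin X V) \<and> \<Union>U = topspace X}. entropy_wrt_cover X T U)"

definition invariant_borel_prob :: "'a topology \<Rightarrow> ('a \<Rightarrow> 'a) \<Rightarrow> 'a measure \<Rightarrow> bool" where
  "invariant_borel_prob X T \<mu> \<longleftrightarrow>
     sets \<mu> = sets (borel_of X) \<and> prob_space \<mu> \<and> T \<in> measurable \<mu> \<mu> \<and> distr \<mu> \<mu> T = \<mu>"

definition measure_of_maximal_entropy :: "'a topology \<Rightarrow> ('a \<Rightarrow> 'a) \<Rightarrow> 'a measure \<Rightarrow> bool" where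
  "measure_of_maximal_entropy X T \<mu> \<longleftrightarrow>
     invariant_borel_prob X T \<mu> \<and> measure_entropy \<mu> T = topological_entropy X T"

text \<open>
  On the compact metrizable groups considered here, finite Borel measures are automatically
  regular, so regularity is not part of the definition.
\<close>

definition normalized_haar_measure ::
    "('a, 'b) monoid_scheme \<Rightarrow> 'a topology \<Rightarrow> 'a measure \<Rightarrow> bool" where
  "normalized_haar_measure G X m \<longleftrightarrow>
     sets m = sets (borel_of X) \<and> prob_space m \<and>
     (\<forall>g\<in>carrier G. \<forall>A\<in>sets m. emeasure m ((\<lambda>h. g \<otimes>\<^bsub>G\<^esub> h) ` A) = emeasure m A)"

text \<open>
  Sequences are indexed by \<open>{1..}\<close>: they are functions on \<open>nat\<close> that are
  \<open>undefined\<close> at \<open>0\<close>.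
\<close>

definition binary_sequences :: "(nat \<Rightarrow> nat) topology" where
  "binary_sequences = product_topology (\<lambda>_. discrete_topology {0, 1}) {1..}"

definition left_shift :: "(nat \<Rightarrow> nat) \<Rightarrow> (nat \<Rightarrow> nat)" where
  "left_shift x = (\<lambda>n\<in>{1..}. x (n + 1))"

definition supp :: "(nat \<Rightarrow> nat) \<Rightarrow> nat set" where
  "supp x = {n\<in>{1..}. x n = 1}"

definition squarefree_flow :: "(nat \<Rightarrow> nat) topology" where
  "squarefree_flow = subtopology binary_sequences
     {x \<in> topspace binary_sequences.
        \<forall>p. Factorial_Ring.prime p \<longrightarrow> (\<lambda>n. n mod p\<^sup>2) ` supp x \<subset> {0..<p\<^sup>2}}"

definition bernoulli_half :: "(nat \<Rightarrow> nat) measure" where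
  "bernoulli_half = PiM {1..} (\<lambda>_. uniform_count_measure {0, 1})"

definition primes :: "nat set" where
  "primes = {p. Factorial_Ring.prime p}"

definition G_group :: "(nat \<Rightarrow> int) monoid" where
  "G_group = product_group primes (\<lambda>p. integer_mod_group (p\<^sup>2))"

definition G_topology :: "(nat \<Rightarrow> int) topology" where
  "G_topology =
     product_topology (\<lambda>p. discrete_topology (carrier (integer_mod_group (p\<^sup>2)))) primes"

definition sieved :: "(nat \<Rightarrow> int) \<Rightarrow> nat \<Rightarrow> bool" where
  "sieved g n \<longleftrightarrow> (\<exists>p\<in>primes. [int n = g p] (mod int (p\<^sup>2)))"

definition num_sieved :: "(nat \<Rightarrow> int) \<Rightarrow> nat \<Rightarrow> nat" where
  "num_sieved g k = card {n\<in>{1..k}. sieved g n}"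

text \<open>
  If \<open>k\<close> is not sieved then \<open>num_sieved g k < k\<close>, so the index \<open>k - num_sieved g k\<close> is positive.
\<close>

definition insertion :: "(nat \<Rightarrow> int) \<times> (nat \<Rightarrow> nat) \<Rightarrow> (nat \<Rightarrow> nat)" where
  "insertion = (\<lambda>(g, y). \<lambda>k\<in>{1..}. if sieved g k then 0 else y (k - num_sieved g k))"

text \<open>A normalized Haar measure on \<open>G_group\<close> exists: the product of the uniform measures.\<close>

lemma sets_borel_of: "sets (borel_of X) = sigma_sets (topspace X) {U. openin X U}"
  unfolding borel_of_def by (rule sets_measure_of) (auto dest: openin_subset)

lemma sets_borel_of_product_discrete:
  assumes I: "countable I" and S: "\<And>i. i \<in> I \<Longrightarrow> countable (S i)"
  shows "sets (borel_of (product_topology (\<lambda>i. discrete_topology (S i)) I)) =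
    sets (PiM I (\<lambda>i. count_space (S i)))" (is "sets (borel_of ?X) = sets ?P")
proof
  have "{f \<in> PiE I S. f i \<in> A} \<in> {U. openin ?X U}" if "i \<in> I" "A \<subseteq> S i" for i A
    using openin_continuous_map_preimage[OF continuous_map_product_projection[OF that(1)], of "\<lambda>i. discrete_topology (S i)" A] that(2)
    by simp
  then show "sets ?P \<subseteq> sets (borel_of ?X)"
    unfolding sets_PiM_single sets_borel_of topspace_product_topology topspace_discrete_topology
      space_count_space sets_count_space
    by (intro sigma_sets_mono') blast
  show "sets (borel_of ?X) \<subseteq> sets ?P"
  proof -
    have "U \<in> sets ?P" if U: "openin ?X U" for U
    proof -
      define K where "K = (SIGMA J : {J. finite J \<and> J \<subseteq> I}. PiE J S)"
      define C where "C = (\<lambda>(J, x). {f \<in> space ?P. \<forall>j\<in>J. f j = x j})"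
      have "countable K"
        unfolding K_def using I S countable_Collect_finite_subset[OF I]
        by (intro countable_SIGMA countable_PiE) (auto simp: conj_commute)
      then have cnt: "countable {k\<in>K. C k \<subseteq> U}" by (rule countable_subset[rotated]) auto
      have CP: "C k \<in> sets ?P" if "k \<in> K" for k
      proof -
        obtain J x where k: "k = (J, x)" "finite J" "J \<subseteq> I" "x \<in> PiE J S"
          using \<open>k \<in> K\<close> by (auto simp: K_def)
        have "C k = prod_emb I (\<lambda>i. count_space (S i)) J (PiE J (\<lambda>j. {x j}))"
          using k(3) by (auto simp: C_def k(1) prod_emb_def space_PiM restrict_PiE_iff)
        also have "\<dots> \<in> sets ?P"
          using k(2,3,4) by (intro sets_PiM_I) auto
        finally show ?thesis .
      qed
      have "U = (\<Union>k\<in>{k\<in>K. C k \<subseteq> U}. C k)"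
      proof (intro subset_antisym subsetI)
        fix f assume f: "f \<in> U"
        have "\<exists>V. finite {i \<in> I. V i \<noteq> S i} \<and> (\<forall>i\<in>I. V i \<subseteq> S i) \<and> f \<in> PiE I V \<and> PiE I V \<subseteq> U"
          using U f unfolding openin_product_topology_alt by simp
        then obtain V where "finite {i \<in> I. V i \<noteq> S i} \<and> (\<forall>i\<in>I. V i \<subseteq> S i) \<and> f \<in> PiE I V \<and> PiE I V \<subseteq> U"
          by (rule exE)
        then have V: "finite {i \<in> I. V i \<noteq> S i}" "f \<in> PiE I V" "PiE I V \<subseteq> U" "\<And>i. i \<in> I \<Longrightarrow> V i \<subseteq> S i"
          by simp_all
        let ?J = "{i \<in> I. V i \<noteq> S i}"
        have "(?J, restrict f ?J) \<in> K"
        proof -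
          have "f i \<in> S i" if "i \<in> I" for i using PiE_mem[OF V(2) that] V(4)[OF that] by blast
          then show ?thesis using V(1) by (simp add: K_def)
        qed
        moreover have "C (?J, restrict f ?J) \<subseteq> U"
        proof -
          have "C (?J, restrict f ?J) \<subseteq> PiE I V"
          proof
            fix h assume h: "h \<in> C (?J, restrict f ?J)"
            then have hS: "h \<in> PiE I S" by (simp add: C_def space_PiM)
            have hJ: "h i = f i" if "i \<in> ?J" for i using h that by (simp add: C_def)
            show "h \<in> PiE I V"
            proof (rule PiE_I)
              fix i assume i: "i \<in> I"
              show "h i \<in> V i"
                using hJ[of i] PiE_mem[OF V(2) i] PiE_mem[OF hS i] i by (cases "V i = S i") simp_all
            qed (use hS in \<open>rule PiE_arb\<close>)
          qed
          then show ?thesis using V(3) by blast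
        qed
        moreover have "f \<in> C (?J, restrict f ?J)"
        proof -
          have "f i \<in> S i" if "i \<in> I" for i using PiE_mem[OF V(2) that] V(4)[OF that] by blast
          then have "f \<in> PiE I S" using PiE_arb[OF V(2)] by (intro PiE_I) auto
          then show ?thesis by (simp add: C_def space_PiM)
        qed
        ultimately show "f \<in> (\<Union>k\<in>{k\<in>K. C k \<subseteq> U}. C k)" by blast
      qed blast
      also have "\<dots> \<in> sets ?P"
        using cnt by (rule sets.countable_UN'') (auto intro: CP)
      finally show ?thesis .
    qed
    then have "{U. openin ?X U} \<subseteq> sets ?P" by blast
    then have "sigma_sets (space ?P) {U. openin ?X U} \<subseteq> sets ?P"
      by (rule sets.sigma_sets_subset)
    then show ?thesis by (simp add: sets_borel_of space_PiM)
  qed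
qed

lemma sets_borel_of_G:
  "sets (borel_of G_topology) = sets (PiM primes (\<lambda>p. count_space (carrier (integer_mod_group (p\<^sup>2)))))"
  unfolding G_topology_def by (rule sets_borel_of_product_discrete) auto

lemma uniform_count_measure_translate:
  assumes "group Z" "finite (carrier Z)" and g: "g \<in> carrier Z" and A: "A \<subseteq> carrier Z"
  shows "emeasure (uniform_count_measure (carrier Z)) ((\<lambda>x. g \<otimes>\<^bsub>Z\<^esub> x) -` A \<inter> carrier Z) =
    emeasure (uniform_count_measure (carrier Z)) A"
proof -
  interpret group Z by fact
  let ?B = "(\<lambda>x. g \<otimes>\<^bsub>Z\<^esub> x) -` A \<inter> carrier Z"
  have "inj_on (\<lambda>x. g \<otimes>\<^bsub>Z\<^esub> x) ?B"
    using inj_on_cmult[OF g] by (rule inj_on_subset) auto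
  moreover have "(\<lambda>x. g \<otimes>\<^bsub>Z\<^esub> x) ` ?B = A"
  proof (intro subset_antisym subsetI)
    fix a assume a: "a \<in> A"
    then have "a \<in> (\<lambda>x. g \<otimes>\<^bsub>Z\<^esub> x) ` carrier Z" using surj_const_mult[OF g] A by auto
    then show "a \<in> (\<lambda>x. g \<otimes>\<^bsub>Z\<^esub> x) ` ?B" using a by (auto intro!: imageI)
  qed auto
  ultimately have "card ?B = card A" using card_image by metis
  then show ?thesis
    using A assms(2) by (subst (1 2) emeasure_uniform_count_measure) auto
qed

lemma normalized_haar_measure_PiM_uniform: "normalized_haar_measure G_group G_topology
   (PiM primes (\<lambda>p. uniform_count_measure (carrier (integer_mod_group (p\<^sup>2)))))"
  (is "normalized_haar_measure _ _ (PiM _ ?u)")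
proof -
  let ?Z = "\<lambda>p. integer_mod_group (p\<^sup>2)"
  let ?m = "PiM primes ?u"
  have fin: "finite (carrier (?Z p))" if "p \<in> primes" for p
    using that by (auto simp: primes_def carrier_integer_mod_group)
  have ne: "carrier (?Z p) \<noteq> {}" for p
    by (metis empty_iff group.is_monoid group_integer_mod_group monoid.one_closed)
  have ps: "prob_space (?u p)" if "p \<in> primes" for p
    using fin[OF that] ne by (rule prob_space_uniform_count_measure)
  have sets_m: "sets ?m = sets (borel_of G_topology)"
    unfolding sets_borel_of_G
    by (rule sets_PiM_cong) (auto simp: sets_uniform_count_measure)
  interpret G: group G_group unfolding G_group_def by simp
  have cG: "carrier G_group = space ?m"
    by (simp add: G_group_def space_PiM space_uniform_count_measure)
  have meas: "(\<lambda>h. g \<otimes>\<^bsub>G_group\<^esub> h) \<in> measurable ?m ?m" if "g \<in> carrier G_group" for g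
  proof -
    have "(\<lambda>x. g p \<otimes>\<^bsub>?Z p\<^esub> x) \<in> measurable (?u p) (?u p)" if p: "p \<in> primes" for p
    proof -
      interpret group "?Z p" by simp
      have "g p \<in> carrier (?Z p)" using \<open>g \<in> carrier G_group\<close> p by (auto simp: G_group_def)
      then have "(\<lambda>x. g p \<otimes>\<^bsub>?Z p\<^esub> x) \<in> carrier (?Z p) \<rightarrow> carrier (?Z p)"
        by (intro funcsetI m_closed)
      then show ?thesis
        unfolding measurable_def sets_uniform_count_measure space_uniform_count_measure
        by blast
    qed
    then show ?thesis
      unfolding G_group_def mult_product_group
      by (intro measurable_restrict measurable_compose[OF measurable_component_singleton])
  qed
  have dist: "distr ?m ?m (\<lambda>h. g \<otimes>\<^bsub>G_group\<^esub> h) = ?m" if g: "g \<in> carrier G_group" for g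
  proof (rule measure_eqI_PiM_infinite[symmetric])
    interpret prob_space ?m using ps by (rule prob_space_PiM)
    show "finite_measure ?m" by unfold_locales
    fix A J assume J: "finite J" "J \<subseteq> primes" and A: "\<And>i. i \<in> J \<Longrightarrow> A i \<in> sets (?u i)"
    let ?A' = "\<lambda>i. (\<lambda>x. g i \<otimes>\<^bsub>?Z i\<^esub> x) -` A i \<inter> carrier (?Z i)"
    have gi: "g i \<in> carrier (?Z i)" if "i \<in> primes" for i
      using g that by (auto simp: G_group_def)
    have "emeasure (distr ?m ?m (\<lambda>h. g \<otimes>\<^bsub>G_group\<^esub> h)) (prod_emb primes ?u J (PiE J A)) =
      emeasure ?m ((\<lambda>h. g \<otimes>\<^bsub>G_group\<^esub> h) -` prod_emb primes ?u J (PiE J A) \<inter> space ?m)"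
      using J A by (intro emeasure_distr meas g sets_PiM_I) auto
    also have "(\<lambda>h. g \<otimes>\<^bsub>G_group\<^esub> h) -` prod_emb primes ?u J (PiE J A) \<inter> space ?m =
      prod_emb primes ?u J (PiE J ?A')"
    proof -
      have 1: "h \<in> prod_emb primes ?u J (PiE J B) \<longleftrightarrow> h \<in> space ?m \<and> (\<forall>j\<in>J. h j \<in> B j)" for h B
        using J by (auto simp: prod_emb_def space_PiM restrict_PiE_iff)
      have 2: "h \<in> space ?m \<Longrightarrow> (g \<otimes>\<^bsub>G_group\<^esub> h) \<in> space ?m" for h
        using g cG G.m_closed by metis
      have 3: "h \<in> space ?m \<Longrightarrow> j \<in> J \<Longrightarrow> (g \<otimes>\<^bsub>G_group\<^esub> h) j = g j \<otimes>\<^bsub>?Z j\<^esub> h j \<and> h j \<in> carrier (?Z j)" for h j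
        using J by (auto simp: G_group_def space_PiM space_uniform_count_measure)
      show ?thesis using 2 3 by (auto simp: 1)
    qed
    also have "emeasure ?m \<dots> = (\<Prod>i\<in>J. emeasure (?u i) (?A' i))"
      using ps J A by (intro emeasure_PiM_emb) (auto simp: sets_uniform_count_measure)
    also have "\<dots> = (\<Prod>i\<in>J. emeasure (?u i) (A i))"
    proof (rule prod.cong[OF refl])
      fix i assume i: "i \<in> J"
      then have ip: "i \<in> primes" using J by auto
      have "A i \<subseteq> carrier (?Z i)" using A[OF i] by (simp add: sets_uniform_count_measure)
      then show "emeasure (?u i) (?A' i) = emeasure (?u i) (A i)"
        by (intro uniform_count_measure_translate group_integer_mod_group fin ip gi)
    qed
    also have "\<dots> = emeasure ?m (prod_emb primes ?u J (PiE J A))"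
      using ps J A by (intro emeasure_PiM_emb[symmetric]) auto
    finally show "emeasure ?m (prod_emb primes ?u J (PiE J A)) =
      emeasure (distr ?m ?m (\<lambda>h. g \<otimes>\<^bsub>G_group\<^esub> h)) (prod_emb primes ?u J (PiE J A))" by simp
  qed simp_all
  have "emeasure ?m ((\<lambda>h. g \<otimes>\<^bsub>G_group\<^esub> h) ` A) = emeasure ?m A"
    if g: "g \<in> carrier G_group" and A: "A \<in> sets ?m" for g A
  proof -
    let ?i = "inv\<^bsub>G_group\<^esub> g"
    have As: "A \<subseteq> carrier G_group" using sets.sets_into_space[OF A] cG by simp
    have i: "?i \<in> carrier G_group" using g by simp
    have "(\<lambda>h. g \<otimes>\<^bsub>G_group\<^esub> h) ` A = (\<lambda>h. ?i \<otimes>\<^bsub>G_group\<^esub> h) -` A \<inter> space ?m"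
    proof (intro subset_antisym subsetI)
      fix h assume "h \<in> (\<lambda>h. g \<otimes>\<^bsub>G_group\<^esub> h) ` A"
      then obtain a where a: "a \<in> A" "h = g \<otimes>\<^bsub>G_group\<^esub> a" by auto
      then have "?i \<otimes>\<^bsub>G_group\<^esub> h = a" "h \<in> carrier G_group"
        using g As i G.m_assoc[of ?i g a] by auto
      then show "h \<in> (\<lambda>h. ?i \<otimes>\<^bsub>G_group\<^esub> h) -` A \<inter> space ?m" using a cG by auto
    next
      fix h assume h: "h \<in> (\<lambda>h. ?i \<otimes>\<^bsub>G_group\<^esub> h) -` A \<inter> space ?m"
      then have "h \<in> carrier G_group" using cG by auto
      then have "h = g \<otimes>\<^bsub>G_group\<^esub> (?i \<otimes>\<^bsub>G_group\<^esub> h)"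
        using g i G.m_assoc[of g ?i h] by auto
      then show "h \<in> (\<lambda>h. g \<otimes>\<^bsub>G_group\<^esub> h) ` A" using h by blast
    qed
    then show ?thesis
      using dist[OF i] emeasure_distr[OF meas[OF i] A] by simp
  qed
  then show ?thesis
    unfolding normalized_haar_measure_def
    by (intro conjI ballI sets_m prob_space_PiM ps)
qed

end

theory Submission
  imports Defs "HOL-Real_Asymp.Real_Asymp"
begin

text \<open>
  Let \<open>c\<close> be the product of \<open>1 - 1/p\<^sup>2\<close> over all primes, which is
  \<open>squarefree_density\<close>. The topological entropy of the flow, the largest entropy of an
  invariant measure and the entropy of the insertion law are all \<open>c ln 2\<close>, and the case of
  equality in one entropy estimate pins down the measure of every cylinder.

  \<^bold>\<open>The upper bound.\<close> For a point \<open>x\<close> and the finitely many primes \<open>p \<le> N\<close>, let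
  \<open>missed N x\<close> record the residue classes modulo \<open>p\<^sup>2\<close> that the support of \<open>x\<close> avoids. A
  position in a missed class carries the symbol 0, and every other position carries at most
  one bit. Under an invariant measure the missed classes of the shifted point are almost surely
  the shifted missed classes (\<open>AE_missed_left_shift\<close>), so the entropy of the first \<open>n\<close> symbols
  conditioned on the missed classes is subadditive in \<open>n\<close>. By the Kolmogorov-Sinai argument
  \<open>n\<close> times the entropy of the system is at most this conditional entropy, for every fixed
  \<open>n\<close> and \<open>N\<close> (\<open>measure_entropy_le_cond_ent\<close>). The conditional entropy is in turn at most
  \<open>ln 2\<close> times the expected number of positions that survive (\<open>cond_ent_le_survival\<close>), and
  averaging over a full period, with the Chinese remainder theorem, bounds the survival
  probability by the product over \<open>p \<le> N\<close>, since at least one class is missed for each prime.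

  \<^bold>\<open>Uniqueness.\<close> If the entropy is \<open>c ln 2\<close>, then for almost every point exactly one class is
  missed for each prime, because a second one would cost a definite factor
  (\<open>one_missed_residue\<close>). The missed classes are then those of a shifted sieve, described by a
  phase modulo the product of the \<open>p\<^sup>2\<close>; by invariance the phase is uniform. The bound on the
  conditional entropy comes from the Gibbs inequality, which retains a sum of squares of
  Hellinger type (\<open>conditional_gibbs\<close>). As \<open>N\<close> grows the two sides differ by
  at most \<open>n ln 2\<close> times the difference of the partial product and \<open>c\<close>, so the joint law of phase
  and first \<open>n\<close> symbols approaches the one given by a uniform phase and fair coin flips on
  the surviving positions. The probability of a word is therefore the limit of the explicit numbers
  \<open>phase_average N n w\<close> (\<open>maximal_word_prob\<close>), which do not depend on the measure.

  \<^bold>\<open>Existence.\<close> Given \<open>g\<close>, the insertion map writes independent fair coins on the positions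
  that \<open>g\<close> does not sieve, so cylinder probabilities of the insertion law are limits of the same
  numbers (\<open>insertion_law_word_LIMSEQ\<close>). Invariance and the lower bound
  \<open>n c ln 2\<close> for the entropy of the first \<open>n\<close> symbols follow by passing to the limit
  in finite identities. The same lower bound, compared with the number of words of length \<open>n\<close>,
  bounds the topological entropy from below; counting words phase by phase bounds it from above.
\<close>

section \<open>Entropy of random variables with finitely many values\<close>

abbreviation fibre_prob :: "'a measure \<Rightarrow> ('a \<Rightarrow> 'b) \<Rightarrow> 'b \<Rightarrow> real" where
  "fibre_prob M X v \<equiv> measure M (X -` {v} \<inter> space M)"

text \<open>
  Shannon entropy, written as the mean of the information of the fibre through a point. The
  integrand depends on the random variable only through the partition into its fibres, so
  changing the names of the values costs nothing (\<open>determines_ent_eq\<close>).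
\<close>

definition ent :: "'a measure \<Rightarrow> ('a \<Rightarrow> 'b) \<Rightarrow> real" where
  "ent M X = (\<integral>\<omega>. - ln (fibre_prob M X (X \<omega>)) \<partial>M)"

definition determines :: "'a measure \<Rightarrow> ('a \<Rightarrow> 'b) \<Rightarrow> ('a \<Rightarrow> 'c) \<Rightarrow> bool" where
  "determines M X Y \<longleftrightarrow> (\<forall>a\<in>space M. \<forall>b\<in>space M. X a = X b \<longrightarrow> Y a = Y b)"

lemma determines_ent_eq:
  assumes "determines M X Y" "determines M Y X"
  shows "ent M X = ent M Y"
  unfolding ent_def
proof (rule Bochner_Integration.integral_cong[OF refl])
  fix \<omega> assume "\<omega> \<in> space M"
  then have "X -` {X \<omega>} \<inter> space M = Y -` {Y \<omega>} \<inter> space M"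
    using assms unfolding determines_def by blast
  then show "- ln (fibre_prob M X (X \<omega>)) = - ln (fibre_prob M Y (Y \<omega>))" by simp
qed

lemma simple_function_image_finite: "simple_function M X \<Longrightarrow> finite (X ` space M)"
  by (rule simple_functionD)

lemma simple_function_fibre: "simple_function M X \<Longrightarrow> X -` {v} \<inter> space M \<in> sets M"
  by (rule simple_functionD)

lemma simple_function_Collect:
  assumes I: "finite I" and m: "\<And>i. i \<in> I \<Longrightarrow> {x \<in> space M. P i x} \<in> sets M"
  shows "simple_function M (\<lambda>x. {i\<in>I. P i x})"
  unfolding simple_function_def
proof (intro conjI ballI)
  show "finite ((\<lambda>x. {i\<in>I. P i x}) ` space M)"
    by (rule finite_subset[of _ "Pow I"]) (use I in auto)
next
  fix A
  assume "A \<in> (\<lambda>x. {i \<in> I. P i x}) ` space M"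
  then have A: "A \<subseteq> I" by auto
  have "(\<lambda>x. {i \<in> I. P i x}) -` {A} \<inter> space M = {x\<in>space M. \<forall>i\<in>I. P i x \<longleftrightarrow> i \<in> A}"
    using A by auto
  also have "\<dots> \<in> sets M"
  proof (rule sets.sets_Collect_finite_All[OF _ I])
    fix i assume i: "i \<in> I"
    show "{x \<in> space M. P i x = (i \<in> A)} \<in> sets M"
      using m[OF i] sets.sets_Collect_neg[OF m[OF i]] by (cases "i \<in> A") auto
  qed
  finally show "(\<lambda>x. {i \<in> I. P i x}) -` {A} \<inter> space M \<in> sets M" .
qed

text \<open>
  The pointwise form of the Gibbs inequality. The square is what remains of strict convexity; it
  turns near equality of entropies into closeness of distributions.
\<close>

lemma relative_entropy_term_ge:
  fixes p q :: real
  assumes "p \<ge> 0" "q \<ge> 0" "p > 0 \<Longrightarrow> q > 0"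
  shows "p - q + (sqrt p - sqrt q)\<^sup>2 \<le> p * ln p - p * ln q"
proof (cases "p = 0")
  case True then show ?thesis using assms by simp
next
  case False
  then have p: "p > 0" and q: "q > 0" using assms by auto
  \<comment> \<open>In terms of square roots the claim is \<open>ln (b / a) \<le> b / a - 1\<close>.\<close>
  define a b where "a = sqrt p" and "b = sqrt q"
  have a: "a > 0" and b: "b > 0" and pa: "p = a\<^sup>2" and qb: "q = b\<^sup>2"
    using p q by (auto simp: a_def b_def)
  have "ln (b / a) \<le> b / a - 1" using a b by (intro ln_le_minus_one) auto
  then have "ln b - ln a \<le> b / a - 1" using a b by (simp add: ln_div)
  then have "a\<^sup>2 * (ln b - ln a) \<le> a\<^sup>2 * (b / a - 1)" by (intro mult_left_mono) auto
  also have "\<dots> = a * b - a\<^sup>2" using a by (simp add: field_simps power2_eq_square)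
  finally have "a\<^sup>2 * (ln b - ln a) \<le> a * b - a\<^sup>2" .
  moreover have "ln (a\<^sup>2) = 2 * ln a" "ln (b\<^sup>2) = 2 * ln b"
    using a b by (simp_all add: ln_realpow)
  moreover have "sqrt (a\<^sup>2) = a" "sqrt (b\<^sup>2) = b" using a b by auto
  ultimately show ?thesis
    unfolding pa qb by (simp add: power2_diff algebra_simps)
qed

context prob_space
begin

lemma simple_function_expectation:
  fixes \<phi> :: "'b \<Rightarrow> real"
  assumes X: "simple_function M X" and A: "finite A" "X ` space M \<subseteq> A"
  shows "integrable M (\<lambda>\<omega>. \<phi> (X \<omega>))"
    and "(\<integral>\<omega>. \<phi> (X \<omega>) \<partial>M) = (\<Sum>v\<in>A. fibre_prob M X v * \<phi> v)"
proof -
  let ?f = "\<lambda>\<omega>. \<Sum>v\<in>A. indicator (X -` {v} \<inter> space M) \<omega> * \<phi> v"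
  have meas: "X -` {v} \<inter> space M \<in> events" for v
    using simple_function_fibre[OF X] .
  have eq: "\<phi> (X \<omega>) = ?f \<omega>" if "\<omega> \<in> space M" for \<omega>
  proof -
    have "?f \<omega> = (\<Sum>v\<in>A. if v = X \<omega> then \<phi> v else 0)"
      using that by (intro sum.cong) (auto simp: indicator_def)
    also have "\<dots> = \<phi> (X \<omega>)"
      using A that by (subst sum.delta) auto
    finally show ?thesis by simp
  qed
  have int: "integrable M (\<lambda>\<omega>. indicator (X -` {v} \<inter> space M) \<omega> * \<phi> v)" for v
    using meas[of v] by (intro integrable_mult_left integrable_real_indicator) (auto simp: emeasure_eq_measure)
  have "integrable M ?f" using int by auto
  then show "integrable M (\<lambda>\<omega>. \<phi> (X \<omega>))"
    using eq by (subst Bochner_Integration.integrable_cong[OF refl eq]) auto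
  have "(\<integral>\<omega>. \<phi> (X \<omega>) \<partial>M) = (\<integral>\<omega>. ?f \<omega> \<partial>M)"
    by (rule Bochner_Integration.integral_cong[OF refl eq])
  also have "\<dots> = (\<Sum>v\<in>A. (\<integral>\<omega>. indicator (X -` {v} \<inter> space M) \<omega> * \<phi> v \<partial>M))"
    using int by (intro Bochner_Integration.integral_sum)
  also have "\<dots> = (\<Sum>v\<in>A. fibre_prob M X v * \<phi> v)"
    using meas by (intro sum.cong refl) (simp add: Int_absorb2)
  finally show "(\<integral>\<omega>. \<phi> (X \<omega>) \<partial>M) = (\<Sum>v\<in>A. fibre_prob M X v * \<phi> v)" .
qed

lemma ent_eq_sum:
  assumes "simple_function M X" "finite A" "X ` space M \<subseteq> A"
  shows "ent M X = - (\<Sum>v\<in>A. fibre_prob M X v * ln (fibre_prob M X v))"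
  unfolding ent_def
  by (subst simple_function_expectation(2)[OF assms, where \<phi> = "\<lambda>v. - ln (fibre_prob M X v)"])
     (simp add: sum_negf)

lemma integrable_info:
  assumes "simple_function M X"
  shows "integrable M (\<lambda>\<omega>. - ln (fibre_prob M X (X \<omega>)))"
  by (rule simple_function_expectation(1)[OF assms simple_function_image_finite[OF assms] order_refl])

lemma sum_fibre_prob:
  assumes "simple_function M X" "finite A" "X ` space M \<subseteq> A"
  shows "(\<Sum>v\<in>A. fibre_prob M X v) = 1"
  using simple_function_expectation(2)[OF assms, where \<phi> = "\<lambda>_. 1"] by (simp add: prob_space)

lemma sum_fibre_prob_Pair:
  assumes X: "simple_function M X" and Y: "simple_function M Y"
    and A: "finite A" "X ` space M \<subseteq> A"
  shows "(\<Sum>x\<in>A. fibre_prob M (\<lambda>\<omega>. (X \<omega>, Y \<omega>)) (x, y)) = fibre_prob M Y y"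
proof -
  have "fibre_prob M Y y = measure M (\<Union>x\<in>A. (\<lambda>\<omega>. (X \<omega>, Y \<omega>)) -` {(x, y)} \<inter> space M)"
    using A(2) by (intro arg_cong[where f = "measure M"]) auto
  also have "\<dots> = (\<Sum>x\<in>A. fibre_prob M (\<lambda>\<omega>. (X \<omega>, Y \<omega>)) (x, y))"
    using A(1) simple_function_fibre[OF simple_function_Pair[OF X Y]]
    by (intro finite_measure_finite_Union) (auto simp: disjoint_family_on_def)
  finally show ?thesis by simp
qed

lemma AE_fibre_prob_pos:
  assumes X: "simple_function M X"
  shows "AE \<omega> in M. fibre_prob M X (X \<omega>) > 0"
proof -
  have "AE \<omega> in M. \<forall>v\<in>X ` space M. fibre_prob M X v = 0 \<longrightarrow> X \<omega> \<noteq> v"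
  proof (rule AE_finite_allI[OF simple_function_image_finite[OF X]])
    fix v
    show "AE \<omega> in M. fibre_prob M X v = 0 \<longrightarrow> X \<omega> \<noteq> v"
    proof (cases "fibre_prob M X v = 0")
      case True
      then have "X -` {v} \<inter> space M \<in> null_sets M"
        using simple_function_fibre[OF X] by (intro null_setsI) (auto simp: emeasure_eq_measure)
      then have "AE \<omega> in M. \<omega> \<notin> X -` {v} \<inter> space M" by (rule AE_not_in)
      then show ?thesis by (rule AE_mp) auto
    qed simp
  qed
  then show ?thesis
    by (rule AE_mp) (auto simp: zero_less_measure_iff)
qed

text \<open>
  The conditional law of \<open>X\<close> given \<open>Y\<close> is compared with a model \<open>s\<close>: coding \<open>X\<close> with the code
  that is optimal for the model costs at least the conditional entropy, and the excess controls the
  squared Hellinger distance of the joint law from the law that the model predicts. Suitable models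
  give the inequalities for conditional entropy below.
\<close>

lemma conditional_gibbs:
  fixes s :: "'b \<Rightarrow> 'c \<Rightarrow> real"
  assumes X: "simple_function M X" and Y: "simple_function M Y"
    and A: "finite A" "X ` space M \<subseteq> A" and B: "finite B" "Y ` space M \<subseteq> B"
    and s0: "\<And>x y. x \<in> A \<Longrightarrow> y \<in> B \<Longrightarrow> s x y \<ge> 0"
    and spos: "\<And>x y. x \<in> A \<Longrightarrow> y \<in> B \<Longrightarrow> fibre_prob M (\<lambda>\<omega>. (X \<omega>, Y \<omega>)) (x, y) > 0 \<Longrightarrow> s x y > 0"
    and s1: "\<And>y. y \<in> B \<Longrightarrow> (\<Sum>x\<in>A. s x y) \<le> 1"
  shows "ent M (\<lambda>\<omega>. (X \<omega>, Y \<omega>)) - ent M Y +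
      (\<Sum>(x, y)\<in>A \<times> B. (sqrt (fibre_prob M (\<lambda>\<omega>. (X \<omega>, Y \<omega>)) (x, y)) - sqrt (fibre_prob M Y y * s x y))\<^sup>2)
    \<le> (\<integral>\<omega>. - ln (s (X \<omega>) (Y \<omega>)) \<partial>M)"
proof -
  let ?XY = "\<lambda>\<omega>. (X \<omega>, Y \<omega>)"
  define p where "p = fibre_prob M ?XY"
  define pY where "pY = fibre_prob M Y"
  have XY: "simple_function M ?XY" using X Y by (rule simple_function_Pair)
  have AB: "finite (A \<times> B)" "?XY ` space M \<subseteq> A \<times> B" using A B by auto
  have marg: "(\<Sum>x\<in>A. p (x, y)) = pY y" for y
    unfolding p_def pY_def by (rule sum_fibre_prob_Pair[OF X Y A])
  have p0: "p v \<ge> 0" and pY0: "pY y \<ge> 0" for v y by (auto simp: p_def pY_def)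
  have p_le: "p (x, y) \<le> pY y" if "x \<in> A" for x y
    unfolding marg[symmetric] using A(1) that p0 by (intro member_le_sum) auto
  have bnd: "p (x, y) - pY y * s x y + (sqrt (p (x, y)) - sqrt (pY y * s x y))\<^sup>2
      \<le> p (x, y) * (ln (p (x, y)) - ln (pY y) - ln (s x y))" if "x \<in> A" "y \<in> B" for x y
  proof -
    have pos: "pY y > 0 \<and> s x y > 0" if "p (x, y) > 0"
      using spos[OF \<open>x \<in> A\<close> \<open>y \<in> B\<close>] that p_le[OF \<open>x \<in> A\<close>, of y] by (auto simp: p_def)
    have "p (x, y) - pY y * s x y + (sqrt (p (x, y)) - sqrt (pY y * s x y))\<^sup>2
      \<le> p (x, y) * ln (p (x, y)) - p (x, y) * ln (pY y * s x y)"
      using pos s0[OF that] p0 pY0 by (intro relative_entropy_term_ge) auto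
    also have "\<dots> = p (x, y) * (ln (p (x, y)) - ln (pY y) - ln (s x y))"
      using pos p0[of "(x, y)"] by (cases "p (x, y) = 0") (auto simp: ln_mult algebra_simps)
    finally show ?thesis .
  qed
  have sump: "(\<Sum>(x, y)\<in>A \<times> B. p (x, y)) = 1"
    using sum_fibre_prob[OF XY AB] by (simp add: p_def case_prod_unfold)
  have sumq: "(\<Sum>(x, y)\<in>A \<times> B. pY y * s x y) \<le> 1"
  proof -
    have "(\<Sum>(x, y)\<in>A \<times> B. pY y * s x y) = (\<Sum>y\<in>B. pY y * (\<Sum>x\<in>A. s x y))"
      by (simp add: sum.cartesian_product[symmetric] sum.swap[of _ A] sum_distrib_left)
    also have "\<dots> \<le> (\<Sum>y\<in>B. pY y * 1)"
      using s1 pY0 by (intro sum_mono mult_left_mono) auto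
    also have "\<dots> = 1" using sum_fibre_prob[OF Y B] by (simp add: pY_def)
    finally show ?thesis .
  qed
  have "(\<Sum>(x, y)\<in>A \<times> B. (sqrt (p (x, y)) - sqrt (pY y * s x y))\<^sup>2)
      \<le> (\<Sum>(x, y)\<in>A \<times> B. p (x, y) * (ln (p (x, y)) - ln (pY y) - ln (s x y)) - p (x, y) + pY y * s x y)"
    using bnd by (intro sum_mono) fastforce
  also have "\<dots> = (\<Sum>(x, y)\<in>A \<times> B. p (x, y) * (ln (p (x, y)) - ln (pY y) - ln (s x y)))
      - (\<Sum>(x, y)\<in>A \<times> B. p (x, y)) + (\<Sum>(x, y)\<in>A \<times> B. pY y * s x y)"
    by (simp add: case_prod_unfold sum.distrib sum_subtractf)
  also have "\<dots> \<le> (\<Sum>v\<in>A \<times> B. p v * (ln (p v) - ln (pY (snd v)) - ln (s (fst v) (snd v))))"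
    using sump sumq by (simp add: case_prod_unfold)
  also have "\<dots> = (\<integral>\<omega>. ln (p (?XY \<omega>)) - ln (pY (Y \<omega>)) - ln (s (X \<omega>) (Y \<omega>)) \<partial>M)"
    using simple_function_expectation(2)[OF XY AB,
        where \<phi> = "\<lambda>v. ln (p v) - ln (pY (snd v)) - ln (s (fst v) (snd v))"]
    by (simp add: p_def)
  also have "\<dots> = - ent M ?XY + ent M Y + (\<integral>\<omega>. - ln (s (X \<omega>) (Y \<omega>)) \<partial>M)"
  proof -
    have 1: "integrable M (\<lambda>\<omega>. ln (p (?XY \<omega>)))" "integrable M (\<lambda>\<omega>. ln (pY (Y \<omega>)))"
        "integrable M (\<lambda>\<omega>. ln (s (X \<omega>) (Y \<omega>)))"
      using simple_function_expectation(1)[OF XY AB, where \<phi> = "\<lambda>v. ln (p v)"]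
        simple_function_expectation(1)[OF XY AB, where \<phi> = "\<lambda>v. ln (pY (snd v))"]
        simple_function_expectation(1)[OF XY AB, where \<phi> = "\<lambda>v. ln (s (fst v) (snd v))"] by auto
    then show ?thesis unfolding ent_def p_def pY_def by simp
  qed
  finally show ?thesis unfolding p_def pY_def by simp
qed

lemma ent_mono:
  assumes X: "simple_function M X" and Y: "simple_function M Y" and d: "determines M X Y"
  shows "ent M Y \<le> ent M X"
  unfolding ent_def
proof (rule integral_mono_AE[OF integrable_info[OF Y] integrable_info[OF X]])
  show "AE \<omega> in M. - ln (fibre_prob M Y (Y \<omega>)) \<le> - ln (fibre_prob M X (X \<omega>))"
    using AE_fibre_prob_pos[OF X] AE_space
  proof eventually_elim
    case (elim \<omega>)
    have "fibre_prob M X (X \<omega>) \<le> fibre_prob M Y (Y \<omega>)"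
    proof (rule finite_measure_mono[OF _ simple_function_fibre[OF Y]])
      show "X -` {X \<omega>} \<inter> space M \<subseteq> Y -` {Y \<omega>} \<inter> space M"
        using d elim(2) unfolding determines_def by blast
    qed
    then show ?case using elim(1) by simp
  qed
qed

text \<open>
  Conditioning on more information decreases conditional entropy: the model is the conditional law
  of \<open>X\<close> given the coarser variable \<open>Z\<close>.
\<close>

lemma ent_Pair_diff_antimono:
  assumes X: "simple_function M X" and Y: "simple_function M Y" and Z: "simple_function M Z"
    and d: "determines M Y Z"
  shows "ent M (\<lambda>\<omega>. (X \<omega>, Y \<omega>)) - ent M Y \<le> ent M (\<lambda>\<omega>. (X \<omega>, Z \<omega>)) - ent M Z"
proof -
  define h where "h = (\<lambda>y. Z (SOME \<omega>. \<omega> \<in> space M \<and> Y \<omega> = y))"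
  have h: "Z \<omega> = h (Y \<omega>)" if "\<omega> \<in> space M" for \<omega>
  proof -
    have "\<exists>\<omega>'. \<omega>' \<in> space M \<and> Y \<omega>' = Y \<omega>" using that by blast
    from someI_ex[OF this] show ?thesis using d that unfolding h_def determines_def by metis
  qed
  let ?A = "X ` space M" and ?B = "Y ` space M"
  define s where "s = (\<lambda>x y. fibre_prob M (\<lambda>\<omega>. (X \<omega>, Z \<omega>)) (x, h y) / fibre_prob M Z (h y))"
  have XZ: "simple_function M (\<lambda>\<omega>. (X \<omega>, Z \<omega>))" using X Z by (rule simple_function_Pair)
  have fin: "finite ?A" "finite ?B" using X Y by (auto simp: simple_functionD)
  have "ent M (\<lambda>\<omega>. (X \<omega>, Y \<omega>)) - ent M Y \<le> ent M (\<lambda>\<omega>. (X \<omega>, Y \<omega>)) - ent M Y +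
      (\<Sum>(x, y)\<in>?A \<times> ?B. (sqrt (fibre_prob M (\<lambda>\<omega>. (X \<omega>, Y \<omega>)) (x, y)) - sqrt (fibre_prob M Y y * s x y))\<^sup>2)"
    by (auto intro!: sum_nonneg)
  also have "\<dots> \<le> (\<integral>\<omega>. - ln (s (X \<omega>) (Y \<omega>)) \<partial>M)"
  proof (rule conditional_gibbs[OF X Y fin(1) order_refl fin(2) order_refl])
    fix x y assume xy: "x \<in> ?A" "y \<in> ?B"
    show "s x y \<ge> 0" by (simp add: s_def)
    assume pos: "fibre_prob M (\<lambda>\<omega>. (X \<omega>, Y \<omega>)) (x, y) > 0"
    have "fibre_prob M (\<lambda>\<omega>. (X \<omega>, Y \<omega>)) (x, y) \<le> fibre_prob M (\<lambda>\<omega>. (X \<omega>, Z \<omega>)) (x, h y)"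
      using simple_function_fibre[OF XZ] h by (intro finite_measure_mono) auto
    moreover have "\<dots> \<le> fibre_prob M Z (h y)"
      using simple_function_fibre[OF Z] by (intro finite_measure_mono) auto
    ultimately show "s x y > 0" using pos unfolding s_def by (intro divide_pos_pos) linarith+
  next
    fix y assume "y \<in> ?B"
    have "(\<Sum>x\<in>?A. s x y) = (\<Sum>x\<in>?A. fibre_prob M (\<lambda>\<omega>. (X \<omega>, Z \<omega>)) (x, h y)) / fibre_prob M Z (h y)"
      by (simp add: s_def sum_divide_distrib)
    also have "\<dots> \<le> 1" by (subst sum_fibre_prob_Pair[OF X Z fin(1) order_refl]) simp
    finally show "(\<Sum>x\<in>?A. s x y) \<le> 1" .
  qed
  also have "\<dots> = (\<integral>\<omega>. - ln (fibre_prob M (\<lambda>\<omega>. (X \<omega>, Z \<omega>)) (X \<omega>, Z \<omega>)) - (- ln (fibre_prob M Z (Z \<omega>))) \<partial>M)"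
  proof (rule integral_cong_AE)
    show "(\<lambda>x. - ln (s (X x) (Y x))) \<in> borel_measurable M"
      using borel_measurable_integrable[OF simple_function_expectation(1)[OF simple_function_Pair[OF X Y]
        simple_functionD(1)[OF simple_function_Pair[OF X Y]] order_refl, where \<phi> = "\<lambda>(x, y). - ln (s x y)"]]
      by simp
    show "(\<lambda>\<omega>. - ln (fibre_prob M (\<lambda>\<omega>. (X \<omega>, Z \<omega>)) (X \<omega>, Z \<omega>)) - (- ln (fibre_prob M Z (Z \<omega>)))) \<in> borel_measurable M"
      by (intro borel_measurable_diff borel_measurable_integrable integrable_info[OF Z] integrable_info[OF XZ])
    show "AE \<omega> in M. - ln (s (X \<omega>) (Y \<omega>)) =
      - ln (fibre_prob M (\<lambda>\<omega>. (X \<omega>, Z \<omega>)) (X \<omega>, Z \<omega>)) - (- ln (fibre_prob M Z (Z \<omega>)))"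
      using AE_fibre_prob_pos[OF XZ] AE_fibre_prob_pos[OF Z] AE_space
      by eventually_elim (simp add: s_def h[symmetric] ln_div)
  qed
  also have "\<dots> = ent M (\<lambda>\<omega>. (X \<omega>, Z \<omega>)) - ent M Z"
    unfolding ent_def by (intro Bochner_Integration.integral_diff integrable_info[OF Z] integrable_info[OF XZ])
  finally show ?thesis .
qed

text \<open>
  A variant of the Fano inequality. The model guesses that \<open>X\<close> equals \<open>Y\<close> with probability
  \<open>1 - d\<close> and gives each other value the mass \<open>d / k\<close>.
\<close>

lemma ent_fano:
  fixes d :: real and X Y :: "'a \<Rightarrow> nat"
  assumes X: "simple_function M X" and Y: "simple_function M Y"
    and k: "k \<ge> 1" "\<And>\<omega>. \<omega> \<in> space M \<Longrightarrow> X \<omega> < k"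
    and d: "0 < d" "d < 1"
  shows "ent M (\<lambda>\<omega>. (X \<omega>, Y \<omega>)) - ent M Y
    \<le> - ln (1 - d) + measure M {\<omega>\<in>space M. X \<omega> \<noteq> Y \<omega>} * ln (real k / d)"
proof -
  let ?A = "{..<k}" and ?B = "Y ` space M"
  define s where "s = (\<lambda>x y :: nat. if x = y then 1 - d else d / k)"
  have fin: "finite ?A" "X ` space M \<subseteq> ?A" "finite ?B" using k Y by (auto simp: simple_functionD)
  have N: "{\<omega>\<in>space M. X \<omega> \<noteq> Y \<omega>} \<in> sets M"
  proof -
    have "{\<omega>\<in>space M. X \<omega> \<noteq> Y \<omega>} = space M - (\<lambda>\<omega>. X \<omega> = Y \<omega>) -` {True} \<inter> space M" by auto
    then show ?thesis
      using simple_function_fibre[OF simple_function_compose2[OF X Y, of "(=)"], of True] by auto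
  qed
  have "ent M (\<lambda>\<omega>. (X \<omega>, Y \<omega>)) - ent M Y \<le> ent M (\<lambda>\<omega>. (X \<omega>, Y \<omega>)) - ent M Y +
      (\<Sum>(x, y)\<in>?A \<times> ?B. (sqrt (fibre_prob M (\<lambda>\<omega>. (X \<omega>, Y \<omega>)) (x, y)) - sqrt (fibre_prob M Y y * s x y))\<^sup>2)"
    by (auto intro!: sum_nonneg)
  also have "\<dots> \<le> (\<integral>\<omega>. - ln (s (X \<omega>) (Y \<omega>)) \<partial>M)"
  proof (rule conditional_gibbs[OF X Y fin order_refl])
    show "s x y \<ge> 0" "s x y > 0" for x y using d k by (auto simp: s_def)
    fix y
    have "(\<Sum>x<k. s x y) \<le> (\<Sum>x<k. (if x = y then 1 - d else 0) + d / k)"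
      using d by (intro sum_mono) (auto simp: s_def)
    also have "\<dots> \<le> 1" using k d by (simp add: sum.distrib sum.delta)
    finally show "(\<Sum>x<k. s x y) \<le> 1" .
  qed
  also have "\<dots> \<le> (\<integral>\<omega>. - ln (1 - d) + indicator {\<omega>\<in>space M. X \<omega> \<noteq> Y \<omega>} \<omega> * ln (real k / d) \<partial>M)"
  proof (rule integral_mono)
    show "integrable M (\<lambda>\<omega>. - ln (s (X \<omega>) (Y \<omega>)))"
      using simple_function_expectation(1)[OF simple_function_Pair[OF X Y]
        simple_functionD(1)[OF simple_function_Pair[OF X Y]] order_refl, where \<phi> = "\<lambda>(x, y). - ln (s x y)"]
      by simp
    show "integrable M (\<lambda>\<omega>. - ln (1 - d) + indicator {\<omega>\<in>space M. X \<omega> \<noteq> Y \<omega>} \<omega> * ln (real k / d))"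
      using N by (intro Bochner_Integration.integrable_add integrable_mult_left integrable_real_indicator)
        (auto simp: emeasure_eq_measure)
    fix \<omega> assume "\<omega> \<in> space M"
    have "- ln (d / k) = ln (real k / d)" "ln (1 - d) \<le> 0" using d k by (auto simp: ln_div)
    then show "- ln (s (X \<omega>) (Y \<omega>)) \<le> - ln (1 - d) + indicator {\<omega>\<in>space M. X \<omega> \<noteq> Y \<omega>} \<omega> * ln (real k / d)"
      using \<open>\<omega> \<in> space M\<close> by (auto simp: s_def)
  qed
  also have "\<dots> = - ln (1 - d) + measure M {\<omega>\<in>space M. X \<omega> \<noteq> Y \<omega>} * ln (real k / d)"
  proof -
    have "integrable M (\<lambda>\<omega>. indicator {\<omega>\<in>space M. X \<omega> \<noteq> Y \<omega>} \<omega> * ln (real k / d))"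
      using N by (intro integrable_mult_left integrable_real_indicator) (auto simp: emeasure_eq_measure)
    then show ?thesis
      using N by (subst Bochner_Integration.integral_add) (auto simp: prob_space Int_absorb2)
  qed
  finally show ?thesis .
qed

lemma ent_const: "ent M (\<lambda>_. c) = 0"
  by (simp add: ent_def prob_space vimage_const)

lemma ent_le_card:
  assumes X: "simple_function M X" and A: "finite A" "X ` space M \<subseteq> A"
  shows "ent M X \<le> ln (card A)"
proof -
  have "A \<noteq> {}" using A not_empty by auto
  then have cA: "card A > 0" using A by (simp add: card_gt_0_iff)
  have "ent M X = ent M (\<lambda>\<omega>. (X \<omega>, ())) - ent M (\<lambda>_. ())"
    using determines_ent_eq[of M X "\<lambda>\<omega>. (X \<omega>, ())"] by (simp add: ent_const determines_def)
  also have "\<dots> \<le> ent M (\<lambda>\<omega>. (X \<omega>, ())) - ent M (\<lambda>_. ()) +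
      (\<Sum>(x, y)\<in>A \<times> {()}. (sqrt (fibre_prob M (\<lambda>\<omega>. (X \<omega>, ())) (x, y)) - sqrt (fibre_prob M (\<lambda>_. ()) y * (1 / card A)))\<^sup>2)"
    by (auto intro!: sum_nonneg)
  also have "\<dots> \<le> (\<integral>\<omega>. - ln (1 / card A) \<partial>M)"
    using cA by (intro conditional_gibbs[OF X _ A, where s = "\<lambda>_ _. 1 / card A"]) auto
  also have "\<dots> = ln (card A)" using cA by (simp add: ln_div prob_space)
  finally show ?thesis .
qed

lemma ent_AE_cong:
  assumes X: "simple_function M X" and Y: "simple_function M Y" and eq: "AE \<omega> in M. X \<omega> = Y \<omega>"
  shows "ent M X = ent M Y"
proof -
  have "fibre_prob M X v = fibre_prob M Y v" for v
    by (rule measure_eq_AE[OF _ simple_function_fibre[OF X] simple_function_fibre[OF Y]])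
       (use eq AE_space in \<open>eventually_elim, auto\<close>)
  then have "AE \<omega> in M. - ln (fibre_prob M X (X \<omega>)) = - ln (fibre_prob M Y (Y \<omega>))"
    using eq by auto
  then show ?thesis
    unfolding ent_def
    by (rule integral_cong_AE[OF borel_measurable_integrable[OF integrable_info[OF X]]
        borel_measurable_integrable[OF integrable_info[OF Y]]])
qed

lemma ent_measure_preserving:
  assumes X: "simple_function M X" and T: "T \<in> measurable M M" "distr M M T = M"
  shows "ent M (\<lambda>\<omega>. X (T \<omega>)) = ent M X"
proof -
  have Tsp: "T \<omega> \<in> space M" if "\<omega> \<in> space M" for \<omega> using T(1) that by (rule measurable_space)
  have f: "fibre_prob M (\<lambda>\<omega>. X (T \<omega>)) v = fibre_prob M X v" for v
  proof -
    have "(\<lambda>\<omega>. X (T \<omega>)) -` {v} \<inter> space M = T -` (X -` {v} \<inter> space M) \<inter> space M"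
      using Tsp by auto
    then show ?thesis
      using measure_distr[OF T(1) simple_function_fibre[OF X], of v] T(2) by simp
  qed
  have "ent M X = (\<integral>\<omega>. - ln (fibre_prob M X (X \<omega>)) \<partial>(distr M M T))"
    unfolding T(2) by (simp only: ent_def)
  also have "\<dots> = (\<integral>\<omega>. - ln (fibre_prob M X (X (T \<omega>))) \<partial>M)"
    by (intro integral_distr T(1) borel_measurable_integrable integrable_info X)
  finally show ?thesis unfolding ent_def f by simp
qed

end

lemma simple_function_measure_preserving:
  assumes X: "simple_function M X" and T: "T \<in> measurable M M"
  shows "simple_function M (\<lambda>\<omega>. X (T \<omega>))"
  using simple_function_comp[OF T X] by (simp add: o_def)

section \<open>Counting sieved positions in a period\<close>

definition small_primes :: "nat \<Rightarrow> nat set" where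
  "small_primes N = {p \<in> primes. p \<le> N}"

definition modulus :: "nat \<Rightarrow> nat" where
  "modulus N = (\<Prod>p\<in>small_primes N. p\<^sup>2)"

definition sieve_density :: "nat \<Rightarrow> real" where
  "sieve_density N = (\<Prod>p\<in>small_primes N. 1 - 1 / real (p\<^sup>2))"

text \<open>
  The product of \<open>1 - 1/p\<^sup>2\<close> over all primes, as the limit of its decreasing partial products.
\<close>

definition squarefree_density :: real where
  "squarefree_density = lim sieve_density"

lemma finite_small_primes [simp]: "finite (small_primes N)"
  by (rule finite_subset[of _ "{..N}"]) (auto simp: small_primes_def)

lemma small_primes_ge_2: "p \<in> small_primes N \<Longrightarrow> p \<ge> 2"
  by (auto simp: small_primes_def primes_def prime_ge_2_nat)

lemma primes_ge_2: "p \<in> primes \<Longrightarrow> p \<ge> 2"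
  by (auto simp: primes_def prime_ge_2_nat)

lemma small_primes_pos [simp]: "p \<in> small_primes N \<Longrightarrow> 0 < p"
  by (auto dest: small_primes_ge_2)

lemma modulus_pos [simp]: "modulus N > 0"
  unfolding modulus_def by (rule prod_pos) simp

lemma small_primes_square_dvd_modulus: "p \<in> small_primes N \<Longrightarrow> p\<^sup>2 dvd modulus N"
  unfolding modulus_def by (rule dvd_prodI) auto

lemma coprime_prime_squares:
  assumes "p \<in> small_primes N" "q \<in> small_primes N" "p \<noteq> q"
  shows "coprime (p\<^sup>2) (q\<^sup>2)"
  using assms by (simp add: small_primes_def primes_def primes_coprime)

lemma cong_modulus_iff:
  "[i = j] (mod modulus N) \<longleftrightarrow> (\<forall>p\<in>small_primes N. i mod p\<^sup>2 = j mod p\<^sup>2)"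
proof
  assume "[i = j] (mod modulus N)"
  from cong_dvd_modulus_nat[OF this small_primes_square_dvd_modulus]
  show "\<forall>p\<in>small_primes N. i mod p\<^sup>2 = j mod p\<^sup>2"
    unfolding cong_def by blast
next
  assume "\<forall>p\<in>small_primes N. i mod p\<^sup>2 = j mod p\<^sup>2"
  then show "[i = j] (mod modulus N)"
    unfolding modulus_def
    by (intro coprime_cong_prod_nat) (auto simp only: cong_def intro: coprime_prime_squares)
qed

lemma inj_on_mod_interval: "inj_on (\<lambda>j :: nat. j mod Q) {a..<a + Q}"
proof (rule linorder_inj_onI)
  fix i j assume "i < j" "i \<in> {a..<a + Q}" "j \<in> {a..<a + Q}"
  then have "j - i < Q" "0 < j - i" by auto
  then have "\<not> Q dvd j - i" by (auto dest: dvd_imp_le)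
  moreover have "Q dvd j - i" if "i mod Q = j mod Q"
    using that \<open>i < j\<close> mod_eq_dvd_iff_nat[of i j Q] by simp
  ultimately show "i mod Q \<noteq> j mod Q" by auto
qed auto

text \<open>
  The Chinese remainder theorem by counting: the map is injective, and both sides have
  \<open>modulus N\<close> elements.
\<close>

lemma chinese_remainder_bij_betw:
  "bij_betw (\<lambda>j. \<lambda>p\<in>small_primes N. j mod p\<^sup>2) {a..<a + modulus N}
     (PiE (small_primes N) (\<lambda>p. {..<p\<^sup>2}))"
  (is "bij_betw ?f ?A ?B")
proof -
  have inj: "inj_on ?f ?A"
  proof (rule inj_onI)
    fix i j assume ij: "i \<in> ?A" "j \<in> ?A" "?f i = ?f j"
    have "i mod p\<^sup>2 = j mod p\<^sup>2" if "p \<in> small_primes N" for p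
      using fun_cong[OF ij(3), of p] that by simp
    then have "i mod modulus N = j mod modulus N"
      using cong_modulus_iff by (simp add: cong_def)
    then show "i = j" using inj_onD[OF inj_on_mod_interval] ij by blast
  qed
  have sub: "?f ` ?A \<subseteq> ?B" by auto
  have fin: "finite ?B" by (intro finite_PiE) auto
  have "card ?B = modulus N" by (simp add: card_PiE modulus_def)
  then have "card (?f ` ?A) = card ?B" by (simp add: card_image[OF inj])
  then have "?f ` ?A = ?B" using sub fin by (simp add: card_subset_eq)
  then show ?thesis using inj by (simp add: bij_betw_def)
qed

lemma card_residues_in:
  assumes "\<And>p. p \<in> small_primes N \<Longrightarrow> E p \<subseteq> {..<p\<^sup>2}"
  shows "card {j\<in>{a..<a + modulus N}. \<forall>p\<in>small_primes N. j mod p\<^sup>2 \<in> E p} =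
    (\<Prod>p\<in>small_primes N. card (E p))"
proof -
  let ?f = "\<lambda>j. \<lambda>p\<in>small_primes N. j mod p\<^sup>2" and ?A = "{a..<a + modulus N}"
  note b = chinese_remainder_bij_betw[of N a]
  have "?f ` {j\<in>?A. \<forall>p\<in>small_primes N. j mod p\<^sup>2 \<in> E p} = PiE (small_primes N) E" (is "?f ` ?S = ?E")
  proof (intro subset_antisym subsetI)
    fix h assume h: "h \<in> ?E"
    have "?E \<subseteq> PiE (small_primes N) (\<lambda>p. {..<p\<^sup>2})"
      using assms by (rule PiE_mono)
    then have "h \<in> ?f ` ?A" using h b by (auto simp: bij_betw_def)
    then obtain j where j: "j \<in> ?A" "h = ?f j" by blast
    then have "j \<in> ?S" using h by auto
    then show "h \<in> ?f ` ?S" using j by blast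
  qed auto
  moreover have "inj_on ?f ?S" using b by (auto simp: bij_betw_def intro: inj_on_subset)
  ultimately have "card ?S = card ?E" using card_image by fastforce
  then show ?thesis by (simp add: card_PiE)
qed

text \<open>
  A choice of residue classes modulo \<open>p\<^sup>2\<close> for each prime \<open>p \<le> N\<close>, stored as the set of all pairs
  of a prime and a natural number in one of its classes. With periodic sets in place of residues,
  shifting a sequence becomes subtraction in the second component.
\<close>

definition residue_relation :: "nat \<Rightarrow> (nat \<times> nat) set \<Rightarrow> bool" where
  "residue_relation N R \<longleftrightarrow> R \<subseteq> small_primes N \<times> UNIV \<and>
     (\<forall>p\<in>small_primes N. \<forall>j. (p, j) \<in> R \<longleftrightarrow> (p, j mod p\<^sup>2) \<in> R)"

lemma simple_function_residue_relation:
  assumes f: "\<And>x. residue_relation N (f x)"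
    and m: "\<And>p r. p \<in> small_primes N \<Longrightarrow> {x \<in> space M. (p, r) \<in> f x} \<in> sets M"
  shows "simple_function M f"
proof -
  let ?I = "SIGMA p:small_primes N. {..<p\<^sup>2}"
  have "simple_function M (\<lambda>x. {i \<in> ?I. i \<in> f x})"
    by (rule simple_function_Collect) (auto intro: m)
  from simple_function_compose1[OF this, of "\<lambda>A. {(p, j). (p, j mod p\<^sup>2) \<in> A}"]
  have "simple_function M (\<lambda>x. {(p, j). (p, j mod p\<^sup>2) \<in> {i \<in> ?I. i \<in> f x}})" .
  moreover have "{(p, j). (p, j mod p\<^sup>2) \<in> {i \<in> ?I. i \<in> f x}} = f x" for x
  proof -
    have "(p, j) \<in> f x \<longleftrightarrow> p \<in> small_primes N \<and> (p, j mod p\<^sup>2) \<in> f x" for p j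
      using f[of x] unfolding residue_relation_def by blast
    moreover have "(p, j mod p\<^sup>2) \<in> ?I \<longleftrightarrow> p \<in> small_primes N" for p j by auto
    ultimately show ?thesis by blast
  qed
  ultimately show ?thesis by simp
qed

definition survives :: "(nat \<times> nat) set \<Rightarrow> nat \<Rightarrow> bool" where
  "survives R j \<longleftrightarrow> (\<forall>p. (p, j) \<notin> R)"

definition residues :: "(nat \<times> nat) set \<Rightarrow> nat \<Rightarrow> nat set" where
  "residues R p = {r\<in>{..<p\<^sup>2}. (p, r) \<in> R}"

lemma survives_iff_residues:
  assumes "residue_relation N R"
  shows "survives R j \<longleftrightarrow> (\<forall>p\<in>small_primes N. j mod p\<^sup>2 \<in> {..<p\<^sup>2} - residues R p)"
proof -
  have "survives R j \<longleftrightarrow> (\<forall>p\<in>small_primes N. (p, j mod p\<^sup>2) \<notin> R)"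
    using assms unfolding survives_def residue_relation_def by blast
  also have "\<dots> \<longleftrightarrow> (\<forall>p\<in>small_primes N. j mod p\<^sup>2 \<in> {..<p\<^sup>2} - residues R p)"
    by (intro ball_cong refl) (simp add: residues_def)
  finally show ?thesis .
qed

lemma card_survivors_period:
  assumes "residue_relation N R"
  shows "card {j\<in>{a..<a + modulus N}. survives R j} =
    (\<Prod>p\<in>small_primes N. p\<^sup>2 - card (residues R p))"
proof -
  have "{j\<in>{a..<a + modulus N}. survives R j} =
    {j\<in>{a..<a + modulus N}. \<forall>p\<in>small_primes N. j mod p\<^sup>2 \<in> {..<p\<^sup>2} - residues R p}"
    using survives_iff_residues[OF assms] by simp
  also have "card \<dots> = (\<Prod>p\<in>small_primes N. card ({..<p\<^sup>2} - residues R p))"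
    by (rule card_residues_in) auto
  also have "\<dots> = (\<Prod>p\<in>small_primes N. p\<^sup>2 - card (residues R p))"
    by (intro prod.cong refl, subst card_Diff_subset) (auto simp: residues_def)
  finally show ?thesis .
qed

lemma card_residues_le: "card (residues R p) \<le> p\<^sup>2"
  using card_mono[of "{..<p\<^sup>2}" "residues R p"] by (auto simp: residues_def)

text \<open>
  By the Chinese remainder theorem the events of avoiding the classes of different primes are
  independent over a full period.
\<close>

lemma survivors_fraction:
  assumes "residue_relation N R"
  shows "real (card {j\<in>{a..<a + modulus N}. survives R j}) / real (modulus N) =
    (\<Prod>p\<in>small_primes N. 1 - real (card (residues R p)) / real (p\<^sup>2))"
proof -
  have "real (card {j\<in>{a..<a + modulus N}. survives R j}) / real (modulus N) =
    (\<Prod>p\<in>small_primes N. real (p\<^sup>2 - card (residues R p)) / real (p\<^sup>2))"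
    unfolding card_survivors_period[OF assms] by (simp add: modulus_def prod_dividef)
  also have "\<dots> = (\<Prod>p\<in>small_primes N. 1 - real (card (residues R p)) / real (p\<^sup>2))"
  proof (intro prod.cong refl)
    fix p assume "p \<in> small_primes N"
    then have "real (p\<^sup>2) \<noteq> 0" by simp
    then show "real (p\<^sup>2 - card (residues R p)) / real (p\<^sup>2) = 1 - real (card (residues R p)) / real (p\<^sup>2)"
      unfolding of_nat_diff[OF card_residues_le] by (simp only: diff_divide_distrib divide_self_if if_False)
  qed
  finally show ?thesis .
qed

text \<open>
  The sieve by squares of primes, seen by an observer at the position \<open>k\<close>; the number \<open>k\<close> is called
  the phase.
\<close>

definition square_multiples :: "nat \<Rightarrow> nat \<Rightarrow> (nat \<times> nat) set" where
  "square_multiples N k = {(p, j). p \<in> small_primes N \<and> p\<^sup>2 dvd k + j}"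

lemma residue_relation_square_multiples: "residue_relation N (square_multiples N k)"
proof -
  have "p\<^sup>2 dvd k + j mod p\<^sup>2 \<longleftrightarrow> p\<^sup>2 dvd k + j" for p j :: nat
    by (metis dvd_eq_mod_eq_0 mod_add_right_eq)
  then show ?thesis unfolding residue_relation_def square_multiples_def by auto
qed

text \<open>\<open>k * (p\<^sup>2 - 1)\<close> is \<open>- k\<close> modulo \<open>p\<^sup>2\<close>, written with natural numbers.\<close>

lemma residues_square_multiples:
  assumes p: "p \<in> small_primes N"
  shows "residues (square_multiples N k) p = {(k * (p\<^sup>2 - 1)) mod p\<^sup>2}"
proof -
  have p2: "p\<^sup>2 > 0" using small_primes_ge_2[OF p] by simp
  let ?r = "(k * (p\<^sup>2 - 1)) mod p\<^sup>2"
  have "k + k * (p\<^sup>2 - 1) = k * p\<^sup>2" using p2 by (cases "p\<^sup>2") auto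
  then have 1: "p\<^sup>2 dvd k + ?r"
    by (metis dvd_eq_mod_eq_0 mod_add_right_eq mod_mult_self2_is_0)
  have "r = ?r" if "r < p\<^sup>2" "p\<^sup>2 dvd k + r" for r
  proof -
    have "[k + r = k + ?r] (mod p\<^sup>2)" using 1 that(2) by (simp add: cong_def dvd_eq_mod_eq_0)
    then have "[r = ?r] (mod p\<^sup>2)" using cong_add_lcancel_nat by blast
    then show ?thesis using that(1) by (simp add: cong_def)
  qed
  then show ?thesis using 1 p p2 by (auto simp: residues_def square_multiples_def)
qed

lemma square_multiples_eq_iff:
  "square_multiples N k = square_multiples N l \<longleftrightarrow> k mod modulus N = l mod modulus N"
proof
  assume eq: "square_multiples N k = square_multiples N l"
  have "k mod p\<^sup>2 = l mod p\<^sup>2" if p: "p \<in> small_primes N" for p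
  proof -
    let ?r = "(k * (p\<^sup>2 - 1)) mod p\<^sup>2"
    have "?r \<in> residues (square_multiples N k) p"
      unfolding residues_square_multiples[OF p] by simp
    moreover from this have "?r \<in> residues (square_multiples N l) p" unfolding eq .
    ultimately
    have "p\<^sup>2 dvd k + ?r" "p\<^sup>2 dvd l + ?r" by (auto simp: residues_def square_multiples_def)
    then have "[k + ?r = l + ?r] (mod p\<^sup>2)" by (simp add: cong_def dvd_eq_mod_eq_0)
    then show ?thesis using cong_add_rcancel_nat by (simp add: cong_def)
  qed
  then show "k mod modulus N = l mod modulus N" using cong_modulus_iff by (simp add: cong_def)
next
  assume "k mod modulus N = l mod modulus N"
  then have "k mod p\<^sup>2 = l mod p\<^sup>2" if "p \<in> small_primes N" for p
    using that cong_modulus_iff[of k l N] by (simp add: cong_def)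
  then have "p\<^sup>2 dvd k + j \<longleftrightarrow> p\<^sup>2 dvd l + j" if "p \<in> small_primes N" for p j
    using that cong_dvd_iff[OF cong_add[OF _ cong_refl], of k l "p\<^sup>2" j] by (simp add: cong_def)
  then show "square_multiples N k = square_multiples N l"
    by (auto simp: square_multiples_def)
qed

lemma square_multiples_add_modulus: "square_multiples N (k + modulus N) = square_multiples N k"
  by (simp add: square_multiples_eq_iff)

text \<open>
  When every prime misses a single class, the Chinese remainder theorem combines the classes
  into one phase.
\<close>

lemma residue_relation_eq_square_multiples:
  assumes R: "residue_relation N R" and one: "\<And>p. p \<in> small_primes N \<Longrightarrow> card (residues R p) = 1"
  obtains k where "k < modulus N" "R = square_multiples N k"
proof -
  have "\<forall>p\<in>small_primes N. \<exists>r. residues R p = {r}"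
    using one by (simp add: card_1_singleton_iff)
  then obtain r where r: "\<And>p. p \<in> small_primes N \<Longrightarrow> residues R p = {r p}" by metis
  have rlt: "r p < p\<^sup>2" if "p \<in> small_primes N" for p using r[OF that] by (auto simp: residues_def)
  have "(\<lambda>p\<in>small_primes N. (r p * (p\<^sup>2 - 1)) mod p\<^sup>2) \<in> PiE (small_primes N) (\<lambda>p. {..<p\<^sup>2})"
    by (auto dest: small_primes_ge_2)
  then have "(\<lambda>p\<in>small_primes N. (r p * (p\<^sup>2 - 1)) mod p\<^sup>2)
      \<in> (\<lambda>j. \<lambda>p\<in>small_primes N. j mod p\<^sup>2) ` {0..<0 + modulus N}"
    using chinese_remainder_bij_betw[of N 0] unfolding bij_betw_def by blast
  then obtain k where k: "k < modulus N"
      "(\<lambda>p\<in>small_primes N. (r p * (p\<^sup>2 - 1)) mod p\<^sup>2) = (\<lambda>p\<in>small_primes N. k mod p\<^sup>2)"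
    by auto
  have "(p, j) \<in> R \<longleftrightarrow> p\<^sup>2 dvd k + j" if p: "p \<in> small_primes N" for p j
  proof -
    have p2: "p\<^sup>2 > 0" using small_primes_ge_2[OF p] by simp
    have kp: "k mod p\<^sup>2 = (r p * (p\<^sup>2 - 1)) mod p\<^sup>2" using fun_cong[OF k(2), of p] p by simp
    have "r p * (p\<^sup>2 - 1) + r p = r p * p\<^sup>2" using p2 by (cases "p\<^sup>2") auto
    then have 0: "[k + r p = 0] (mod p\<^sup>2)"
      using kp by (metis cong_def mod_add_left_eq mod_mult_self2_is_0 mod_0)
    have "(p, j) \<in> R \<longleftrightarrow> (p, j mod p\<^sup>2) \<in> R"
      using R p unfolding residue_relation_def by blast
    also have "\<dots> \<longleftrightarrow> j mod p\<^sup>2 \<in> residues R p"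
      using p2 by (simp add: residues_def)
    also have "\<dots> \<longleftrightarrow> [j = r p] (mod p\<^sup>2)" using r[OF p] rlt[OF p] by (simp add: cong_def)
    also have "\<dots> \<longleftrightarrow> [k + j = k + r p] (mod p\<^sup>2)" by (simp add: cong_add_lcancel_nat)
    also have "\<dots> \<longleftrightarrow> [k + j = 0] (mod p\<^sup>2)" using cong_trans[OF _ 0] cong_trans[OF _ cong_sym[OF 0]] by blast
    finally show ?thesis by (simp add: cong_0_iff)
  qed
  moreover have "R \<subseteq> small_primes N \<times> UNIV" using R by (simp add: residue_relation_def)
  ultimately have "R = square_multiples N k" by (auto simp: square_multiples_def)
  then show thesis using k(1) that by blast
qed

lemma survivors_square_multiples_fraction:
  "real (card {j\<in>{a..<a + modulus N}. survives (square_multiples N k) j}) = modulus N * sieve_density N"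
proof -
  have "real (card {j\<in>{a..<a + modulus N}. survives (square_multiples N k) j}) / real (modulus N) = sieve_density N"
    unfolding survivors_fraction[OF residue_relation_square_multiples] sieve_density_def
    by (intro prod.cong refl) (simp add: residues_square_multiples del: One_nat_def)
  then show ?thesis by (simp add: field_simps)
qed

lemma card_phases_surviving:
  "real (card {k\<in>{..<modulus N}. survives (square_multiples N k) j}) = modulus N * sieve_density N"
proof -
  have "{k\<in>{..<modulus N}. survives (square_multiples N k) j} =
      {k\<in>{0..<0 + modulus N}. survives (square_multiples N j) k}"
    by (auto simp: survives_def square_multiples_def add.commute[of j])
  then show ?thesis by (simp only: survivors_square_multiples_fraction)
qed

lemma sieve_density_factor_bounds:
  assumes "p \<ge> (2 :: nat)" shows "0 \<le> 1 - 1 / real (p\<^sup>2)" "1 - 1 / real (p\<^sup>2) \<le> 1"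
proof -
  have "real (p\<^sup>2) \<ge> 1" using assms by simp
  then show "0 \<le> 1 - 1 / real (p\<^sup>2)" "1 - 1 / real (p\<^sup>2) \<le> 1" by (auto simp: divide_le_eq_1)
qed

text \<open>
  Replacing the primes by all integers \<open>k \<ge> 2\<close> only decreases the product, which then telescopes.
\<close>

lemma sieve_density_pos: "sieve_density N \<ge> 1 / 2"
proof -
  have telescope: "(\<Prod>k=2..N. 1 - 1 / real (k\<^sup>2)) \<ge> 1 / 2"
  proof (cases "N \<ge> 1")
    case True
    then have "(\<Prod>k=2..N. 1 - 1 / real (k\<^sup>2)) = (real N + 1) / (2 * real N)"
    proof (induction N rule: nat_induct_at_least)
      case (Suc n)
      have "(\<Prod>k=2..Suc n. 1 - 1 / real (k\<^sup>2)) =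
          (real n + 1) / (2 * real n) * (1 - 1 / (real n + 1)\<^sup>2)"
        using Suc by (simp add: prod.atLeast_Suc_atMost algebra_simps)
      also have "\<dots> = (real (Suc n) + 1) / (2 * real (Suc n))"
        using Suc.hyps by (simp add: divide_simps) (simp add: power2_eq_square algebra_simps)
      finally show ?case .
    qed simp
    also have "\<dots> \<ge> 1 / 2" using True by (simp add: field_simps)
    finally show ?thesis .
  qed simp
  also have "(\<Prod>k=2..N. 1 - 1 / real (k\<^sup>2)) \<le> (\<Prod>k=2..N. if k \<in> primes then 1 - 1 / real (k\<^sup>2) else 1)"
    using sieve_density_factor_bounds by (intro prod_mono) auto
  also have "\<dots> = (\<Prod>k\<in>{k\<in>{2..N}. k \<in> primes}. 1 - 1 / real (k\<^sup>2))"
    by (rule prod.inter_filter[symmetric]) simp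
  also have "{k\<in>{2..N}. k \<in> primes} = small_primes N"
    by (auto simp: small_primes_def dest: primes_ge_2)
  finally show ?thesis by (simp add: sieve_density_def)
qed

lemma decseq_sieve_density: "decseq sieve_density"
proof (rule decseq_SucI)
  fix N
  show "sieve_density (Suc N) \<le> sieve_density N"
  proof (cases "Suc N \<in> primes")
    case True
    then have "small_primes (Suc N) = insert (Suc N) (small_primes N)" "Suc N \<notin> small_primes N"
      by (auto simp: small_primes_def le_Suc_eq)
    then have "sieve_density (Suc N) = (1 - 1 / real ((Suc N)\<^sup>2)) * sieve_density N"
      by (simp add: sieve_density_def)
    also have "\<dots> \<le> 1 * sieve_density N"
      using sieve_density_pos[of N] sieve_density_factor_bounds(2)[OF primes_ge_2[OF True]]
      by (intro mult_right_mono) auto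
    finally show ?thesis by simp
  next
    case False
    then have "small_primes (Suc N) = small_primes N" by (auto simp: small_primes_def le_Suc_eq)
    then show ?thesis by (simp add: sieve_density_def)
  qed
qed

lemma sieve_density_LIMSEQ: "sieve_density \<longlonglongrightarrow> squarefree_density"
proof -
  have "convergent sieve_density"
  proof (intro Bseq_monoseq_convergent decseq_imp_monoseq decseq_sieve_density BseqI')
    fix N show "norm (sieve_density N) \<le> sieve_density 0"
      using sieve_density_pos[of N] decseqD[OF decseq_sieve_density, of 0 N] by simp
  qed
  then show ?thesis unfolding squarefree_density_def by (simp add: convergent_LIMSEQ_iff)
qed

lemma squarefree_density_le: "squarefree_density \<le> sieve_density N"
  using decseq_sieve_density sieve_density_LIMSEQ by (rule decseq_ge)

lemma squarefree_density_pos: "squarefree_density > 0"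
  using LIMSEQ_le_const[OF sieve_density_LIMSEQ, of "1 / 2"] sieve_density_pos by auto

section \<open>Cylinder sets of the squarefree flow\<close>

abbreviation flow :: "(nat \<Rightarrow> nat) set" where
  "flow \<equiv> topspace squarefree_flow"

definition word :: "nat \<Rightarrow> (nat \<Rightarrow> nat) \<Rightarrow> (nat \<Rightarrow> nat)" where
  "word n x = restrict x {1..n}"

definition words :: "nat \<Rightarrow> (nat \<Rightarrow> nat) set" where
  "words n = PiE {1..n} (\<lambda>_. {0, 1})"

definition cyl :: "nat \<Rightarrow> (nat \<Rightarrow> nat) \<Rightarrow> (nat \<Rightarrow> nat) set" where
  "cyl n x = {y \<in> flow. word n y = word n x}"

lemma word_eq_iff: "word n x = word n y \<longleftrightarrow> (\<forall>k\<in>{1..n}. x k = y k)"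
  unfolding word_def by (metis (no_types, lifting) restrict_apply' restrict_ext)

lemma finite_words [simp]: "finite (words n)"
  unfolding words_def by (intro finite_PiE) auto

lemma topspace_binary_sequences: "topspace binary_sequences = PiE {1..} (\<lambda>_. {0, 1})"
  by (simp add: binary_sequences_def)

lemma flow_eq: "flow = {x \<in> PiE {1..} (\<lambda>_. {0, 1}).
    \<forall>p\<in>primes. (\<lambda>n. n mod p\<^sup>2) ` supp x \<subset> {0..<p\<^sup>2}}"
  by (auto simp: squarefree_flow_def topspace_binary_sequences primes_def)

lemma flow_values: "x \<in> flow \<Longrightarrow> k \<ge> 1 \<Longrightarrow> x k \<in> {0, 1}"
  unfolding flow_eq by (auto simp del: insert_iff dest!: PiE_mem[where x = k])

lemma flow_subset: "flow \<subseteq> topspace binary_sequences"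
  by (auto simp: squarefree_flow_def)

lemma squarefree_flow_subtopology: "squarefree_flow = subtopology binary_sequences flow"
proof -
  have "flow = {x \<in> topspace binary_sequences.
      \<forall>p. Factorial_Ring.prime p \<longrightarrow> (\<lambda>n. n mod p\<^sup>2) ` supp x \<subset> {0..<p\<^sup>2}}"
    by (auto simp: squarefree_flow_def)
  then show ?thesis by (subst squarefree_flow_def) simp
qed

lemma word_in_words: "x \<in> flow \<Longrightarrow> word n x \<in> words n"
  using flow_values by (auto simp: words_def word_def simp del: insert_iff)

lemma openin_binary_sequences_iff:
  "openin binary_sequences U \<longleftrightarrow> U \<subseteq> topspace binary_sequences \<and>
     (\<forall>x\<in>U. \<exists>n. {y \<in> topspace binary_sequences. word n y = word n x} \<subseteq> U)"
proof (intro iffI conjI ballI)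
  assume U: "openin binary_sequences U"
  then show sub: "U \<subseteq> topspace binary_sequences" by (rule openin_subset)
  fix x assume x: "x \<in> U"
  have "\<exists>V. finite {i \<in> {1..}. V i \<noteq> {0, 1}} \<and> (\<forall>i\<in>{1..}. V i \<subseteq> {0, 1}) \<and> x \<in> PiE {1..} V \<and> PiE {1..} V \<subseteq> U"
    using U x unfolding binary_sequences_def openin_product_topology_alt by simp
  then obtain V where V: "finite {i \<in> {1..}. V i \<noteq> {0, 1 :: nat}}" "x \<in> PiE {1..} V" "PiE {1..} V \<subseteq> U"
    by blast
  obtain n where n: "\<And>i. i \<in> {i \<in> {1..}. V i \<noteq> {0, 1}} \<Longrightarrow> i \<le> n"
    using finite_nat_set_iff_bounded_le[THEN iffD1, OF V(1)] by blast
  have "{y \<in> topspace binary_sequences. word n y = word n x} \<subseteq> PiE {1..} V"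
  proof
    fix y assume y: "y \<in> {y \<in> topspace binary_sequences. word n y = word n x}"
    then have yP: "y \<in> PiE {1..} (\<lambda>_. {0, 1})" and yx: "\<forall>k\<in>{1..n}. y k = x k"
      by (simp_all add: topspace_binary_sequences word_eq_iff)
    show "y \<in> PiE {1..} V"
    proof (rule PiE_I)
      fix i :: nat assume i: "i \<in> {1..}"
      show "y i \<in> V i"
        using n[of i] yx PiE_mem[OF V(2) i] PiE_mem[OF yP i] i by (cases "V i = {0, 1}") auto
    qed (use yP in \<open>rule PiE_arb\<close>)
  qed
  then show "\<exists>n. {y \<in> topspace binary_sequences. word n y = word n x} \<subseteq> U" using V(3) by blast
next
  assume r: "U \<subseteq> topspace binary_sequences \<and>
     (\<forall>x\<in>U. \<exists>n. {y \<in> topspace binary_sequences. word n y = word n x} \<subseteq> U)"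
  have "\<exists>V. finite {i \<in> {1..}. V i \<noteq> {0, 1}} \<and> (\<forall>i\<in>{1..}. V i \<subseteq> {0, 1}) \<and> x \<in> PiE {1..} V \<and> PiE {1..} V \<subseteq> U"
    if x: "x \<in> U" for x
  proof -
    obtain n where n: "{y \<in> topspace binary_sequences. word n y = word n x} \<subseteq> U" using r x by blast
    have xP: "x \<in> PiE {1..} (\<lambda>_. {0, 1})" using r x unfolding topspace_binary_sequences by blast
    define V where "V = (\<lambda>i. if i \<le> n then {x i} else {0, 1})"
    have Vsub: "V i \<subseteq> {0, 1}" if "i \<in> {1..}" for i
      using PiE_mem[OF xP that] by (auto simp: V_def)
    have "finite {i \<in> {1..}. V i \<noteq> {0, 1}}"
      by (rule finite_subset[of _ "{..n}"]) (auto simp: V_def)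
    moreover have "x \<in> PiE {1..} V"
      using PiE_mem[OF xP] PiE_arb[OF xP] by (intro PiE_I) (auto simp: V_def)
    moreover have "PiE {1..} V \<subseteq> U"
    proof -
      have "PiE {1..} V \<subseteq> {y \<in> topspace binary_sequences. word n y = word n x}"
      proof
        fix y assume y: "y \<in> PiE {1..} V"
        have "PiE {1..} V \<subseteq> PiE {1..} (\<lambda>_. {0, 1})" by (rule PiE_mono, rule Vsub)
        with y have "y \<in> PiE {1..} (\<lambda>_. {0, 1})" by (rule rev_subsetD)
        moreover have "y k = x k" if "k \<in> {1..n}" for k
          using PiE_mem[OF y, of k] that by (simp add: V_def)
        ultimately show "y \<in> {y \<in> topspace binary_sequences. word n y = word n x}"
          by (simp add: topspace_binary_sequences word_eq_iff)
      qed
      then show ?thesis using n by blast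
    qed
    ultimately show ?thesis using Vsub by blast
  qed
  then show "openin binary_sequences U"
    unfolding binary_sequences_def openin_product_topology_alt by simp
qed

text \<open>
  In the product topology cylinders form a neighbourhood base, so openness, measurability and
  continuity in the flow can all be tested on initial words.
\<close>

lemma openin_flow_iff:
  "openin squarefree_flow U \<longleftrightarrow> U \<subseteq> flow \<and> (\<forall>x\<in>U. \<exists>n. cyl n x \<subseteq> U)"
proof (intro iffI conjI ballI)
  assume op: "openin squarefree_flow U"
  then show "U \<subseteq> flow" by (rule openin_subset)
  fix x assume "x \<in> U"
  have "\<exists>T. openin binary_sequences T \<and> U = T \<inter> flow"
    using op by (subst (asm) squarefree_flow_subtopology) (simp only: openin_subtopology)
  then obtain T where T: "openin binary_sequences T" "U = T \<inter> flow" by blast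
  then obtain n where "{y \<in> topspace binary_sequences. word n y = word n x} \<subseteq> T"
    using \<open>x \<in> U\<close> unfolding openin_binary_sequences_iff by blast
  then have "cyl n x \<subseteq> U" using T(2) flow_subset by (auto simp: cyl_def)
  then show "\<exists>n. cyl n x \<subseteq> U" ..
next
  assume r: "U \<subseteq> flow \<and> (\<forall>x\<in>U. \<exists>n. cyl n x \<subseteq> U)"
  define T where "T = {y \<in> topspace binary_sequences. \<exists>n. \<exists>x\<in>U. cyl n x \<subseteq> U \<and> word n y = word n x}"
  have "openin binary_sequences T"
    unfolding openin_binary_sequences_iff
  proof (intro conjI ballI)
    show "T \<subseteq> topspace binary_sequences" by (auto simp: T_def)
    fix y assume "y \<in> T"
    then obtain n x where "x \<in> U" "cyl n x \<subseteq> U" "word n y = word n x" by (auto simp: T_def)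
    then have "{z \<in> topspace binary_sequences. word n z = word n y} \<subseteq> T" by (auto simp: T_def)
    then show "\<exists>n. {z \<in> topspace binary_sequences. word n z = word n y} \<subseteq> T" ..
  qed
  moreover have "U = T \<inter> flow"
  proof (intro subset_antisym subsetI)
    fix x assume x: "x \<in> U"
    then have "x \<in> flow" "x \<in> topspace binary_sequences" using r flow_subset by auto
    moreover obtain n where "cyl n x \<subseteq> U" using r x by blast
    ultimately show "x \<in> T \<inter> flow" using x unfolding T_def by blast
  next
    fix y assume "y \<in> T \<inter> flow"
    then obtain n x where "x \<in> U" "cyl n x \<subseteq> U" "word n y = word n x" "y \<in> flow" by (auto simp: T_def)
    then show "y \<in> U" by (auto simp: cyl_def)
  qed
  ultimately show "openin squarefree_flow U"
    by (subst squarefree_flow_subtopology) (auto simp only: openin_subtopology)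
qed

lemma word_le: "word n x = word n y \<Longrightarrow> m \<le> n \<Longrightarrow> word m x = word m y"
  by (auto simp: word_eq_iff)

lemma cyl_mono: "m \<le> n \<Longrightarrow> cyl n x \<subseteq> cyl m x"
  by (auto simp: cyl_def intro: word_le)

lemma cyl_self: "x \<in> flow \<Longrightarrow> x \<in> cyl n x"
  by (simp add: cyl_def)

lemma cyl_subset: "cyl n x \<subseteq> flow"
  by (auto simp: cyl_def)

lemma openin_cyl: "openin squarefree_flow (cyl n x)"
  unfolding openin_flow_iff
proof (intro conjI ballI cyl_subset)
  fix y assume "y \<in> cyl n x"
  then have "cyl n y \<subseteq> cyl n x" by (auto simp: cyl_def)
  then show "\<exists>m. cyl m y \<subseteq> cyl n x" ..
qed

text \<open>
  The flow is closed in the full shift: if the support meets every class modulo \<open>p\<^sup>2\<close>, then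
  finitely many of its elements do so already, and these are seen by an initial word.
\<close>

lemma compact_squarefree_flow: "compact_space squarefree_flow"
proof -
  have "compact_space binary_sequences"
    unfolding binary_sequences_def compact_space_product_topology
    by (simp add: compact_space_discrete_topology)
  moreover have "closedin binary_sequences flow"
    unfolding closedin_def openin_binary_sequences_iff
  proof (intro conjI ballI)
    show "flow \<subseteq> topspace binary_sequences" by (rule flow_subset)
    fix x assume x: "x \<in> topspace binary_sequences - flow"
    then have "\<exists>p\<in>primes. \<not> (\<lambda>n. n mod p\<^sup>2) ` supp x \<subset> {0..<p\<^sup>2}"
      unfolding flow_eq topspace_binary_sequences by blast
    then obtain p where p: "p \<in> primes" "\<not> (\<lambda>n. n mod p\<^sup>2) ` supp x \<subset> {0..<p\<^sup>2}" by blast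
    have "(\<lambda>n. n mod p\<^sup>2) ` supp x \<subseteq> {0..<p\<^sup>2}" using primes_ge_2[OF p(1)] by auto
    then have full: "(\<lambda>n. n mod p\<^sup>2) ` supp x = {0..<p\<^sup>2}" using p(2) by blast
    then obtain F where F: "F \<subseteq> supp x" "finite F" "{0..<p\<^sup>2} = (\<lambda>n. n mod p\<^sup>2) ` F"
      using finite_subset_image[of "{0..<p\<^sup>2}" "\<lambda>n. n mod p\<^sup>2" "supp x"] by auto
    obtain n where n: "\<And>i. i \<in> F \<Longrightarrow> i \<le> n"
      using finite_nat_set_iff_bounded_le[THEN iffD1, OF F(2)] by blast
    \<comment> \<open>The finite set \<open>F\<close> witnesses that no point with this initial word lies in the flow.\<close>
    have "y \<notin> flow" if "word n y = word n x" for y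
    proof -
      have "F \<subseteq> supp y" using F(1) n that by (fastforce simp: supp_def word_eq_iff)
      then have "{0..<p\<^sup>2} \<subseteq> (\<lambda>n. n mod p\<^sup>2) ` supp y" using F(3) by blast
      then show ?thesis using p(1) by (auto simp: flow_eq)
    qed
    then have "{y \<in> topspace binary_sequences. word n y = word n x} \<subseteq> topspace binary_sequences - flow"
      by blast
    then show "\<exists>n. {y \<in> topspace binary_sequences. word n y = word n x} \<subseteq> topspace binary_sequences - flow" ..
  qed auto
  ultimately have "compactin binary_sequences flow" by (rule closedin_compact_space)
  then show ?thesis
    by (subst squarefree_flow_subtopology) (rule compact_space_subtopology)
qed

definition cylinders :: "(nat \<Rightarrow> nat) set set" where
  "cylinders = {cyl n x | n x. x \<in> flow}"

lemma countable_cylinders: "countable cylinders"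
proof -
  have "cylinders \<subseteq> (\<Union>n. (\<lambda>w. {y \<in> flow. word n y = w}) ` words n)"
    using word_in_words by (fastforce simp: cylinders_def cyl_def)
  moreover have "countable (\<Union>n. (\<lambda>w. {y \<in> flow. word n y = w}) ` words n)"
    by (intro countable_UN countable_image countable_finite[OF finite_words]) simp
  ultimately show ?thesis by (rule countable_subset)
qed

lemma space_borel_flow [simp]: "space (borel_of squarefree_flow) = flow"
  unfolding borel_of_def by (rule space_measure_of) (auto dest: openin_subset)

lemma sets_borel_flow: "sets (borel_of squarefree_flow) = sigma_sets flow cylinders"
  unfolding sets_borel_of
proof (rule sigma_sets_eqI)
  fix U assume "U \<in> {U. openin squarefree_flow U}"
  then have U: "U \<subseteq> flow" "\<And>x. x \<in> U \<Longrightarrow> \<exists>n. cyl n x \<subseteq> U" by (auto simp: openin_flow_iff)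
  have "U = \<Union>{C \<in> cylinders. C \<subseteq> U}"
  proof (intro subset_antisym subsetI)
    fix x assume x: "x \<in> U"
    then obtain n where "cyl n x \<subseteq> U" using U(2) by blast
    moreover have "cyl n x \<in> cylinders" using x U(1) by (auto simp: cylinders_def)
    ultimately show "x \<in> \<Union>{C \<in> cylinders. C \<subseteq> U}" using x U(1) cyl_self by blast
  qed blast
  moreover have "\<Union>{C \<in> cylinders. C \<subseteq> U} \<in> sigma_sets flow cylinders"
    by (rule sigma_sets_UNION) (auto intro: countable_subset[OF _ countable_cylinders])
  ultimately show "U \<in> sigma_sets flow cylinders" by simp
next
  fix C assume "C \<in> cylinders"
  then show "C \<in> sigma_sets flow {U. openin squarefree_flow U}"
    by (auto simp: cylinders_def openin_cyl)
qed

lemma Int_stable_cylinders: "Int_stable (insert {} cylinders)"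
proof -
  have "cyl n x \<inter> cyl m y \<in> insert {} cylinders" if "x \<in> flow" "y \<in> flow" "n \<le> m" for n m x y
  proof (cases "cyl n x \<inter> cyl m y = {}")
    case False
    then obtain z where z: "z \<in> flow" "word n z = word n x" "word m z = word m y" by (auto simp: cyl_def)
    have "word n u = word n x" if "word m u = word m y" for u
      using word_le[of m u z n] that z \<open>n \<le> m\<close> by simp
    then have "cyl n x \<inter> cyl m y = cyl m z" using z by (auto simp: cyl_def)
    then show ?thesis using \<open>z \<in> flow\<close> by (auto simp: cylinders_def)
  qed simp
  then have "cyl n x \<inter> cyl m y \<in> insert {} cylinders" if "x \<in> flow" "y \<in> flow" for n m x y
    using that nle_le[of n m] by (metis Int_commute)
  note int = this
  show ?thesis
  proof (rule Int_stableI)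
    fix a b assume "a \<in> insert {} cylinders" "b \<in> insert {} cylinders"
    then consider "a \<inter> b = {}" | n x m y where "x \<in> flow" "y \<in> flow" "a = cyl n x" "b = cyl m y"
      unfolding cylinders_def by blast
    then show "a \<inter> b \<in> insert {} cylinders" by cases (simp_all only: int insertI1)
  qed
qed

lemma flow_measure_eqI:
  assumes "sets \<mu> = sets (borel_of squarefree_flow)" "sets \<nu> = sets (borel_of squarefree_flow)"
    and "prob_space \<mu>" "prob_space \<nu>"
    and eq: "\<And>n x. x \<in> flow \<Longrightarrow> measure \<mu> (cyl n x) = measure \<nu> (cyl n x)"
  shows "\<mu> = \<nu>"
proof (rule measure_eqI_generator_eq[OF Int_stable_cylinders])
  interpret mu: prob_space \<mu> by fact
  interpret nu: prob_space \<nu> by fact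
  have sp: "space \<mu> = flow" using sets_eq_imp_space_eq[OF assms(1)] by simp
  obtain x where x: "x \<in> flow" using mu.not_empty unfolding sp by blast
  have c0: "cyl 0 x = flow" by (auto simp: cyl_def word_def)
  show "insert {} cylinders \<subseteq> Pow flow" using cyl_subset by (auto simp: cylinders_def)
  show "sets \<mu> = sigma_sets flow (insert {} cylinders)" "sets \<nu> = sigma_sets flow (insert {} cylinders)"
    unfolding assms(1,2) sets_borel_flow
    by (rule sigma_sets_eqI; auto intro: sigma_sets.Empty sigma_sets.Basic)+
  show "emeasure \<mu> C = emeasure \<nu> C" if "C \<in> insert {} cylinders" for C
    using that eq by (auto simp: cylinders_def mu.emeasure_eq_measure nu.emeasure_eq_measure)
  show "range (\<lambda>_. flow) \<subseteq> insert {} cylinders" using c0 x by (auto simp: cylinders_def)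
qed (auto simp: prob_space.finite_measure[OF assms(3)] finite_measure.emeasure_eq_measure)

lemma cyl_sets: "cyl n x \<in> sets (borel_of squarefree_flow)"
  unfolding sets_borel_of using openin_cyl by (auto intro: sigma_sets.Basic)

lemma funpow_left_shift: "k \<ge> 1 \<Longrightarrow> (left_shift ^^ i) x k = x (k + i)"
  by (induction i arbitrary: k) (auto simp: left_shift_def)

lemma supp_left_shift: "supp (left_shift x) = {k. k \<ge> 1 \<and> Suc k \<in> supp x}"
  by (auto simp: supp_def left_shift_def)

definition missed :: "nat \<Rightarrow> (nat \<Rightarrow> nat) \<Rightarrow> (nat \<times> nat) set" where
  "missed N x = {(p, j). p \<in> small_primes N \<and> (\<forall>k\<in>supp x. k mod p\<^sup>2 \<noteq> j mod p\<^sup>2)}"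

lemma residue_relation_missed: "residue_relation N (missed N x)"
  by (auto simp: residue_relation_def missed_def)

lemma residues_missed_nonempty:
  assumes x: "x \<in> flow" and p: "p \<in> small_primes N"
  shows "card (residues (missed N x) p) \<ge> 1"
proof -
  have "(\<lambda>n. n mod p\<^sup>2) ` supp x \<subset> {0..<p\<^sup>2}"
    using x p by (auto simp: flow_eq small_primes_def)
  then obtain r where "r \<in> {0..<p\<^sup>2}" and r: "r \<notin> (\<lambda>n. n mod p\<^sup>2) ` supp x" by blast
  then have "r < p\<^sup>2" by simp
  with r
  have "r \<in> residues (missed N x) p" using p by (fastforce simp: residues_def missed_def)
  moreover have "finite (residues (missed N x) p)" by (auto simp: residues_def)
  ultimately show ?thesis by (metis One_nat_def Suc_leI card_gt_0_iff empty_iff)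
qed

lemma supp_survives: "k \<in> supp x \<Longrightarrow> survives (missed N x) k"
  by (auto simp: survives_def missed_def)

text \<open>
  Only an inclusion: a class may be met by the support at the first position and nowhere else, and
  then the shifted point misses one class more.
\<close>

lemma missed_left_shift: "(p, Suc j) \<in> missed N x \<Longrightarrow> (p, j) \<in> missed N (left_shift x)"
proof -
  assume a: "(p, Suc j) \<in> missed N x"
  have "k mod p\<^sup>2 \<noteq> j mod p\<^sup>2" if "Suc k \<in> supp x" for k
  proof
    assume "k mod p\<^sup>2 = j mod p\<^sup>2"
    then have "Suc k mod p\<^sup>2 = Suc j mod p\<^sup>2" by (metis mod_Suc_eq)
    then show False using a that by (auto simp: missed_def)
  qed
  then show ?thesis using a by (auto simp: missed_def supp_left_shift)
qed

text \<open>
  A class missed by a point, moved by one, is missed by the shifted point. The representative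
  \<open>r + p\<^sup>2 - 1\<close> avoids subtracting one from the class of 0.
\<close>

lemma left_shift_flow: "x \<in> flow \<Longrightarrow> left_shift x \<in> flow"
proof -
  assume x: "x \<in> flow"
  then have "left_shift x \<in> PiE {1..} (\<lambda>_. {0, 1})"
    using flow_values[OF x] by (auto simp: left_shift_def simp del: insert_iff)
  moreover have "(\<lambda>n. n mod p\<^sup>2) ` supp (left_shift x) \<subset> {0..<p\<^sup>2}" if p: "p \<in> primes" for p
  proof -
    have p': "p \<in> small_primes p" using p by (simp add: small_primes_def)
    have p2: "p\<^sup>2 > 0" using p' by simp
    obtain r where "r \<in> residues (missed p x) p"
      using residues_missed_nonempty[OF x p'] by (metis card.empty ex_in_conv not_one_le_zero)
    then have "(p, r + p\<^sup>2) \<in> missed p x" by (auto simp: residues_def missed_def)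
    then have "(p, Suc (r + p\<^sup>2 - 1)) \<in> missed p x" using p2 by simp
    then have "(p, r + p\<^sup>2 - 1) \<in> missed p (left_shift x)" by (rule missed_left_shift)
    then have "(r + p\<^sup>2 - 1) mod p\<^sup>2 \<notin> (\<lambda>n. n mod p\<^sup>2) ` supp (left_shift x)"
      by (auto simp: missed_def)
    moreover have "(r + p\<^sup>2 - 1) mod p\<^sup>2 \<in> {0..<p\<^sup>2}" using p2 by simp
    moreover have "(\<lambda>n. n mod p\<^sup>2) ` supp (left_shift x) \<subseteq> {0..<p\<^sup>2}" using p2 by auto
    ultimately show ?thesis by blast
  qed
  ultimately show "left_shift x \<in> flow" by (simp add: flow_eq)
qed

lemma funpow_left_shift_flow: "x \<in> flow \<Longrightarrow> (left_shift ^^ i) x \<in> flow"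
  by (induction i) (auto intro: left_shift_flow)

lemma word_left_shift: "word (Suc n) x = word (Suc n) y \<Longrightarrow> word n (left_shift x) = word n (left_shift y)"
  by (auto simp: word_eq_iff left_shift_def)

lemma word_funpow_left_shift:
  "word (n + i) x = word (n + i) y \<Longrightarrow> word n ((left_shift ^^ i) x) = word n ((left_shift ^^ i) y)"
  by (auto simp: word_eq_iff funpow_left_shift)

lemma measurable_left_shift:
  "left_shift \<in> measurable (borel_of squarefree_flow) (borel_of squarefree_flow)"
proof (rule measurable_sigma_sets[OF sets_borel_flow])
  show "cylinders \<subseteq> Pow flow" using cyl_subset by (auto simp: cylinders_def)
  show "left_shift \<in> space (borel_of squarefree_flow) \<rightarrow> flow" by (auto intro: left_shift_flow)
  fix C assume "C \<in> cylinders"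
  then obtain n x where C: "C = cyl n x" by (auto simp: cylinders_def)
  have "openin squarefree_flow (left_shift -` C \<inter> flow)"
    unfolding openin_flow_iff
  proof (intro conjI ballI)
    fix y assume y: "y \<in> left_shift -` C \<inter> flow"
    have "z \<in> left_shift -` C \<inter> flow" if z: "z \<in> cyl (Suc n) y" for z
    proof -
      have "z \<in> flow" "word (Suc n) z = word (Suc n) y" using z by (simp_all add: cyl_def)
      then show ?thesis
        using y left_shift_flow[of z] word_left_shift[of n z y] by (simp add: C cyl_def)
    qed
    then have "cyl (Suc n) y \<subseteq> left_shift -` C \<inter> flow" by blast
    then show "\<exists>n. cyl n y \<subseteq> left_shift -` C \<inter> flow" ..
  qed auto
  then show "left_shift -` C \<inter> space (borel_of squarefree_flow) \<in> sets (borel_of squarefree_flow)"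
    by (auto simp: sets_borel_of intro: sigma_sets.Basic)
qed

lemma vimage_word_sets: "word n -` {w} \<inter> flow \<in> sets (borel_of squarefree_flow)"
proof (cases "word n -` {w} \<inter> flow = {}")
  case False
  then obtain x where "x \<in> flow" "word n x = w" by auto
  then have "word n -` {w} \<inter> flow = cyl n x" by (auto simp: cyl_def)
  then show ?thesis by (simp add: cyl_sets)
qed (simp only: sets.empty_sets)

lemma simple_function_word:
  assumes "sets \<mu> = sets (borel_of squarefree_flow)"
  shows "simple_function \<mu> (word n)"
proof -
  have sp: "space \<mu> = flow" using sets_eq_imp_space_eq[OF assms] by simp
  have "word n ` flow \<subseteq> words n" using word_in_words by auto
  then show ?thesis
    unfolding simple_function_def sp assms
    using vimage_word_sets finite_subset[OF _ finite_words] by blast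
qed

lemma simple_function_missed:
  assumes "sets \<mu> = sets (borel_of squarefree_flow)"
  shows "simple_function \<mu> (missed N)"
proof -
  have sp: "space \<mu> = flow" using sets_eq_imp_space_eq[OF assms] by simp
  have one: "{x \<in> flow. x k = 1} \<in> sets \<mu>" if "k \<ge> 1" for k
  proof -
    have "openin squarefree_flow {x \<in> flow. x k = 1}"
      unfolding openin_flow_iff
    proof (intro conjI ballI)
      fix x assume "x \<in> {x \<in> flow. x k = 1}"
      then have "cyl k x \<subseteq> {x \<in> flow. x k = 1}" using that by (auto simp: cyl_def word_eq_iff)
      then show "\<exists>n. cyl n x \<subseteq> {x \<in> flow. x k = 1}" ..
    qed auto
    then show ?thesis unfolding assms by (auto simp: sets_borel_of intro: sigma_sets.Basic)
  qed
  show ?thesis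
  proof (rule simple_function_residue_relation[OF residue_relation_missed])
    fix p r assume p: "p \<in> small_primes N"
    have "{x \<in> space \<mu>. (p, r) \<in> missed N x} =
        space \<mu> - (\<Union>k\<in>{k. k \<ge> 1 \<and> k mod p\<^sup>2 = r mod p\<^sup>2}. {x \<in> flow. x k = 1})"
      using p by (auto simp: missed_def supp_def sp)
    also have "\<dots> \<in> sets \<mu>"
      using one by (intro sets.compl_sets sets.countable_UN'') auto
    finally show "{x \<in> space \<mu>. (p, r) \<in> missed N x} \<in> sets \<mu>" .
  qed
qed

section \<open>Itineraries and entropy with respect to a partition\<close>

definition itinerary :: "('a \<Rightarrow> 'a) \<Rightarrow> ('a \<Rightarrow> 'b) \<Rightarrow> nat \<Rightarrow> 'a \<Rightarrow> 'b list" where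
  "itinerary T f n x = map (\<lambda>i. f ((T ^^ i) x)) [0..<n]"

lemma itinerary_eq_iff: "itinerary T f n x = itinerary T f n y \<longleftrightarrow> (\<forall>i<n. f ((T ^^ i) x) = f ((T ^^ i) y))"
  by (auto simp: itinerary_def)

lemma itinerary_0 [simp]: "itinerary T f 0 = (\<lambda>_. [])"
  by (simp add: itinerary_def fun_eq_iff)

lemma itinerary_Suc: "itinerary T f (Suc n) x = itinerary T f n x @ [f ((T ^^ n) x)]"
  by (simp add: itinerary_def)

text \<open>
  The cells of the join of the first \<open>n\<close> preimages of a partition are the fibres of the
  itinerary map; the join may in addition contain the empty set, which is removed on both sides.
\<close>

lemma iterated_join_nonempty_cells:
  assumes T: "\<And>x. x \<in> S \<Longrightarrow> T x \<in> S" and P: "P = (\<lambda>x. {y\<in>S. f y = f x}) ` S"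
  shows "iterated_join S T P n - {{}} = (\<lambda>x. {y\<in>S. itinerary T f n y = itinerary T f n x}) ` S - {{}}"
proof (induction n)
  case 0
  then show ?case by auto
next
  case (Suc n)
  let ?c = "\<lambda>n x. {y\<in>S. itinerary T f n y = itinerary T f n x}"
  have Tn: "(T ^^ n) x \<in> S" if "x \<in> S" for x n using that by (induction n) (auto intro: T)
  have cell: "?c (Suc n) x = ?c n x \<inter> ((T ^^ n) -` {y\<in>S. f y = f ((T ^^ n) x)} \<inter> S)" if "x \<in> S" for x
    using Tn by (auto simp: itinerary_Suc)
  show ?case
  proof (intro subset_antisym subsetI)
    fix C assume "C \<in> iterated_join S T P (Suc n) - {{}}"
    then obtain A B x where C: "C = A \<inter> ((T ^^ n) -` B \<inter> S)" "A \<in> iterated_join S T P n" "B \<in> P" "x \<in> C"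
      by auto
    then have x: "x \<in> A" "(T ^^ n) x \<in> B" "x \<in> S" by auto
    have "A \<in> ?c n ` S" using Suc.IH C(2) x(1) by auto
    then have "A = ?c n x" using x(1) by auto
    moreover have "B = {y\<in>S. f y = f ((T ^^ n) x)}" using C(3) x(2) P by auto
    ultimately have "C = ?c (Suc n) x" using C(1) cell[OF x(3)] by simp
    then show "C \<in> ?c (Suc n) ` S - {{}}" using x(3) by auto
  next
    fix C assume "C \<in> ?c (Suc n) ` S - {{}}"
    then obtain x where x: "x \<in> S" "C = ?c (Suc n) x" by auto
    have "?c n x \<in> iterated_join S T P n" using Suc.IH x(1) by blast
    moreover have "{y\<in>S. f y = f ((T ^^ n) x)} \<in> P" using P Tn[OF x(1)] by blast
    moreover have "C = ?c n x \<inter> ((T ^^ n) -` {y\<in>S. f y = f ((T ^^ n) x)} \<inter> S)"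
      unfolding x(2) by (rule cell[OF x(1)])
    ultimately have "C \<in> iterated_join S T P (Suc n)" unfolding iterated_join.simps by blast
    moreover have "x \<in> C" using x by simp
    ultimately show "C \<in> iterated_join S T P (Suc n) - {{}}" by blast
  qed
qed

context prob_space
begin

lemma partition_entropy_eq_ent:
  assumes X: "simple_function M X"
    and Q: "Q - {{}} = (\<lambda>x. {y\<in>space M. X y = X x}) ` space M - {{}}"
  shows "partition_entropy M Q = ent M X"
proof -
  let ?F = "\<lambda>v. X -` {v} \<inter> space M"
  have img: "Q - {{}} = ?F ` (X ` space M)"
  proof -
    have "{y\<in>space M. X y = X x} = ?F (X x)" for x by auto
    then have "Q - {{}} = ?F ` (X ` space M) - {{}}" using Q by (simp add: image_image)
    then show ?thesis by auto
  qed
  have fin: "finite (X ` space M)" using X by (rule simple_functionD)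
  then have finQ: "finite Q" using img by (metis finite_Diff2 finite.emptyI finite_imageI finite_insert)
  have inj: "inj_on ?F (X ` space M)" by (rule inj_onI) blast
  have "(\<Sum>A\<in>Q. measure M A * ln (measure M A)) = (\<Sum>A\<in>Q - {{}}. measure M A * ln (measure M A))"
    using finQ by (intro sum.mono_neutral_right) auto
  also have "\<dots> = (\<Sum>v\<in>X ` space M. fibre_prob M X v * ln (fibre_prob M X v))"
    unfolding img by (simp add: sum.reindex[OF inj])
  finally show ?thesis
    using ent_eq_sum[OF X fin order_refl] by (simp add: partition_entropy_def)
qed

lemma measure_preserving_funpow:
  assumes T: "T \<in> measurable M M" "distr M M T = M"
  shows "(T ^^ n) \<in> measurable M M" "distr M M (T ^^ n) = M"
proof -
  have *: "(T ^^ n) \<in> measurable M M \<and> distr M M (T ^^ n) = M"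
  proof (induction n)
    case 0
    then show ?case by (simp add: id_def distr_id)
  next
    case (Suc n)
    then have m: "(T ^^ n) \<in> measurable M M" by simp
    have "(T ^^ Suc n) \<in> measurable M M"
      unfolding funpow.simps by (rule measurable_comp[OF m T(1)])
    moreover have "distr M M (T ^^ Suc n) = M"
      unfolding funpow.simps distr_distr[OF T(1) m, symmetric] Suc[THEN conjunct2] T(2) ..
    ultimately show ?case by (rule conjI)
  qed
  show "(T ^^ n) \<in> measurable M M" using * by (rule conjunct1)
  show "distr M M (T ^^ n) = M" using * by (rule conjunct2)
qed

lemma simple_function_itinerary:
  assumes f: "simple_function M f" and T: "T \<in> measurable M M"
  shows "simple_function M (itinerary T f n)"
proof (induction n)
  case (Suc n)
  have "(T ^^ n) \<in> measurable M M"
  proof (induction n)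
    case (Suc n)
    then show ?case unfolding funpow.simps by (rule measurable_comp[OF _ T])
  qed (simp add: id_def)
  then have "simple_function M (\<lambda>x. f ((T ^^ n) x))"
    by (rule simple_function_measure_preserving[OF f])
  from simple_function_compose2[OF Suc this, of "\<lambda>a b. a @ [b]"]
  show ?case by (simp add: itinerary_Suc[abs_def])
qed simp

lemma entropy_wrt_partition_eq:
  assumes f: "simple_function M f" and T: "T \<in> measurable M M"
    and P: "P = (\<lambda>x. {y\<in>space M. f y = f x}) ` space M"
  shows "entropy_wrt_partition M T P = limsup (\<lambda>n. ereal (ent M (itinerary T f n) / real n))"
proof -
  have "partition_entropy M (iterated_join (space M) T P n) = ent M (itinerary T f n)" for n
    using T by (intro partition_entropy_eq_ent simple_function_itinerary f iterated_join_nonempty_cells P)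
      (auto dest: measurable_space)
  then show ?thesis by (simp add: entropy_wrt_partition_def)
qed

text \<open>
  The step from one partition to another in the Kolmogorov-Sinai theorem. The labels \<open>f\<close> along an
  orbit are added one at a time to the information \<open>Y\<close>; since \<open>Y\<close> knows the approximate label \<open>g\<close> at
  each time, every step costs at most the conditional entropy of \<open>f\<close> given \<open>g\<close>.
\<close>

lemma ent_itinerary_le:
  assumes f: "simple_function M f" and g: "simple_function M g" and Y: "simple_function M Y"
    and T: "T \<in> measurable M M" "distr M M T = M"
    and det: "\<And>i. i < n \<Longrightarrow> determines M Y (\<lambda>x. g ((T ^^ i) x))"
  shows "ent M (itinerary T f n) \<le> ent M Y + real n * (ent M (\<lambda>x. (f x, g x)) - ent M g)"
proof -
  let ?d = "ent M (\<lambda>x. (f x, g x)) - ent M g"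
  have "ent M (\<lambda>x. (itinerary T f k x, Y x)) \<le> ent M Y + real k * ?d" if "k \<le> n" for k
    using that
  proof (induction k)
    case 0
    have "ent M (\<lambda>x. (itinerary T f 0 x, Y x)) = ent M Y"
      by (rule determines_ent_eq) (auto simp: determines_def)
    then show ?case by simp
  next
    case (Suc k)
    let ?f = "\<lambda>x. f ((T ^^ k) x)" and ?g = "\<lambda>x. g ((T ^^ k) x)" and ?I = "\<lambda>x. (itinerary T f k x, Y x)"
    note Tk = measure_preserving_funpow[OF T, of k]
    have sf: "simple_function M ?f" "simple_function M ?g" "simple_function M ?I"
      using simple_function_measure_preserving[OF f Tk(1)] simple_function_measure_preserving[OF g Tk(1)]
        simple_function_itinerary[OF f T(1)] Y by auto
    have fg: "simple_function M (\<lambda>x. (f x, g x))" using f g by (rule simple_function_Pair)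
    have "ent M (\<lambda>x. (itinerary T f (Suc k) x, Y x)) = ent M (\<lambda>x. (?f x, ?I x))"
      by (rule determines_ent_eq) (auto simp: determines_def itinerary_Suc)
    also have "\<dots> \<le> ent M ?I + (ent M (\<lambda>x. (?f x, ?g x)) - ent M ?g)"
    proof -
      have "determines M Y ?g" using det[of k] Suc.prems by simp
      then have "determines M ?I ?g" unfolding determines_def prod.inject by blast
      from ent_Pair_diff_antimono[OF sf(1,3,2) this] show ?thesis by simp
    qed
    also have "ent M (\<lambda>x. (?f x, ?g x)) - ent M ?g = ?d"
      using ent_measure_preserving[OF fg Tk] ent_measure_preserving[OF g Tk] by simp
    also have "ent M ?I \<le> ent M Y + real k * ?d" using Suc by simp
    finally show ?case by (simp add: algebra_simps)
  qed
  from this[of n] have "ent M (\<lambda>x. (itinerary T f n x, Y x)) \<le> ent M Y + real n * ?d" by simp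
  moreover have "ent M (itinerary T f n) \<le> ent M (\<lambda>x. (itinerary T f n x, Y x))"
    using simple_function_itinerary[OF f T(1)] Y by (intro ent_mono) (auto simp: determines_def)
  ultimately show ?thesis by linarith
qed

text \<open>A partition is replaced by a labelling with numbers, to which the entropy of random variables applies.\<close>

lemma partition_label:
  assumes P: "finite P" "partition_on (space M) P" "P \<subseteq> sets M"
  obtains f :: "'a \<Rightarrow> nat" and k where "simple_function M f" "k \<ge> 1" "\<And>x. x \<in> space M \<Longrightarrow> f x < k"
    "P = (\<lambda>x. {y\<in>space M. f y = f x}) ` space M"
proof -
  obtain h where h: "bij_betw h P {0..<card P}" using ex_bij_betw_finite_nat[OF P(1)] by blast
  have cover: "\<Union>P = space M" and ne: "{} \<notin> P"
    using P(2) by (auto simp: partition_on_def)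
  have disj: "A = B" if "A \<in> P" "B \<in> P" "x \<in> A" "x \<in> B" for A B x
    using partition_onD2[OF P(2)] that by (auto simp: disjoint_def)
  define c where "c = (\<lambda>x. THE A. A \<in> P \<and> x \<in> A)"
  have c: "c x = A" if "A \<in> P" "x \<in> A" for x A
    unfolding c_def using that disj by (intro the_equality) auto
  have cP: "c x \<in> P" "x \<in> c x" if "x \<in> space M" for x
    using that cover c by blast+
  let ?f = "\<lambda>x. h (c x)"
  have eq: "?f y = ?f x \<longleftrightarrow> y \<in> c x" if "x \<in> space M" "y \<in> space M" for x y
  proof
    assume "?f y = ?f x"
    then have "c y = c x" using h cP(1) that by (metis bij_betw_imp_inj_on inj_onD)
    then show "y \<in> c x" using cP(2)[OF that(2)] by simp
  next
    assume "y \<in> c x"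
    then show "?f y = ?f x" using c[OF cP(1)[OF that(1)]] by simp
  qed
  have cell: "{y\<in>space M. ?f y = ?f x} = c x" if "x \<in> space M" for x
  proof -
    have "c x \<subseteq> space M" using cP(1)[OF that] P(3) sets.sets_into_space by blast
    then show ?thesis using eq[OF that] by blast
  qed
  have "?f ` space M \<subseteq> {0..<card P}" using cP h by (auto simp: bij_betw_def)
  then have fin: "finite (?f ` space M)" by (rule finite_subset) simp
  have "simple_function M ?f"
    unfolding simple_function_def
  proof (intro conjI fin ballI)
    fix v assume "v \<in> ?f ` space M"
    then obtain x where x: "x \<in> space M" "v = ?f x" by auto
    then have "?f -` {v} \<inter> space M = c x" using cell[OF x(1)] by auto
    then show "?f -` {v} \<inter> space M \<in> events" using cP(1)[OF x(1)] P(3) by auto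
  qed
  moreover have "card P \<ge> 1"
    using not_empty cP(1) P(1) by (metis One_nat_def Suc_leI card_gt_0_iff empty_iff ex_in_conv)
  moreover have "?f x < card P" if "x \<in> space M" for x using cP(1)[OF that] h by (auto simp: bij_betw_def)
  moreover have "P = (\<lambda>x. {y\<in>space M. ?f y = ?f x}) ` space M"
  proof (intro subset_antisym subsetI)
    fix A assume A: "A \<in> P"
    then obtain x where "x \<in> A" using ne by (metis ex_in_conv)
    moreover have "x \<in> space M" using A \<open>x \<in> A\<close> cover by blast
    ultimately show "A \<in> (\<lambda>x. {y\<in>space M. ?f y = ?f x}) ` space M" using cell c[OF A] by auto
  next
    fix A assume "A \<in> (\<lambda>x. {y\<in>space M. ?f y = ?f x}) ` space M"
    then show "A \<in> P" using cell cP by auto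
  qed
  ultimately show thesis using that by blast
qed

end

section \<open>Approximation by cylinder sets\<close>

definition cyl_union :: "nat \<Rightarrow> (nat \<Rightarrow> nat) set \<Rightarrow> (nat \<Rightarrow> nat) set" where
  "cyl_union n W = {x \<in> flow. word n x \<in> W}"

text \<open>
  Finitely many unions of cylinders can be written with words of one common length.
\<close>

lemma cyl_union_lift: "n \<le> m \<Longrightarrow> cyl_union n W = cyl_union m {w. word n w \<in> W}"
proof -
  assume "n \<le> m"
  then have "word n (word m x) = word n x" for x by (simp add: word_eq_iff) (simp add: word_def)
  then show ?thesis by (simp add: cyl_union_def)
qed

lemma cyl_union_sets: "cyl_union n W \<in> sets (borel_of squarefree_flow)"
proof -
  have "cyl_union n W = (\<Union>w\<in>W \<inter> words n. word n -` {w} \<inter> flow)"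
    using word_in_words by (auto simp: cyl_union_def)
  also have "\<dots> \<in> sets (borel_of squarefree_flow)"
    by (intro sets.finite_UN vimage_word_sets) (auto intro: finite_subset[OF _ finite_words])
  finally show ?thesis .
qed

text \<open>
  The sets that can be approximated form a \<open>\<sigma>\<close>-algebra. For a countable union, first cut off a
  tail of small measure, then approximate the remaining \<open>m\<close> sets with an error that is divided among
  them.
\<close>

lemma cyl_union_approximation:
  assumes s: "sets \<mu> = sets (borel_of squarefree_flow)" and "prob_space \<mu>"
    and A: "A \<in> sets \<mu>" and e: "e > 0"
  shows "\<exists>n W. measure \<mu> ((A - cyl_union n W) \<union> (cyl_union n W - A)) < e"
proof -
  interpret prob_space \<mu> by fact
  have sp: "space \<mu> = flow" using sets_eq_imp_space_eq[OF s] by simp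
  note [simp] = cyl_union_sets[folded s]
  have "A \<in> sigma_sets flow cylinders" using A by (simp add: s sets_borel_flow)
  then show ?thesis using e
  proof (induction A arbitrary: e)
    case (Basic A)
    then obtain n x where "A = cyl n x" by (auto simp: cylinders_def)
    then have "A = cyl_union n {word n x}" by (auto simp: cyl_def cyl_union_def)
    then have "(A - cyl_union n {word n x}) \<union> (cyl_union n {word n x} - A) = {}" by blast
    then show ?case using Basic(2) by (metis measure_empty)
  next
    case Empty
    have "({} - cyl_union 0 {}) \<union> (cyl_union 0 {} - {}) = {}" by (auto simp: cyl_union_def)
    then show ?case using Empty by (metis measure_empty)
  next
    case (Compl A)
    then obtain n W where nW: "measure \<mu> ((A - cyl_union n W) \<union> (cyl_union n W - A)) < e" by blast
    have "(flow - A - cyl_union n (- W)) \<union> (cyl_union n (- W) - (flow - A)) \<subseteq>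
        (A - cyl_union n W) \<union> (cyl_union n W - A)"
      by (auto simp: cyl_union_def)
    then have "measure \<mu> ((flow - A - cyl_union n (- W)) \<union> (cyl_union n (- W) - (flow - A))) < e"
    proof (rule order_le_less_trans[OF finite_measure_mono nW])
      have "A \<in> events" using Compl.hyps by (simp add: s sets_borel_flow)
      then show "(A - cyl_union n W) \<union> (cyl_union n W - A) \<in> events"
        by (intro sets.Un sets.Diff) simp_all
    qed
    then show ?case by (intro exI)
  next
    case (Union A)
    have As: "A i \<in> events" for i using Union.hyps by (simp add: s sets_borel_flow)
    define U where "U = (\<lambda>m. \<Union>i<m. A i)"
    have Us: "U m \<in> events" for m using As by (auto simp: U_def)
    have "(\<lambda>m. measure \<mu> (U m)) \<longlonglongrightarrow> measure \<mu> (\<Union>m. U m)"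
    proof (rule finite_Lim_measure_incseq)
      show "range U \<subseteq> events" using Us by blast
      show "incseq U" by (rule incseq_SucI) (auto simp: U_def lessThan_Suc)
    qed
    moreover have UU: "(\<Union>m. U m) = (\<Union>i. A i)" by (auto simp: U_def)
    ultimately obtain m where m: "\<bar>measure \<mu> (U m) - measure \<mu> (\<Union>i. A i)\<bar> < e / 2"
      using Union.prems unfolding LIMSEQ_iff by (metis UU half_gt_zero order_refl real_norm_def)
    have tail: "measure \<mu> ((\<Union>i. A i) - U m) < e / 2"
    proof -
      have "measure \<mu> ((\<Union>i. A i) - U m) = measure \<mu> (\<Union>i. A i) - measure \<mu> (U m)"
        using As Us by (intro finite_measure_Diff) (auto simp: U_def)
      then show ?thesis using m by linarith
    qed
    have "\<forall>i. \<exists>n W. measure \<mu> ((A i - cyl_union n W) \<union> (cyl_union n W - A i)) < e / (2 * (m + 1))"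
      by (intro allI Union.IH) (use Union.prems in simp)
    then obtain n W where nW: "\<And>i. measure \<mu> ((A i - cyl_union (n i) (W i)) \<union> (cyl_union (n i) (W i) - A i)) < e / (2 * (m + 1))"
      by metis
    define L where "L = Max (insert 0 (n ` {..<m}))"
    have L: "n i \<le> L" if "i < m" for i unfolding L_def using that by (intro Max_ge) auto
    define V where "V = (\<Union>i<m. {w. word (n i) w \<in> W i})"
    have V: "cyl_union L V = (\<Union>i<m. cyl_union (n i) (W i))"
      using cyl_union_lift[OF L] by (auto simp: V_def cyl_union_def)
    let ?D = "\<lambda>i. (A i - cyl_union (n i) (W i)) \<union> (cyl_union (n i) (W i) - A i)"
    have D: "?D i \<in> events" for i using As[of i] by (intro sets.Un sets.Diff) simp_all
    have AU: "(\<Union>i. A i) \<in> events" using As by (intro sets.countable_UN) auto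
    have DU: "(\<Union>i<m. ?D i) \<in> events" using D by (intro sets.finite_UN) auto
    have sub: "((\<Union>i. A i) - cyl_union L V) \<union> (cyl_union L V - (\<Union>i. A i)) \<subseteq> ((\<Union>i. A i) - U m) \<union> (\<Union>i<m. ?D i)"
      unfolding V U_def by blast
    have "measure \<mu> (((\<Union>i. A i) - cyl_union L V) \<union> (cyl_union L V - (\<Union>i. A i)))
        \<le> measure \<mu> (((\<Union>i. A i) - U m) \<union> (\<Union>i<m. ?D i))"
      by (intro finite_measure_mono[OF sub] sets.Un sets.Diff AU Us DU)
    also have "\<dots> \<le> measure \<mu> ((\<Union>i. A i) - U m) + measure \<mu> (\<Union>i<m. ?D i)"
      by (intro measure_Un_le sets.Diff AU Us DU)
    also have "measure \<mu> (\<Union>i<m. ?D i) \<le> (\<Sum>i<m. measure \<mu> (?D i))"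
      using D by (intro measure_UNION_le) auto
    also have "\<dots> \<le> (\<Sum>i<m. e / (2 * (m + 1)))"
      using nW by (intro sum_mono less_imp_le) auto
    also have "\<dots> \<le> e / 2" using Union.prems by (simp add: field_simps)
    finally have "measure \<mu> (((\<Union>i. A i) - cyl_union L V) \<union> (cyl_union L V - (\<Union>i. A i))) < e"
      using tail by linarith
    then show ?case by (intro exI)
  qed
qed

text \<open>
  Each cell of a labelling is approximated by a union of cylinders. The least index of a union
  containing the point (or \<open>k\<close> if there is none) agrees with the label outside the symmetric
  differences.
\<close>

lemma label_approximation:
  fixes f :: "(nat \<Rightarrow> nat) \<Rightarrow> nat"
  assumes s: "sets \<mu> = sets (borel_of squarefree_flow)" and "prob_space \<mu>"
    and f: "simple_function \<mu> f" and k: "k \<ge> 1" "\<And>x. x \<in> flow \<Longrightarrow> f x < k" and e: "e > 0"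
  obtains n g where "simple_function \<mu> (\<lambda>x. g (word n x))"
    "measure \<mu> {x\<in>space \<mu>. f x \<noteq> g (word n x)} < e"
proof -
  interpret prob_space \<mu> by fact
  have sp: "space \<mu> = flow" using sets_eq_imp_space_eq[OF s] by simp
  let ?A = "\<lambda>i. f -` {i} \<inter> space \<mu>"
  have A: "?A i \<in> events" for i using simple_function_fibre[OF f] .
  have "\<forall>i. \<exists>n W. measure \<mu> ((?A i - cyl_union n W) \<union> (cyl_union n W - ?A i)) < e / k"
    using cyl_union_approximation[OF s \<open>prob_space \<mu>\<close> A] e k(1) by simp
  then obtain n W where nW: "\<And>i. measure \<mu> ((?A i - cyl_union (n i) (W i)) \<union> (cyl_union (n i) (W i) - ?A i)) < e / k"
    by metis
  define L where "L = Max (insert 0 (n ` {..<k}))"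
  have L: "n i \<le> L" if "i < k" for i unfolding L_def using that by (intro Max_ge) auto
  define V where "V = (\<lambda>i. {w. word (n i) w \<in> W i})"
  have V: "cyl_union (n i) (W i) = cyl_union L (V i)" if "i < k" for i
    using cyl_union_lift[OF L[OF that]] by (simp add: V_def)
  define g where "g = (\<lambda>w. LEAST i. i = k \<or> w \<in> V i)"
  let ?D = "\<lambda>i. (?A i - cyl_union L (V i)) \<union> (cyl_union L (V i) - ?A i)"
  have D: "?D i \<in> events" for i using A cyl_union_sets[folded s] by auto
  have sub: "{x\<in>space \<mu>. f x \<noteq> g (word L x)} \<subseteq> (\<Union>i<k. ?D i)"
  proof (rule subsetI, rule ccontr)
    fix x assume x: "x \<in> {x\<in>space \<mu>. f x \<noteq> g (word L x)}" and "x \<notin> (\<Union>i<k. ?D i)"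
    then have iff: "word L x \<in> V i \<longleftrightarrow> f x = i" if "i < k" for i
    proof -
      have "x \<notin> ?D i" using \<open>x \<notin> (\<Union>i<k. ?D i)\<close> that by blast
      moreover have "x \<in> cyl_union L (V i) \<longleftrightarrow> word L x \<in> V i" "x \<in> ?A i \<longleftrightarrow> f x = i"
        using x by (simp_all add: cyl_union_def sp)
      ultimately show ?thesis by blast
    qed
    have "f x < k" using k(2) x sp by auto
    then have "g (word L x) = f x"
      unfolding g_def
    proof (intro Least_equality)
      fix j assume "j = k \<or> word L x \<in> V j"
      then show "f x \<le> j" using iff[of j] \<open>f x < k\<close> by (cases "j < k") auto
    qed (use iff in auto)
    then show False using x by simp
  qed
  have "measure \<mu> {x\<in>space \<mu>. f x \<noteq> g (word L x)} \<le> measure \<mu> (\<Union>i<k. ?D i)"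
    using D by (intro finite_measure_mono[OF sub] sets.finite_UN) auto
  also have "\<dots> \<le> (\<Sum>i<k. measure \<mu> (?D i))" using D by (intro measure_UNION_le) auto
  also have "\<dots> < (\<Sum>i<k. e / k)"
  proof (rule sum_strict_mono)
    fix i assume "i \<in> {..<k}"
    then show "measure \<mu> (?D i) < e / k" using nW[of i] V[of i] by simp
  qed (use k(1) in \<open>auto simp: lessThan_empty_iff bot_nat_def\<close>)
  also have "\<dots> = e" using k(1) by simp
  finally have "measure \<mu> {x\<in>space \<mu>. f x \<noteq> g (word L x)} < e" .
  moreover have "simple_function \<mu> (\<lambda>x. g (word L x))"
    using simple_function_compose1[OF simple_function_word[OF s]] .
  ultimately show thesis using that by blast
qed

section \<open>Invariant measures on the flow\<close>

definition shift_relation :: "nat \<Rightarrow> (nat \<times> nat) set \<Rightarrow> (nat \<times> nat) set" where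
  "shift_relation i R = {(p, j). (p, j + i) \<in> R}"

locale invariant_measure = prob_space \<mu> for \<mu> :: "(nat \<Rightarrow> nat) measure" +
  assumes sets_eq: "sets \<mu> = sets (borel_of squarefree_flow)"
    and invariant: "distr \<mu> \<mu> left_shift = \<mu>"

lemma invariant_borel_prob_iff:
  "invariant_borel_prob squarefree_flow left_shift \<mu> \<longleftrightarrow> invariant_measure \<mu>"
proof -
  have "left_shift \<in> measurable \<mu> \<mu>" if "sets \<mu> = sets (borel_of squarefree_flow)"
    using measurable_left_shift measurable_cong_sets[OF that that] by simp
  then show ?thesis
    unfolding invariant_borel_prob_def invariant_measure_def invariant_measure_axioms_def by blast
qed

context invariant_measure
begin

lemma space_eq: "space \<mu> = flow"
  using sets_eq_imp_space_eq[OF sets_eq] by simp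

lemma measurable_shift: "left_shift \<in> measurable \<mu> \<mu>"
  using measurable_left_shift measurable_cong_sets[OF sets_eq sets_eq] by simp

lemmas measurable_shift_pow = measure_preserving_funpow(1)[OF measurable_shift invariant]
lemmas invariant_pow = measure_preserving_funpow(2)[OF measurable_shift invariant]
lemmas simple_word = simple_function_word[OF sets_eq]
lemmas simple_missed = simple_function_missed[OF sets_eq]

lemma sets_Collect_missed: "{x \<in> space \<mu>. Q (missed N x)} \<in> sets \<mu>"
proof -
  have "simple_function \<mu> (\<lambda>x. Q (missed N x))"
    by (rule simple_function_compose1[OF simple_missed])
  from simple_function_fibre[OF this, of True]
  show ?thesis by (simp add: vimage_def Int_def conj_commute)
qed

lemma measure_shift_eq:
  assumes "A \<in> sets \<mu>" shows "measure \<mu> {x \<in> space \<mu>. (left_shift ^^ i) x \<in> A} = measure \<mu> A"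
proof -
  have "{x \<in> space \<mu>. (left_shift ^^ i) x \<in> A} = (left_shift ^^ i) -` A \<inter> space \<mu>" by auto
  then show ?thesis using measure_distr[OF measurable_shift_pow assms, of i] invariant_pow[of i] by simp
qed

text \<open>
  Let \<open>E r\<close> be the event that the class of \<open>r\<close> modulo \<open>p\<^sup>2\<close> is missed. Shifting gives that the
  probability of \<open>E (r + 1)\<close> is at most that of \<open>E r\<close>; as \<open>E\<close> is periodic, all these probabilities
  are equal, and the inclusion behind the inequality is an equality up to a null set.
\<close>

lemma AE_missed_left_shift:
  "AE x in \<mu>. missed N (left_shift x) = shift_relation 1 (missed N x)"
proof -
  have "AE x in \<mu>. (p, r) \<in> missed N (left_shift x) \<longrightarrow> (p, Suc r) \<in> missed N x" for p r
  proof (cases "p \<in> small_primes N")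
    case True
    define E where "E = (\<lambda>r. {x \<in> space \<mu>. (p, r) \<in> missed N x})"
    define F where "F = {x \<in> space \<mu>. left_shift x \<in> E r}"
    have Es: "E r \<in> sets \<mu>" for r unfolding E_def by (rule sets_Collect_missed)
    have step: "E (Suc r) \<subseteq> {x \<in> space \<mu>. left_shift x \<in> E r}" for r
      using missed_left_shift measurable_space[OF measurable_shift] by (auto simp: E_def)
    have Fs: "{x \<in> space \<mu>. left_shift x \<in> E r} \<in> sets \<mu>" for r
      using measurable_sets[OF measurable_shift Es[of r]] by (simp add: vimage_def Int_def conj_commute)
    have eqF: "measure \<mu> {x \<in> space \<mu>. left_shift x \<in> E r} = measure \<mu> (E r)" for r
      using measure_shift_eq[OF Es, of 1 r] by simp
    have "measure \<mu> (E (Suc r)) \<le> measure \<mu> (E r)" for r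
      using finite_measure_mono[OF step Fs] eqF by simp
    then have "antimono (\<lambda>r. measure \<mu> (E r))" by (intro decseq_SucI)
    moreover have "E (r + p\<^sup>2) = E r" by (simp add: E_def missed_def)
    moreover have "Suc r \<le> r + p\<^sup>2" using True by (simp add: Suc_le_eq)
    ultimately have "measure \<mu> (E r) \<le> measure \<mu> (E (Suc r))"
      by (metis antimonoD)
    then have "measure \<mu> (F - E (Suc r)) = 0"
      using finite_measure_Diff[of F "E (Suc r)"] Fs Es step eqF finite_measure_mono[OF step Fs, of r]
      by (auto simp: F_def)
    then have "F - E (Suc r) \<in> null_sets \<mu>"
      using Fs Es by (intro null_setsI) (auto simp: F_def emeasure_eq_measure)
    then have "AE x in \<mu>. x \<notin> F - E (Suc r)" by (rule AE_not_in)
    then show ?thesis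
      using AE_space by eventually_elim (auto simp: F_def E_def dest: measurable_space[OF measurable_shift])
  qed (simp add: missed_def)
  then have "AE x in \<mu>. \<forall>p r. (p, r) \<in> missed N (left_shift x) \<longrightarrow> (p, Suc r) \<in> missed N x"
    by (simp add: AE_all_countable)
  then show ?thesis
    by eventually_elim (auto simp: shift_relation_def intro: missed_left_shift)
qed

lemma AE_missed_funpow:
  "AE x in \<mu>. missed N ((left_shift ^^ i) x) = shift_relation i (missed N x)"
proof (induction i)
  case 0
  then show ?case by (simp add: shift_relation_def)
next
  case (Suc i)
  have "AE x in distr \<mu> \<mu> (left_shift ^^ i). missed N (left_shift x) = shift_relation 1 (missed N x)"
    unfolding invariant_pow by (rule AE_missed_left_shift)
  then have "AE x in \<mu>. missed N (left_shift ((left_shift ^^ i) x)) = shift_relation 1 (missed N ((left_shift ^^ i) x))"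
    by (rule AE_distrD[OF measurable_shift_pow])
  then show ?case using Suc
    by eventually_elim (simp add: shift_relation_def)
qed

definition cond_ent :: "nat \<Rightarrow> nat \<Rightarrow> real" where
  "cond_ent N n = ent \<mu> (\<lambda>x. (word n x, missed N x)) - ent \<mu> (missed N)"

text \<open>
  Given the missed classes and the first \<open>n\<close> symbols, the next \<open>m\<close> symbols have at most the
  entropy that they have given the missed classes of the point shifted by \<open>n\<close>, since those are
  almost surely determined by the missed classes of the point itself. By invariance the
  latter entropy is \<open>cond_ent N m\<close>.
\<close>

lemma cond_ent_add_le: "cond_ent N (n + m) \<le> cond_ent N n + cond_ent N m"
proof -
  let ?X = "\<lambda>x. word m ((left_shift ^^ n) x)" and ?R = "missed N"
  let ?\<tau>R = "\<lambda>x. shift_relation n (missed N x)" and ?R' = "\<lambda>x. missed N ((left_shift ^^ n) x)"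
  have sX: "simple_function \<mu> ?X"
    by (rule simple_function_measure_preserving[OF simple_word measurable_shift_pow])
  have sR': "simple_function \<mu> ?R'"
    by (rule simple_function_measure_preserving[OF simple_missed measurable_shift_pow])
  have s\<tau>: "simple_function \<mu> ?\<tau>R" by (rule simple_function_compose1[OF simple_missed])
  have sY: "simple_function \<mu> (\<lambda>x. (word n x, ?R x))" using simple_word simple_missed by (rule simple_function_Pair)
  have "ent \<mu> (\<lambda>x. (word (n + m) x, ?R x)) = ent \<mu> (\<lambda>x. (?X x, (word n x, ?R x)))"
  proof (rule determines_ent_eq)
    show "determines \<mu> (\<lambda>x. (word (n + m) x, ?R x)) (\<lambda>x. (?X x, (word n x, ?R x)))"
      unfolding determines_def by (auto simp: word_eq_iff funpow_left_shift)
    show "determines \<mu> (\<lambda>x. (?X x, (word n x, ?R x))) (\<lambda>x. (word (n + m) x, ?R x))"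
      unfolding determines_def
    proof (intro ballI impI)
      fix a b assume "(?X a, (word n a, ?R a)) = (?X b, (word n b, ?R b))"
      then have *: "\<forall>k\<in>{1..m}. a (k + n) = b (k + n)" "\<forall>k\<in>{1..n}. a k = b k" "?R a = ?R b"
        by (auto simp: word_eq_iff funpow_left_shift)
      have "a k = b k" if "k \<in> {1..n + m}" for k
      proof (cases "k \<le> n")
        case False
        then have "k - n \<in> {1..m}" "k - n + n = k" using that by auto
        then show ?thesis using *(1) by metis
      qed (use *(2) that in auto)
      then show "(word (n + m) a, ?R a) = (word (n + m) b, ?R b)" using *(3) by (simp add: word_eq_iff)
    qed
  qed
  moreover have "ent \<mu> (\<lambda>x. (?X x, (word n x, ?R x))) - ent \<mu> (\<lambda>x. (word n x, ?R x))
      \<le> ent \<mu> (\<lambda>x. (?X x, ?\<tau>R x)) - ent \<mu> ?\<tau>R"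
    by (rule ent_Pair_diff_antimono[OF sX sY s\<tau>]) (simp add: determines_def)
  moreover have "ent \<mu> ?\<tau>R = ent \<mu> ?R'"
    using AE_missed_funpow[of N n] by (intro ent_AE_cong s\<tau> sR') auto
  moreover have "ent \<mu> (\<lambda>x. (?X x, ?\<tau>R x)) = ent \<mu> (\<lambda>x. (?X x, ?R' x))"
    using AE_missed_funpow[of N n] by (intro ent_AE_cong simple_function_Pair sX s\<tau> sR') auto
  moreover have "ent \<mu> ?R' = ent \<mu> ?R"
    by (rule ent_measure_preserving[OF simple_missed measurable_shift_pow invariant_pow])
  moreover have "ent \<mu> (\<lambda>x. (?X x, ?R' x)) = ent \<mu> (\<lambda>x. (word m x, ?R x))"
    by (rule ent_measure_preserving[OF simple_function_Pair[OF simple_word simple_missed]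
        measurable_shift_pow invariant_pow])
  ultimately show ?thesis by (simp add: cond_ent_def)
qed

lemma cond_ent_mono: "n \<le> m \<Longrightarrow> cond_ent N n \<le> cond_ent N m"
proof -
  assume "n \<le> m"
  then have "determines \<mu> (\<lambda>x. (word m x, missed N x)) (\<lambda>x. (word n x, missed N x))"
    by (auto simp: determines_def intro: word_le)
  then have "ent \<mu> (\<lambda>x. (word n x, missed N x)) \<le> ent \<mu> (\<lambda>x. (word m x, missed N x))"
    by (intro ent_mono simple_function_Pair simple_word simple_missed)
  then show ?thesis by (simp add: cond_ent_def)
qed

lemma cond_ent_nonneg: "cond_ent N n \<ge> 0"
proof -
  have "ent \<mu> (missed N) \<le> ent \<mu> (\<lambda>x. (word n x, missed N x))"
    by (intro ent_mono simple_function_Pair simple_word simple_missed) (simp add: determines_def)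
  then show ?thesis by (simp add: cond_ent_def)
qed

lemma cond_ent_mult_le: "cond_ent N (k * L) \<le> real k * cond_ent N L"
proof (induction k)
  case 0
  have "ent \<mu> (\<lambda>x. (word 0 x, missed N x)) = ent \<mu> (missed N)"
    by (rule determines_ent_eq) (auto simp: determines_def word_eq_iff)
  then show ?case by (simp add: cond_ent_def)
next
  case (Suc k)
  then show ?case using cond_ent_add_le[of N L "k * L"] by (simp add: algebra_simps)
qed

lemma cond_ent_le: "L \<ge> 1 \<Longrightarrow> cond_ent N n \<le> (real n / real L + 1) * cond_ent N L"
proof -
  assume L: "L \<ge> 1"
  have "n \<le> (n div L + 1) * L"
    using L by (metis Suc_eq_plus1 dividend_less_div_times less_imp_le mult_Suc add.commute One_nat_def Suc_le_eq)
  then have "cond_ent N n \<le> real (n div L + 1) * cond_ent N L"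
    using cond_ent_mono cond_ent_mult_le order_trans by blast
  also have "\<dots> \<le> (real n / real L + 1) * cond_ent N L"
  proof (rule mult_right_mono[OF _ cond_ent_nonneg])
    have "real (n div L) * real L \<le> real n"
      unfolding of_nat_mult[symmetric] of_nat_le_iff by (rule div_times_less_eq_dividend)
    then show "real (n div L + 1) \<le> real n / real L + 1" using L by (simp add: field_simps)
  qed
  finally show ?thesis .
qed

lemma ent_word_le: "ent \<mu> (word n) \<le> cond_ent N n + ent \<mu> (missed N)"
proof -
  have "ent \<mu> (word n) \<le> ent \<mu> (\<lambda>x. (word n x, missed N x))"
    by (intro ent_mono simple_function_Pair simple_word simple_missed) (simp add: determines_def)
  then show ?thesis by (simp add: cond_ent_def)
qed

end

context invariant_measure
begin

text \<open>
  The Kolmogorov-Sinai argument: up to an error \<open>e\<close> per time step, itineraries of length \<open>n\<close> for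
  the partition are determined by words of length \<open>n0 + n\<close>, whose entropy differs from
  \<open>cond_ent N (n0 + n)\<close> by a constant. Subadditivity bounds the latter by multiples of
  \<open>cond_ent N L\<close>.
\<close>

lemma entropy_wrt_partition_le:
  assumes P: "finite P" "partition_on (space \<mu>) P" "P \<subseteq> sets \<mu>" and L: "L \<ge> 1"
  shows "entropy_wrt_partition \<mu> left_shift P \<le> ereal (cond_ent N L / real L)"
proof (rule ereal_le_epsilon2)
  fix e :: real assume e: "e > 0"
  obtain f :: "(nat \<Rightarrow> nat) \<Rightarrow> nat" and k where f: "simple_function \<mu> f" "k \<ge> 1" "\<And>x. x \<in> space \<mu> \<Longrightarrow> f x < k"
      "P = (\<lambda>x. {y\<in>space \<mu>. f y = f x}) ` space \<mu>"
    by (rule partition_label[OF P]) (rule that, assumption+)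
  \<comment> \<open>Half of the error goes to each of the two terms of \<open>ent_fano\<close>.\<close>
  define d where "d = 1 - exp (- (e / 2))"
  have d: "0 < d" "d < 1" "- ln (1 - d) = e / 2" using e by (auto simp: d_def)
  have lnpos: "ln (real k / d) \<ge> 0" using d f(2) by (intro ln_ge_zero) (simp add: field_simps)
  define \<eta> where "\<eta> = (e / 2) / (ln (real k / d) + 1)"
  have \<eta>: "\<eta> > 0" "\<eta> * ln (real k / d) \<le> e / 2"
    using e lnpos by (auto simp: \<eta>_def divide_simps intro: mult_nonneg_nonneg)
  obtain n0 g where g: "simple_function \<mu> (\<lambda>x. g (word n0 x))"
      "measure \<mu> {x\<in>space \<mu>. f x \<noteq> g (word n0 x)} < \<eta>"
  proof (rule label_approximation[OF sets_eq prob_space_axioms f(1,2) _ \<eta>(1)])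
    show "f x < k" if "x \<in> flow" for x using f(3) that by (simp add: space_eq)
  qed (rule that, assumption+)
  let ?g = "\<lambda>x. g (word n0 x)"
  have "ent \<mu> (\<lambda>x. (f x, ?g x)) - ent \<mu> ?g
      \<le> - ln (1 - d) + measure \<mu> {x\<in>space \<mu>. f x \<noteq> ?g x} * ln (real k / d)"
    by (rule ent_fano[OF f(1) g(1) f(2,3) d(1,2)])
  also have "\<dots> \<le> e / 2 + \<eta> * ln (real k / d)"
    unfolding d(3) using g(2) lnpos by (intro add_left_mono mult_right_mono) auto
  finally have fg: "ent \<mu> (\<lambda>x. (f x, ?g x)) - ent \<mu> ?g \<le> e" using \<eta>(2) by linarith
  let ?C = "cond_ent N L" and ?H = "ent \<mu> (missed N)"
  let ?b = "\<lambda>n. ?C / real L + e + (real n0 / real L * ?C + ?C + ?H) / real n"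
  have bound: "ent \<mu> (itinerary left_shift f n) / real n \<le> ?b n" if n: "n \<ge> 1" for n
  proof -
    have "ent \<mu> (itinerary left_shift f n) \<le> ent \<mu> (word (n0 + n)) + real n * (ent \<mu> (\<lambda>x. (f x, ?g x)) - ent \<mu> ?g)"
    proof (rule ent_itinerary_le[OF f(1) g(1) simple_word measurable_shift invariant])
      fix i assume "i < n"
      have "word n0 ((left_shift ^^ i) a) = word n0 ((left_shift ^^ i) b)" if "word (n0 + n) a = word (n0 + n) b" for a b
        using word_le[OF that, of "n0 + i"] \<open>i < n\<close> by (intro word_funpow_left_shift) simp
      then show "determines \<mu> (word (n0 + n)) (\<lambda>x. ?g ((left_shift ^^ i) x))"
        unfolding determines_def by metis
    qed
    also have "\<dots> \<le> cond_ent N (n0 + n) + ?H + real n * e"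
      using ent_word_le[of "n0 + n" N] fg by (intro add_mono mult_left_mono) auto
    also have "\<dots> \<le> (real (n0 + n) / real L + 1) * ?C + ?H + real n * e"
      using cond_ent_le[OF L, of N "n0 + n"] by simp
    also have "\<dots> = ?b n * real n" using n L by (simp add: field_simps)
    finally show ?thesis using n by (simp add: pos_divide_le_eq)
  qed
  have lim: "?b \<longlonglongrightarrow> ?C / real L + e + 0"
    by (intro tendsto_intros lim_const_over_n)
  have "entropy_wrt_partition \<mu> left_shift P = limsup (\<lambda>n. ereal (ent \<mu> (itinerary left_shift f n) / real n))"
    by (rule entropy_wrt_partition_eq[OF f(1) measurable_shift f(4)])
  also have "\<dots> \<le> limsup (\<lambda>n. ereal (?b n))"
    using bound by (intro Limsup_mono eventually_sequentiallyI[of 1]) simp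
  also have "\<dots> = ereal (?C / real L + e)"
    using lim by (intro lim_imp_Limsup) auto
  finally show "entropy_wrt_partition \<mu> left_shift P \<le> ereal (cond_ent N L / real L) + ereal e" by simp
qed

theorem measure_entropy_le_cond_ent:
  assumes "L \<ge> 1"
  shows "measure_entropy \<mu> left_shift \<le> ereal (cond_ent N L / real L)"
  unfolding measure_entropy_def using entropy_wrt_partition_le[OF _ _ _ assms] by (intro SUP_least) auto

end

section \<open>Independent coin flips on the surviving positions\<close>

definition num_survivors :: "nat \<Rightarrow> (nat \<times> nat) set \<Rightarrow> nat" where
  "num_survivors n R = card {j\<in>{1..n}. survives R j}"

text \<open>
  The law of a word whose surviving positions carry independent fair coins and whose other
  positions carry 0.
\<close>

definition coin_weight :: "nat \<Rightarrow> (nat \<times> nat) set \<Rightarrow> (nat \<Rightarrow> nat) \<Rightarrow> real" where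
  "coin_weight n R w =
     (if \<forall>j\<in>{1..n}. w j = 1 \<longrightarrow> survives R j then (1 / 2) ^ num_survivors n R else 0)"

lemma coin_weight_nonneg [simp]: "coin_weight n R w \<ge> 0"
  by (simp add: coin_weight_def)

lemma card_words_on_survivors:
  "card {w\<in>words n. \<forall>j\<in>{1..n}. w j = 1 \<longrightarrow> survives R j} = 2 ^ num_survivors n R"
proof -
  let ?E = "\<lambda>j. if survives R j then {0, 1 :: nat} else {0}"
  have "{w\<in>words n. \<forall>j\<in>{1..n}. w j = 1 \<longrightarrow> survives R j} = PiE {1..n} ?E"
  proof (intro subset_antisym subsetI)
    fix w assume "w \<in> PiE {1..n} ?E"
    then have w: "w j \<in> ?E j" if "j \<in> {1..n}" for j using that by (rule PiE_mem)
    have "PiE {1..n} ?E \<subseteq> words n" unfolding words_def by (rule PiE_mono) auto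
    moreover have "survives R j" if "j \<in> {1..n}" "w j = 1" for j
      using w[OF that(1)] that(2) by (auto split: if_splits)
    ultimately show "w \<in> {w\<in>words n. \<forall>j\<in>{1..n}. w j = 1 \<longrightarrow> survives R j}" using \<open>w \<in> PiE {1..n} ?E\<close> by blast
  next
    fix w assume w: "w \<in> {w\<in>words n. \<forall>j\<in>{1..n}. w j = 1 \<longrightarrow> survives R j}"
    show "w \<in> PiE {1..n} ?E"
    proof (rule PiE_I)
      fix j assume j: "j \<in> {1..n}"
      have "w j \<in> {0, 1}" using w j unfolding words_def by blast
      then show "w j \<in> ?E j" using w j by auto
    next
      fix j assume "j \<notin> {1..n}"
      then show "w j = undefined" using w unfolding words_def by (blast intro: PiE_arb)
    qed
  qed
  then have "card {w\<in>words n. \<forall>j\<in>{1..n}. w j = 1 \<longrightarrow> survives R j} = (\<Prod>j\<in>{1..n}. card (?E j))"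
    by (simp add: card_PiE)
  also have "\<dots> = (\<Prod>j\<in>{1..n}. if survives R j then 2 else 1)"
    by (intro prod.cong) auto
  also have "\<dots> = (\<Prod>j\<in>{j\<in>{1..n}. survives R j}. 2)"
    by (rule prod.inter_filter[symmetric]) simp
  finally show ?thesis by (simp add: num_survivors_def)
qed

lemma sum_coin_weight: "(\<Sum>w\<in>words n. coin_weight n R w) = 1"
proof -
  have "(\<Sum>w\<in>words n. coin_weight n R w) =
      (\<Sum>w\<in>{w\<in>words n. \<forall>j\<in>{1..n}. w j = 1 \<longrightarrow> survives R j}. (1 / 2) ^ num_survivors n R)"
    unfolding coin_weight_def by (rule sum.inter_filter[symmetric]) simp
  also have "\<dots> = 1"
    unfolding sum_constant card_words_on_survivors by (simp add: power_one_over)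
  finally show ?thesis .
qed

lemma coin_weight_of_point:
  "coin_weight n (missed N x) (word n x) = (1 / 2) ^ num_survivors n (missed N x)"
proof -
  have "\<forall>j\<in>{1..n}. word n x j = 1 \<longrightarrow> survives (missed N x) j"
    using supp_survives[of _ x N] by (auto simp: word_def supp_def)
  then show ?thesis by (simp add: coin_weight_def)
qed

lemma survives_shift_relation: "survives (shift_relation i R) j \<longleftrightarrow> survives R (j + i)"
  by (simp add: survives_def shift_relation_def)

context invariant_measure
begin

definition survival_prob :: "nat \<Rightarrow> real" where
  "survival_prob N = measure \<mu> {x \<in> space \<mu>. survives (missed N x) 0}"

text \<open>
  The missed classes move with the shift, so all positions are equally likely to survive. This
  includes the position 0, which carries no symbol.
\<close>

lemma survival_prob_eq: "measure \<mu> {x \<in> space \<mu>. survives (missed N x) j} = survival_prob N"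
proof -
  let ?S = "\<lambda>j. {x \<in> space \<mu>. survives (missed N x) j}"
  have "measure \<mu> (?S j) = measure \<mu> {x \<in> space \<mu>. (left_shift ^^ j) x \<in> ?S 0}"
  proof (rule measure_eq_AE)
    show "AE x in \<mu>. x \<in> ?S j \<longleftrightarrow> x \<in> {x \<in> space \<mu>. (left_shift ^^ j) x \<in> ?S 0}"
      using AE_missed_funpow[of N j] AE_space
    proof eventually_elim
      case (elim x)
      have "(left_shift ^^ j) x \<in> space \<mu>" using measurable_space[OF measurable_shift_pow elim(2)] .
      then show ?case using elim by (simp add: survives_shift_relation)
    qed
    show "?S j \<in> events" by (rule sets_Collect_missed)
    show "{x \<in> space \<mu>. (left_shift ^^ j) x \<in> ?S 0} \<in> events"
      using measurable_sets[OF measurable_shift_pow sets_Collect_missed[of "\<lambda>R. survives R 0" N], of j]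
      by (simp add: vimage_def Int_def conj_commute)
  qed
  also have "\<dots> = measure \<mu> (?S 0)" by (rule measure_shift_eq[OF sets_Collect_missed])
  finally show ?thesis by (simp add: survival_prob_def)
qed

lemma integrable_missed: "integrable \<mu> (\<lambda>x. \<phi> (missed N x) :: real)"
  by (rule simple_function_expectation(1)[OF simple_missed simple_function_image_finite[OF simple_missed] order_refl])

lemma expected_survivors:
  assumes "finite J"
  shows "(\<integral>x. real (card {j\<in>J. survives (missed N x) j}) \<partial>\<mu>) = real (card J) * survival_prob N"
proof -
  let ?S = "\<lambda>j. {x \<in> space \<mu>. survives (missed N x) j}"
  have eq: "real (card {j\<in>J. survives (missed N x) j}) = (\<Sum>j\<in>J. indicator (?S j) x)" if "x \<in> space \<mu>" for x
    using assms that by (simp add: indicator_def sum.If_cases Int_def conj_commute)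
  have "(\<integral>x. real (card {j\<in>J. survives (missed N x) j}) \<partial>\<mu>) = (\<integral>x. (\<Sum>j\<in>J. indicator (?S j) x) \<partial>\<mu>)"
    by (rule Bochner_Integration.integral_cong[OF refl eq])
  also have "\<dots> = (\<Sum>j\<in>J. \<integral>x. indicator (?S j) x \<partial>\<mu>)"
    using sets_Collect_missed
    by (intro Bochner_Integration.integral_sum integrable_real_indicator) (auto simp: emeasure_eq_measure)
  also have "\<dots> = (\<Sum>j\<in>J. survival_prob N)"
  proof (rule sum.cong[OF refl])
    fix j
    have "?S j \<inter> space \<mu> = ?S j" by auto
    then show "(\<integral>x. indicator (?S j) x \<partial>\<mu>) = survival_prob N" by (simp add: survival_prob_eq)
  qed
  finally show ?thesis by simp
qed

text \<open>
  As all positions are equally likely to survive, one may average over a full period, where the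
  fraction of survivors is a product over the primes.
\<close>

lemma survival_prob_eq_integral:
  "survival_prob N = (\<integral>x. (\<Prod>p\<in>small_primes N. 1 - real (card (residues (missed N x) p)) / real (p\<^sup>2)) \<partial>\<mu>)"
proof -
  have "(\<integral>x. (\<Prod>p\<in>small_primes N. 1 - real (card (residues (missed N x) p)) / real (p\<^sup>2)) \<partial>\<mu>)
    = (\<integral>x. real (card {j\<in>{0..<0 + modulus N}. survives (missed N x) j}) / real (modulus N) \<partial>\<mu>)"
    using survivors_fraction[OF residue_relation_missed, of 0 N] by simp
  also have "\<dots> = real (card {0..<0 + modulus N}) * survival_prob N / real (modulus N)"
    using expected_survivors[of "{0..<0 + modulus N}" N] by simp
  finally show ?thesis by simp
qed

text \<open>
  The Gibbs inequality for the model in which, given the missed classes, the surviving positions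
  carry independent fair coins.
\<close>

lemma cond_ent_hellinger:
  assumes B: "finite B" "missed N ` space \<mu> \<subseteq> B"
  shows "cond_ent N n +
      (\<Sum>(w, R)\<in>words n \<times> B. (sqrt (fibre_prob \<mu> (\<lambda>x. (word n x, missed N x)) (w, R))
        - sqrt (fibre_prob \<mu> (missed N) R * coin_weight n R w))\<^sup>2)
    \<le> real n * ln 2 * survival_prob N"
proof -
  have "cond_ent N n +
      (\<Sum>(w, R)\<in>words n \<times> B. (sqrt (fibre_prob \<mu> (\<lambda>x. (word n x, missed N x)) (w, R))
        - sqrt (fibre_prob \<mu> (missed N) R * coin_weight n R w))\<^sup>2)
    \<le> (\<integral>x. - ln (coin_weight n (missed N x) (word n x)) \<partial>\<mu>)"
    unfolding cond_ent_def
  proof (rule conditional_gibbs[OF simple_word simple_missed finite_words _ B, where s = "\<lambda>w R. coin_weight n R w"])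
    show "word n ` space \<mu> \<subseteq> words n" using word_in_words by (auto simp: space_eq)
    show "(\<Sum>w\<in>words n. coin_weight n R w) \<le> 1" for R by (simp add: sum_coin_weight)
    fix w R assume "fibre_prob \<mu> (\<lambda>x. (word n x, missed N x)) (w, R) > 0"
    then have "(\<lambda>x. (word n x, missed N x)) -` {(w, R)} \<inter> space \<mu> \<noteq> {}" by (metis measure_empty less_irrefl)
    then obtain x where "w = word n x" "R = missed N x" by blast
    then show "coin_weight n R w > 0" by (simp add: coin_weight_of_point)
  qed simp
  also have "\<dots> = (\<integral>x. real (card {j\<in>{1..n}. survives (missed N x) j}) * ln 2 \<partial>\<mu>)"
    by (simp add: coin_weight_of_point num_survivors_def ln_realpow ln_div)
  also have "\<dots> = real n * ln 2 * survival_prob N"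
    using expected_survivors[of "{1..n}" N] by simp
  finally show ?thesis .
qed

lemma cond_ent_le_survival: "cond_ent N n \<le> real n * ln 2 * survival_prob N"
proof -
  have "0 \<le> (\<Sum>(w, R)\<in>words n \<times> missed N ` space \<mu>. (sqrt (fibre_prob \<mu> (\<lambda>x. (word n x, missed N x)) (w, R))
        - sqrt (fibre_prob \<mu> (missed N) R * coin_weight n R w))\<^sup>2)"
    by (auto intro!: sum_nonneg)
  then show ?thesis
    using cond_ent_hellinger[OF simple_function_image_finite[OF simple_missed] order_refl, of N n] by linarith
qed

lemma residues_missed_le: "p \<in> small_primes N \<Longrightarrow> residues (missed N x) p = residues (missed p x) p"
  by (auto simp: residues_def missed_def small_primes_def)

text \<open>
  Missing a second class for \<open>p\<close> lowers the factor of \<open>p\<close> from \<open>1 - 1/p\<^sup>2\<close> to at most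
  \<open>1 - 2/p\<^sup>2\<close>, which is \<open>1 - 1/(p\<^sup>2 - 1)\<close> times the former.
\<close>

lemma survival_prob_le_gap:
  assumes p: "p \<in> small_primes N"
  shows "survival_prob N \<le> sieve_density N *
    (1 - measure \<mu> {x \<in> space \<mu>. card (residues (missed p x) p) \<noteq> 1} / (real (p\<^sup>2) - 1))"
proof -
  let ?E = "{x \<in> space \<mu>. card (residues (missed p x) p) \<noteq> 1}"
  let ?f = "\<lambda>x q. 1 - real (card (residues (missed N x) q)) / real (q\<^sup>2)"
  have E: "?E \<in> events" by (rule sets_Collect_missed)
  have p4: "real (p\<^sup>2) \<ge> 4"
    using power_mono[of 2 "real p" 2] small_primes_ge_2[OF p] by simp
  have pt: "(\<Prod>q\<in>small_primes N. ?f x q) \<le> sieve_density N * (1 - indicator ?E x / (real (p\<^sup>2) - 1))" if x: "x \<in> space \<mu>" for x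
  proof -
    have c1: "card (residues (missed N x) q) \<ge> 1" if "q \<in> small_primes N" for q
      using residues_missed_nonempty[OF _ that] x by (simp add: space_eq)
    have f0: "0 \<le> ?f x q" for q
      using card_residues_le[of "missed N x" q] by (cases "q = 0") (simp_all add: field_simps flip: of_nat_power)
    have f1: "?f x q \<le> 1 - 1 / real (q\<^sup>2)" if "q \<in> small_primes N" for q
      using c1[OF that] by (intro diff_left_mono divide_right_mono) auto
    have fp: "?f x p \<le> (1 - 1 / real (p\<^sup>2)) * (1 - indicator ?E x / (real (p\<^sup>2) - 1))"
    proof (cases "x \<in> ?E")
      case True
      then have "card (residues (missed N x) p) \<ge> 2"
        using c1[OF p] residues_missed_le[OF p] by fastforce
      then have "?f x p \<le> 1 - 2 / real (p\<^sup>2)"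
        by (intro diff_left_mono divide_right_mono) auto
      also have "\<dots> = (1 - 1 / real (p\<^sup>2)) * (1 - 1 / (real (p\<^sup>2) - 1))"
      proof -
        have "1 - 2 / a = (1 - 1 / a) * (1 - 1 / (a - 1))" if "a \<ge> 4" for a :: real
          using that by (simp add: divide_simps)
        then show ?thesis using p4 by blast
      qed
      finally show ?thesis using True by simp
    qed (use f1[OF p] in simp)
    have "(\<Prod>q\<in>small_primes N. ?f x q) = ?f x p * (\<Prod>q\<in>small_primes N - {p}. ?f x q)"
      using p by (intro prod.remove) auto
    also have "\<dots> \<le> ((1 - 1 / real (p\<^sup>2)) * (1 - indicator ?E x / (real (p\<^sup>2) - 1))) *
        (\<Prod>q\<in>small_primes N - {p}. 1 - 1 / real (q\<^sup>2))"
      using fp f0 f1 p4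
      by (intro mult_mono prod_mono prod_nonneg mult_nonneg_nonneg)
         (auto simp: indicator_def divide_simps)
    also have "\<dots> = ((1 - 1 / real (p\<^sup>2)) * (\<Prod>q\<in>small_primes N - {p}. 1 - 1 / real (q\<^sup>2))) *
        (1 - indicator ?E x / (real (p\<^sup>2) - 1))" by simp
    also have "(1 - 1 / real (p\<^sup>2)) * (\<Prod>q\<in>small_primes N - {p}. 1 - 1 / real (q\<^sup>2)) = sieve_density N"
      unfolding sieve_density_def using p by (intro prod.remove[symmetric]) auto
    finally show ?thesis .
  qed
  have int: "integrable \<mu> (indicator ?E :: _ \<Rightarrow> real)"
    using E by (intro integrable_real_indicator) (auto simp: emeasure_eq_measure)
  have "survival_prob N \<le> (\<integral>x. sieve_density N * (1 - indicator ?E x / (real (p\<^sup>2) - 1)) \<partial>\<mu>)"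
    unfolding survival_prob_eq_integral using pt int
    by (intro integral_mono integrable_missed integrable_mult_right Bochner_Integration.integrable_diff integrable_divide) auto
  also have "\<dots> = sieve_density N * (1 - measure \<mu> ?E / (real (p\<^sup>2) - 1))"
  proof -
    have "?E \<inter> space \<mu> = ?E" by auto
    then show ?thesis using int by (simp add: prob_space)
  qed
  finally show ?thesis .
qed

lemma survival_prob_le: "survival_prob N \<le> sieve_density N"
proof -
  have "(\<Prod>p\<in>small_primes N. 1 - real (card (residues (missed N x) p)) / real (p\<^sup>2)) \<le> sieve_density N" if x: "x \<in> space \<mu>" for x
    unfolding sieve_density_def
  proof (intro prod_mono conjI)
    fix q assume q: "q \<in> small_primes N"
    show "0 \<le> 1 - real (card (residues (missed N x) q)) / real (q\<^sup>2)"
      using card_residues_le[of "missed N x" q] by (cases "q = 0") (simp_all add: field_simps flip: of_nat_power)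
    show "1 - real (card (residues (missed N x) q)) / real (q\<^sup>2) \<le> 1 - 1 / real (q\<^sup>2)"
      using residues_missed_nonempty[OF _ q] x space_eq by (intro diff_left_mono divide_right_mono) auto
  qed
  then have "survival_prob N \<le> (\<integral>x. sieve_density N \<partial>\<mu>)"
    unfolding survival_prob_eq_integral by (intro integral_mono integrable_missed) auto
  then show ?thesis by (simp add: prob_space)
qed

lemma measure_entropy_le_survival: "measure_entropy \<mu> left_shift \<le> ereal (ln 2 * survival_prob N)"
proof -
  have "measure_entropy \<mu> left_shift \<le> ereal (cond_ent N 1 / real 1)"
    by (rule measure_entropy_le_cond_ent) simp
  also have "\<dots> \<le> ereal (ln 2 * survival_prob N)" using cond_ent_le_survival[of N 1] by simp
  finally show ?thesis .
qed

lemma measure_entropy_le: "measure_entropy \<mu> left_shift \<le> ereal (squarefree_density * ln 2)"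
proof (rule LIMSEQ_le_const)
  show "(\<lambda>N. ereal (sieve_density N * ln 2)) \<longlonglongrightarrow> ereal (squarefree_density * ln 2)"
    by (intro tendsto_intros sieve_density_LIMSEQ)
  have "measure_entropy \<mu> left_shift \<le> ereal (sieve_density N * ln 2)" for N
    by (rule order_trans[OF measure_entropy_le_survival[of N]]) (use survival_prob_le[of N] in \<open>simp add: mult.commute\<close>)
  then show "\<exists>N0. \<forall>N\<ge>N0. measure_entropy \<mu> left_shift \<le> ereal (sieve_density N * ln 2)" by blast
qed

end

section \<open>Measures of maximal entropy\<close>

text \<open>
  How an inequality under one step of a cyclic rotation yields the uniform distribution, used
  for the phase of a measure of maximal entropy and for Haar measure.
\<close>

lemma cyclic_increasing_uniform:
  fixes a :: "nat \<Rightarrow> real"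
  assumes up: "\<And>k. a k \<le> a (Suc k)" and per: "\<And>k. a (k + Q) = a k" and Q: "Q > 0"
    and sum: "(\<Sum>k<Q. a k) = 1"
  shows "a k = 1 / real Q"
proof -
  have inc: "incseq a" using up by (rule incseq_SucI)
  have perm: "a (k + i * Q) = a k" for k i
  proof (induction i)
    case (Suc i)
    have "a (k + Suc i * Q) = a (k + i * Q + Q)" by (simp add: add_ac)
    then show ?case using Suc per by simp
  qed simp
  have le: "a j \<le> a i" for i j
  proof -
    have "a j \<le> a (i + j * Q)" using Q by (intro incseqD[OF inc]) (simp add: trans_le_add2)
    then show ?thesis by (simp add: perm)
  qed
  have "a j = a k" for j using le antisym by blast
  then have "(\<Sum>j<Q. a j) = (\<Sum>j<Q. a k)" by (intro sum.cong refl)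
  then have "(\<Sum>j<Q. a j) = real Q * a k" by simp
  then show ?thesis using sum Q by (simp add: field_simps)
qed

text \<open>
  By Cauchy-Schwarz, from \<open>a - b = (sqrt a - sqrt b) (sqrt a + sqrt b)\<close>.
\<close>

lemma hellinger_bound:
  fixes a b :: "'i \<Rightarrow> real"
  assumes "\<And>i. i \<in> B \<Longrightarrow> a i \<ge> 0" "\<And>i. i \<in> B \<Longrightarrow> b i \<ge> 0" "sum a B \<le> 1" "sum b B \<le> 1"
  shows "\<bar>sum a B - sum b B\<bar> \<le> 2 * sqrt (\<Sum>i\<in>B. (sqrt (a i) - sqrt (b i))\<^sup>2)"
proof -
  have "(sum a B - sum b B)\<^sup>2 = (\<Sum>i\<in>B. (sqrt (a i) - sqrt (b i)) * (sqrt (a i) + sqrt (b i)))\<^sup>2"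
    unfolding sum_subtractf[symmetric] using assms(1,2)
    by (intro arg_cong[where f = "\<lambda>x. x\<^sup>2"] sum.cong refl) (simp add: algebra_simps)
  also have "\<dots> \<le> (\<Sum>i\<in>B. (sqrt (a i) - sqrt (b i))\<^sup>2) * (\<Sum>i\<in>B. (sqrt (a i) + sqrt (b i))\<^sup>2)"
    by (rule Cauchy_Schwarz_ineq_sum)
  also have "\<dots> \<le> (\<Sum>i\<in>B. (sqrt (a i) - sqrt (b i))\<^sup>2) * 4"
  proof (intro mult_left_mono sum_nonneg zero_le_power2)
    have "(sqrt (a i) + sqrt (b i))\<^sup>2 \<le> 2 * a i + 2 * b i" if "i \<in> B" for i
    proof -
      have "0 \<le> (sqrt (a i) - sqrt (b i))\<^sup>2" by simp
      then show ?thesis using assms(1,2)[OF that] by (simp add: power2_sum power2_diff)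
    qed
    then have "(\<Sum>i\<in>B. (sqrt (a i) + sqrt (b i))\<^sup>2) \<le> (\<Sum>i\<in>B. 2 * a i + 2 * b i)" by (rule sum_mono)
    also have "\<dots> \<le> 4" using assms(3,4) by (simp add: sum.distrib sum_distrib_left[symmetric])
    finally show "(\<Sum>i\<in>B. (sqrt (a i) + sqrt (b i))\<^sup>2) \<le> 4" .
  qed
  finally have "sqrt ((sum a B - sum b B)\<^sup>2) \<le> sqrt ((\<Sum>i\<in>B. (sqrt (a i) - sqrt (b i))\<^sup>2) * 4)"
    by (rule real_sqrt_le_mono)
  then show ?thesis by (simp add: real_sqrt_mult)
qed

text \<open>
  The probability of the word \<open>w\<close> when the phase is uniform and the positions that survive the
  sieve by the primes up to \<open>N\<close> carry fair coins.
\<close>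

definition phase_average :: "nat \<Rightarrow> nat \<Rightarrow> (nat \<Rightarrow> nat) \<Rightarrow> real" where
  "phase_average N n w = (\<Sum>k<modulus N. coin_weight n (square_multiples N k) w) / real (modulus N)"

lemma inj_on_square_multiples: "inj_on (square_multiples N) {..<modulus N}"
  by (rule inj_onI) (simp add: square_multiples_eq_iff)

lemma shift_square_multiples: "shift_relation 1 (square_multiples N k) = square_multiples N (Suc k)"
  by (simp add: shift_relation_def square_multiples_def)

locale maximal_measure = invariant_measure +
  assumes maximal: "measure_entropy \<mu> left_shift = ereal (squarefree_density * ln 2)"
begin

lemma squarefree_density_le_survival: "squarefree_density \<le> survival_prob N"
  using measure_entropy_le_survival[of N] by (simp add: maximal mult.commute)

lemma cond_ent_ge: "real n * squarefree_density * ln 2 \<le> cond_ent N n"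
proof (cases "n = 0")
  case False
  then have "squarefree_density * ln 2 \<le> cond_ent N n / real n"
    using measure_entropy_le_cond_ent[of n N] by (simp add: maximal)
  then show ?thesis using False by (simp add: field_simps)
qed (use cond_ent_nonneg in simp)

text \<open>
  Otherwise the survival probability would fall below \<open>squarefree_density\<close> for large \<open>N\<close>.
\<close>

lemma one_missed_residue:
  assumes p: "p \<in> primes"
  shows "AE x in \<mu>. card (residues (missed p x) p) = 1"
proof -
  let ?E = "{x \<in> space \<mu>. card (residues (missed p x) p) \<noteq> 1}"
  define t where "t = measure \<mu> ?E / (real (p\<^sup>2) - 1)"
  have E: "?E \<in> events" by (rule sets_Collect_missed)
  have p4: "real (p\<^sup>2) \<ge> 4"
    using power_mono[of 2 "real p" 2] primes_ge_2[OF p] by simp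
  have "(\<lambda>N. sieve_density N * (1 - t)) \<longlonglongrightarrow> squarefree_density * (1 - t)"
    by (intro tendsto_intros sieve_density_LIMSEQ)
  moreover have "\<exists>N0. \<forall>N\<ge>N0. squarefree_density \<le> sieve_density N * (1 - t)"
    using survival_prob_le_gap[of p] squarefree_density_le_survival p order_trans
    unfolding t_def small_primes_def by blast
  ultimately have "squarefree_density \<le> squarefree_density * (1 - t)" by (rule LIMSEQ_le_const)
  then have "t \<le> 0" using squarefree_density_pos by (simp add: algebra_simps mult_le_0_iff)
  moreover have "t \<ge> 0" using p4 by (simp add: t_def)
  ultimately have "measure \<mu> ?E = 0" using p4 by (auto simp: t_def)
  then have "?E \<in> null_sets \<mu>" using E by (intro null_setsI) (auto simp: emeasure_eq_measure)
  then have "AE x in \<mu>. x \<notin> ?E" by (rule AE_not_in)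
  then show ?thesis using AE_space by eventually_elim auto
qed

lemma AE_missed_square_multiples:
  "AE x in \<mu>. missed N x \<in> square_multiples N ` {..<modulus N}"
proof -
  have "AE x in \<mu>. \<forall>p\<in>small_primes N. card (residues (missed p x) p) = 1"
    using one_missed_residue by (intro AE_finite_allI) (auto simp: small_primes_def)
  then show ?thesis
  proof eventually_elim
    case (elim x)
    then have "card (residues (missed N x) p) = 1" if "p \<in> small_primes N" for p
      using that residues_missed_le by simp
    then show ?case
      by (rule residue_relation_eq_square_multiples[OF residue_relation_missed]) auto
  qed
qed

text \<open>
  The shift moves the phase by one, and the measure is invariant.
\<close>

lemma missed_uniform: "fibre_prob \<mu> (missed N) (square_multiples N k) = 1 / real (modulus N)"
proof (rule cyclic_increasing_uniform[where a = "\<lambda>k. fibre_prob \<mu> (missed N) (square_multiples N k)"])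
  let ?F = "\<lambda>k. missed N -` {square_multiples N k} \<inter> space \<mu>"
  have F: "?F k \<in> events" for k by (rule simple_function_fibre[OF simple_missed])
  show "fibre_prob \<mu> (missed N) (square_multiples N k) \<le> fibre_prob \<mu> (missed N) (square_multiples N (Suc k))" for k
  proof -
    have "measure \<mu> (?F k) \<le> measure \<mu> {x \<in> space \<mu>. (left_shift ^^ 1) x \<in> ?F (Suc k)}"
    proof (rule finite_measure_mono_AE)
      show "AE x in \<mu>. x \<in> ?F k \<longrightarrow> x \<in> {x \<in> space \<mu>. (left_shift ^^ 1) x \<in> ?F (Suc k)}"
        using AE_missed_left_shift[of N]
        by eventually_elim (auto simp: shift_square_multiples[simplified] dest: measurable_space[OF measurable_shift])
      show "{x \<in> space \<mu>. (left_shift ^^ 1) x \<in> ?F (Suc k)} \<in> events"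
        using measurable_sets[OF measurable_shift F[of "Suc k"]]
        by (simp add: vimage_def Int_def conj_commute)
    qed
    then show ?thesis unfolding measure_shift_eq[OF F] .
  qed
  have "1 = measure \<mu> (space \<mu>)" by (simp add: prob_space)
  also have "\<dots> = measure \<mu> (\<Union>k<modulus N. ?F k)"
    using F AE_missed_square_multiples[of N] AE_space
    by (intro measure_eq_AE sets.finite_UN) auto
  also have "\<dots> = (\<Sum>k<modulus N. measure \<mu> (?F k))"
    using F inj_onD[OF inj_on_square_multiples[of N]]
    by (intro finite_measure_finite_Union) (auto simp: disjoint_family_on_def)
  finally show "(\<Sum>k<modulus N. fibre_prob \<mu> (missed N) (square_multiples N k)) = 1" by simp
qed (simp_all add: square_multiples_add_modulus)

text \<open>
  The maximal entropy forces the conditional entropy to be at least \<open>n c ln 2\<close>, and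
  \<open>cond_ent_hellinger\<close> then bounds the Hellinger distance between the joint law of phase and
  word and its model by the gap between the partial product and its limit \<open>c\<close>.
\<close>

lemma word_prob_approx:
  assumes w: "w \<in> words n"
  shows "\<bar>fibre_prob \<mu> (word n) w - phase_average N n w\<bar>
    \<le> 2 * sqrt (real n * ln 2 * (sieve_density N - squarefree_density))"
proof -
  let ?SM = "square_multiples N ` {..<modulus N}"
  define B where "B = missed N ` space \<mu> \<union> ?SM"
  have B: "finite B" "missed N ` space \<mu> \<subseteq> B" "?SM \<subseteq> B"
    using simple_function_image_finite[OF simple_missed] by (auto simp: B_def)
  define a where "a = (\<lambda>w R. fibre_prob \<mu> (\<lambda>x. (word n x, missed N x)) (w, R))"
  define b where "b = (\<lambda>w R. fibre_prob \<mu> (missed N) R * coin_weight n R w)"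
  have suma: "sum (a w) B = fibre_prob \<mu> (word n) w"
  proof -
    have "fibre_prob \<mu> (\<lambda>x. (word n x, missed N x)) (w, R) = fibre_prob \<mu> (\<lambda>x. (missed N x, word n x)) (R, w)" for R
      by (intro arg_cong[where f = "measure \<mu>"]) auto
    then show ?thesis
      using sum_fibre_prob_Pair[OF simple_missed simple_word B(1,2)] by (simp add: a_def)
  qed
  have sumb: "sum (b w) B = phase_average N n w"
  proof -
    have zero: "fibre_prob \<mu> (missed N) R = 0" if "R \<in> B - ?SM" for R
    proof -
      have "AE x in \<mu>. x \<notin> missed N -` {R} \<inter> space \<mu>"
        using AE_missed_square_multiples[of N] by eventually_elim (use that in auto)
      then show ?thesis
        using prob_eq_0[OF simple_function_fibre[OF simple_missed]] by simp
    qed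
    have "sum (b w) B = sum (b w) ?SM"
      using B zero by (intro sum.mono_neutral_right) (auto simp: b_def)
    also have "\<dots> = (\<Sum>k<modulus N. b w (square_multiples N k))"
      by (simp add: sum.reindex[OF inj_on_square_multiples])
    also have "\<dots> = phase_average N n w"
      by (simp add: b_def missed_uniform phase_average_def sum_divide_distrib)
    finally show ?thesis .
  qed
  have b1: "sum (b w) B \<le> 1"
  proof -
    have "coin_weight n R w \<le> 1" for R by (simp add: coin_weight_def power_le_one)
    then have "sum (b w) B \<le> (\<Sum>R\<in>B. fibre_prob \<mu> (missed N) R)"
      by (intro sum_mono) (simp add: b_def mult_left_le)
    then show ?thesis using sum_fibre_prob[OF simple_missed B(1,2)] by simp
  qed
  have "cond_ent N n + (\<Sum>(w, R)\<in>words n \<times> B. (sqrt (a w R) - sqrt (b w R))\<^sup>2)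
      \<le> real n * ln 2 * survival_prob N"
    unfolding a_def b_def by (rule cond_ent_hellinger[OF B(1,2)])
  also have "\<dots> \<le> real n * ln 2 * sieve_density N"
    by (intro mult_left_mono survival_prob_le) auto
  finally have "(\<Sum>(w, R)\<in>words n \<times> B. (sqrt (a w R) - sqrt (b w R))\<^sup>2)
      \<le> real n * ln 2 * (sieve_density N - squarefree_density)"
    using cond_ent_ge[of n N] by (simp add: algebra_simps)
  moreover have "(\<Sum>R\<in>B. (sqrt (a w R) - sqrt (b w R))\<^sup>2) \<le> (\<Sum>(w, R)\<in>words n \<times> B. (sqrt (a w R) - sqrt (b w R))\<^sup>2)"
  proof -
    have "(\<Sum>R\<in>B. (sqrt (a w R) - sqrt (b w R))\<^sup>2) \<le> (\<Sum>w\<in>words n. \<Sum>R\<in>B. (sqrt (a w R) - sqrt (b w R))\<^sup>2)"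
      using w by (intro member_le_sum[where f = "\<lambda>w. \<Sum>R\<in>B. (sqrt (a w R) - sqrt (b w R))\<^sup>2"]) (auto intro: sum_nonneg)
    then show ?thesis by (simp add: sum.cartesian_product)
  qed
  ultimately have "sqrt (\<Sum>R\<in>B. (sqrt (a w R) - sqrt (b w R))\<^sup>2)
      \<le> sqrt (real n * ln 2 * (sieve_density N - squarefree_density))"
    by (intro real_sqrt_le_mono) linarith
  moreover have "\<bar>sum (a w) B - sum (b w) B\<bar> \<le> 2 * sqrt (\<Sum>R\<in>B. (sqrt (a w R) - sqrt (b w R))\<^sup>2)"
    using b1 suma by (intro hellinger_bound) (auto simp: a_def b_def)
  ultimately show ?thesis unfolding suma sumb by linarith
qed

theorem maximal_word_prob:
  assumes w: "w \<in> words n"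
  shows "(\<lambda>N. phase_average N n w) \<longlonglongrightarrow> fibre_prob \<mu> (word n) w"
proof -
  have "(\<lambda>N. 2 * sqrt (real n * ln 2 * (sieve_density N - squarefree_density)))
      \<longlonglongrightarrow> 2 * sqrt (real n * ln 2 * (squarefree_density - squarefree_density))"
    by (intro tendsto_intros sieve_density_LIMSEQ)
  then have "(\<lambda>N. 2 * sqrt (real n * ln 2 * (sieve_density N - squarefree_density))) \<longlonglongrightarrow> 0" by simp
  then have "(\<lambda>N. phase_average N n w - fibre_prob \<mu> (word n) w) \<longlonglongrightarrow> 0"
    by (rule Lim_null_comparison[rotated]) (use word_prob_approx[OF w] in \<open>simp add: abs_minus_commute\<close>)
  then show ?thesis by (rule LIM_zero_cancel)
qed

end

section \<open>The law of the insertion map\<close>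

text \<open>
  The positions sieved by the coordinates of \<open>g\<close> at primes up to \<open>N\<close>, in the form in which missed
  classes are recorded; \<open>full_sieve\<close> uses all primes.
\<close>

definition sieve_relation :: "nat \<Rightarrow> (nat \<Rightarrow> int) \<Rightarrow> (nat \<times> nat) set" where
  "sieve_relation N g = {(p, j). p \<in> small_primes N \<and> [int j = g p] (mod int (p\<^sup>2))}"

definition full_sieve :: "(nat \<Rightarrow> int) \<Rightarrow> (nat \<times> nat) set" where
  "full_sieve g = {(p, j). p \<in> primes \<and> [int j = g p] (mod int (p\<^sup>2))}"

lemma survives_full_sieve: "survives (full_sieve g) j \<longleftrightarrow> \<not> sieved g j"
  by (auto simp: survives_def full_sieve_def sieved_def)

lemma residue_relation_sieve: "residue_relation N (sieve_relation N g)"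
proof -
  have "[int (j mod p\<^sup>2) = g p] (mod int (p\<^sup>2)) \<longleftrightarrow> [int j = g p] (mod int (p\<^sup>2))" for p j
    by (simp add: cong_def zmod_int)
  then show ?thesis unfolding residue_relation_def sieve_relation_def by auto
qed

lemma int_residue:
  fixes a :: int assumes "p \<in> primes"
  obtains r where "r < p\<^sup>2" "int r = a mod int (p\<^sup>2)"
proof -
  have p2: "int (p\<^sup>2) > 0" using primes_ge_2[OF assms] by simp
  then have "0 \<le> a mod int (p\<^sup>2)" by (rule pos_mod_sign)
  then obtain r where r: "a mod int (p\<^sup>2) = int r" by (rule nonneg_int_cases)
  have "int r < int (p\<^sup>2)" unfolding r[symmetric] using p2 by (rule pos_mod_bound)
  then have "r < p\<^sup>2" by (simp only: of_nat_less_iff)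
  then show thesis using r that by metis
qed

lemma card_residues_sieve:
  assumes p: "p \<in> small_primes N"
  shows "card (residues (sieve_relation N g) p) = 1"
proof -
  have "p \<in> primes" using p by (simp add: small_primes_def)
  then obtain r where r: "r < p\<^sup>2" "int r = g p mod int (p\<^sup>2)" by (rule int_residue)
  have "residues (sieve_relation N g) p = {r}"
  proof (intro subset_antisym subsetI)
    fix s assume "s \<in> residues (sieve_relation N g) p"
    then have s: "s < p\<^sup>2" "int s mod int (p\<^sup>2) = g p mod int (p\<^sup>2)"
      unfolding residues_def sieve_relation_def cong_def by blast+
    have "int s mod int (p\<^sup>2) = int (s mod p\<^sup>2)" by (rule zmod_int[symmetric])
    then have "int s = int r" using s r(2) by (simp only: mod_less)
    then show "s \<in> {r}" by simp
  next
    fix s assume "s \<in> {r}"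
    moreover have "[int r = g p] (mod int (p\<^sup>2))" unfolding r by simp
    ultimately show "s \<in> residues (sieve_relation N g) p"
      using p r by (simp add: residues_def sieve_relation_def)
  qed
  then show ?thesis by simp
qed

lemma sieve_relation_is_square_multiples: "sieve_relation N g \<in> square_multiples N ` {..<modulus N}"
  by (rule residue_relation_eq_square_multiples[OF residue_relation_sieve card_residues_sieve]) auto

text \<open>The unsieved positions are numbered consecutively, so that \<open>insertion\<close> reads
  distinct coordinates of the sequence of coin flips.\<close>

lemma unsieved_index: "j - num_sieved g j = card {i\<in>{1..j}. \<not> sieved g i}"
proof -
  have "card {i\<in>{1..j}. sieved g i} + card {i\<in>{1..j}. \<not> sieved g i} = card ({i\<in>{1..j}. sieved g i} \<union> {i\<in>{1..j}. \<not> sieved g i})"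
    by (intro card_Un_disjoint[symmetric]) auto
  also have "{i\<in>{1..j}. sieved g i} \<union> {i\<in>{1..j}. \<not> sieved g i} = {1..j}" by auto
  finally show ?thesis by (simp add: num_sieved_def)
qed

lemma unsieved_index_pos: "j \<ge> 1 \<Longrightarrow> \<not> sieved g j \<Longrightarrow> j - num_sieved g j \<ge> 1"
  unfolding unsieved_index by (auto simp: Suc_le_eq card_gt_0_iff)

lemma unsieved_index_inj: "inj_on (\<lambda>j. j - num_sieved g j) {j\<in>{1..n}. \<not> sieved g j}"
proof (rule linorder_inj_onI)
  fix i j assume "i < j" "i \<in> {j\<in>{1..n}. \<not> sieved g j}" "j \<in> {j\<in>{1..n}. \<not> sieved g j}"
  then have "{k\<in>{1..i}. \<not> sieved g k} \<subseteq> {k\<in>{1..j}. \<not> sieved g k}"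
      "j \<in> {k\<in>{1..j}. \<not> sieved g k}" "j \<notin> {k\<in>{1..i}. \<not> sieved g k}" by auto
  then have "{k\<in>{1..i}. \<not> sieved g k} \<subset> {k\<in>{1..j}. \<not> sieved g k}" by blast
  then have "card {k\<in>{1..i}. \<not> sieved g k} < card {k\<in>{1..j}. \<not> sieved g k}"
    by (intro psubset_card_mono) auto
  then show "i - num_sieved g i \<noteq> j - num_sieved g j" unfolding unsieved_index by simp
qed auto

lemma insertion_apply: "j \<ge> 1 \<Longrightarrow> insertion (g, y) j = (if sieved g j then 0 else y (j - num_sieved g j))"
  by (simp add: insertion_def)

lemma prob_space_bernoulli: "prob_space bernoulli_half"
  unfolding bernoulli_half_def by (intro prob_space_PiM prob_space_uniform_count_measure) auto

lemma space_bernoulli: "space bernoulli_half = PiE {1..} (\<lambda>_. {0, 1})"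
  by (simp add: bernoulli_half_def space_PiM space_uniform_count_measure)

text \<open>
  For fixed \<open>g\<close>, each unsieved position reads its own coordinate of the sequence of coin flips.
\<close>

lemma bernoulli_insertion_word:
  assumes w: "w \<in> words n"
  shows "measure bernoulli_half {y\<in>space bernoulli_half. \<forall>j\<in>{1..n}. insertion (g, y) j = w j} =
    coin_weight n (full_sieve g) w"
proof (cases "\<forall>j\<in>{1..n}. w j = 1 \<longrightarrow> survives (full_sieve g) j")
  case False
  then obtain j where "j \<in> {1..n}" "w j = 1" "sieved g j" by (auto simp: survives_full_sieve)
  then have "{y\<in>space bernoulli_half. \<forall>j\<in>{1..n}. insertion (g, y) j = w j} = {}"
    by (force simp: insertion_apply)
  then show ?thesis using False by (simp only: coin_weight_def if_False measure_empty)
next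
  case True
  let ?u = "\<lambda>_ :: nat. uniform_count_measure {0, 1 :: nat}"
  let ?\<phi> = "\<lambda>j. j - num_sieved g j"
  define S where "S = {j\<in>{1..n}. \<not> sieved g j}"
  have inj: "inj_on ?\<phi> S" unfolding S_def by (rule unsieved_index_inj)
  define \<psi> where "\<psi> = inv_into S ?\<phi>"
  have \<psi>: "\<psi> (?\<phi> j) = j" if "j \<in> S" for j using inv_into_f_f[OF inj that] by (simp add: \<psi>_def)
  let ?J = "?\<phi> ` S" and ?A = "\<lambda>i. {w (\<psi> i)}"
  have J: "finite ?J" "?J \<subseteq> {1..}" using unsieved_index_pos[of _ g] by (auto simp: S_def)
  have w01: "w j \<in> {0, 1}" if "j \<in> {1..n}" for j using w that unfolding words_def by (rule PiE_mem)
  have w0: "w j = 0" if "j \<in> {1..n}" "sieved g j" for j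
    using True w01[OF that(1)] that by (auto simp: survives_full_sieve)
  have A01: "w (\<psi> i) \<in> {0, 1}" if iJ: "i \<in> ?J" for i
  proof -
    obtain j where "j \<in> S" "i = ?\<phi> j" using iJ by blast
    then show ?thesis using \<psi>[of j] w01[of j] by (simp add: S_def)
  qed
  have A: "?A i \<in> sets (?u i)" if "i \<in> ?J" for i
    using A01[OF that] by (simp add: sets_uniform_count_measure)
  have "{y\<in>space bernoulli_half. \<forall>j\<in>{1..n}. insertion (g, y) j = w j} =
      {y\<in>space bernoulli_half. \<forall>j\<in>S. y (?\<phi> j) = w j}"
    using w0 by (auto simp: insertion_apply S_def)
  also have "\<dots> = prod_emb {1..} ?u ?J (PiE ?J ?A)"
  proof -
    have "y \<in> prod_emb {1..} ?u ?J (PiE ?J ?A) \<longleftrightarrow> y \<in> space bernoulli_half \<and> (\<forall>i\<in>?J. y i \<in> ?A i)" for y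
      using J by (auto simp: prod_emb_def bernoulli_half_def space_PiM restrict_PiE_iff)
    then show ?thesis using \<psi> by auto
  qed
  finally have eq: "{y\<in>space bernoulli_half. \<forall>j\<in>{1..n}. insertion (g, y) j = w j} = prod_emb {1..} ?u ?J (PiE ?J ?A)" .
  have "emeasure bernoulli_half (prod_emb {1..} ?u ?J (PiE ?J ?A)) = (\<Prod>i\<in>?J. emeasure (?u i) (?A i))"
    unfolding bernoulli_half_def
    using J A by (intro emeasure_PiM_emb prob_space_uniform_count_measure) auto
  also have "\<dots> = (\<Prod>i\<in>?J. ennreal (1 / 2))"
  proof (rule prod.cong[OF refl])
    fix i assume "i \<in> ?J"
    then have "w (\<psi> i) \<in> {0, 1}" by (rule A01)
    then have "?A i \<subseteq> {0, 1}" by simp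
    then show "emeasure (?u i) (?A i) = ennreal (1 / 2)"
      by (subst emeasure_uniform_count_measure) auto
  qed
  also have "\<dots> = ennreal ((1 / 2) ^ card ?J)" unfolding prod_constant by (rule ennreal_power) simp
  also have "card ?J = num_survivors n (full_sieve g)"
    unfolding card_image[OF inj] by (simp add: num_survivors_def survives_full_sieve S_def)
  finally have "measure bernoulli_half (prod_emb {1..} ?u ?J (PiE ?J ?A)) = (1 / 2) ^ num_survivors n (full_sieve g)"
    by (simp add: measure_def)
  then show ?thesis using True unfolding eq coin_weight_def by simp
qed

text \<open>
  The support of an inserted point misses the class of \<open>g p\<close> modulo \<open>p\<^sup>2\<close>.
\<close>

lemma insertion_in_flow:
  assumes "y \<in> space bernoulli_half" shows "insertion (g, y) \<in> flow"
proof -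
  have y: "y i \<in> {0, 1}" if "i \<ge> 1" for i
    using PiE_mem[of y "{1..}" "\<lambda>_. {0, 1}" i] assms that unfolding space_bernoulli by simp
  have "insertion (g, y) \<in> PiE {1..} (\<lambda>_. {0, 1})"
  proof (rule PiE_I)
    fix j :: nat assume "j \<in> {1..}"
    then show "insertion (g, y) j \<in> {0, 1}"
      using y[OF unsieved_index_pos[of j g]] by (auto simp: insertion_apply)
  qed (simp add: insertion_def)
  moreover have "(\<lambda>n. n mod p\<^sup>2) ` supp (insertion (g, y)) \<subset> {0..<p\<^sup>2}" if p: "p \<in> primes" for p
  proof -
    from p obtain r where r: "r < p\<^sup>2" "int r = g p mod int (p\<^sup>2)" by (rule int_residue)
    have ne: "k mod p\<^sup>2 \<noteq> r" if "k \<in> supp (insertion (g, y))" for k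
    proof
      assume "k mod p\<^sup>2 = r"
      then have "int k mod int (p\<^sup>2) = g p mod int (p\<^sup>2)" using r zmod_int by metis
      then have "sieved g k" using p unfolding sieved_def cong_def by blast
      then show False using that by (auto simp: supp_def insertion_apply)
    qed
    have "(\<lambda>n. n mod p\<^sup>2) ` supp (insertion (g, y)) \<subseteq> {0..<p\<^sup>2}"
      using primes_ge_2[OF p] by auto
    moreover have "r \<in> {0..<p\<^sup>2}" using r by simp
    moreover have "r \<notin> (\<lambda>n. n mod p\<^sup>2) ` supp (insertion (g, y))" using ne by blast
    ultimately show ?thesis by blast
  qed
  ultimately show ?thesis unfolding flow_eq by blast
qed

locale haar = 
  fixes m :: "(nat \<Rightarrow> int) measure"
  assumes haar: "normalized_haar_measure G_group G_topology m"
begin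

lemma sets_m: "sets m = sets (PiM primes (\<lambda>p. count_space (carrier (integer_mod_group (p\<^sup>2)))))"
  using haar by (simp add: normalized_haar_measure_def sets_borel_of_G)

lemma space_m: "space m = carrier G_group"
  using sets_eq_imp_space_eq[OF sets_m] by (simp add: space_PiM G_group_def)

sublocale m: prob_space m
  using haar by (simp add: normalized_haar_measure_def)

lemma sets_component: "p \<in> primes \<Longrightarrow> {g\<in>space m. Q (g p)} \<in> sets m"
proof -
  assume p: "p \<in> primes"
  let ?P = "PiM primes (\<lambda>p. count_space (carrier (integer_mod_group (p\<^sup>2))))"
  have "(\<lambda>g. g p) -` {a \<in> carrier (integer_mod_group (p\<^sup>2)). Q a} \<inter> space ?P \<in> sets ?P"
    by (rule measurable_sets[OF measurable_component_singleton[OF p]]) auto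
  moreover have "{g\<in>space m. Q (g p)} = (\<lambda>g. g p) -` {a \<in> carrier (integer_mod_group (p\<^sup>2)). Q a} \<inter> space ?P"
    using p sets_eq_imp_space_eq[OF sets_m] by (auto simp: space_PiM)
  ultimately show ?thesis by (simp add: sets_m)
qed

lemma sets_sieved: "{g\<in>space m. sieved g j} \<in> sets m"
proof -
  have "{g\<in>space m. sieved g j} = (\<Union>p\<in>primes. {g\<in>space m. [int j = g p] (mod int (p\<^sup>2))})"
    by (auto simp: sieved_def)
  also have "\<dots> \<in> sets m" by (intro sets.countable_UN'' sets_component) auto
  finally show ?thesis .
qed

lemma simple_function_sieve_relation: "simple_function m (sieve_relation N)"
proof (rule simple_function_residue_relation[OF residue_relation_sieve])
  fix p r assume p: "p \<in> small_primes N"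
  then have "{g \<in> space m. (p, r) \<in> sieve_relation N g} = {g\<in>space m. [int r = g p] (mod int (p\<^sup>2))}"
    by (auto simp: sieve_relation_def)
  also have "\<dots> \<in> sets m" using p by (intro sets_component) (simp add: small_primes_def)
  finally show "{g \<in> space m. (p, r) \<in> sieve_relation N g} \<in> sets m" .
qed

text \<open>
  Translation by the element \<open>- 1\<close> of the group moves the phase by one, and Haar measure does not
  change under it.
\<close>

lemma sieve_relation_uniform:
  "fibre_prob m (sieve_relation N) (square_multiples N k) = 1 / real (modulus N)"
proof (rule cyclic_increasing_uniform[where a = "\<lambda>k. fibre_prob m (sieve_relation N) (square_multiples N k)"])
  let ?F = "\<lambda>k. sieve_relation N -` {square_multiples N k} \<inter> space m"
  have F: "?F k \<in> sets m" for k by (rule simple_function_fibre[OF simple_function_sieve_relation])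
  define h where "h = (\<lambda>p\<in>primes. (- 1) mod int (p\<^sup>2))"
  have p2: "int (p\<^sup>2) > 0" if "p \<in> primes" for p using primes_ge_2[OF that] by simp
  interpret G: group G_group unfolding G_group_def by simp
  have h: "h \<in> carrier G_group"
    using p2 by (auto simp: h_def G_group_def carrier_integer_mod_group dest: primes_ge_2)
  show "fibre_prob m (sieve_relation N) (square_multiples N k) \<le> fibre_prob m (sieve_relation N) (square_multiples N (Suc k))" for k
  proof -
    have "sieve_relation N (h \<otimes>\<^bsub>G_group\<^esub> g) = shift_relation 1 (sieve_relation N g)" for g
    proof -
      have "[int j = (h \<otimes>\<^bsub>G_group\<^esub> g) p] (mod int (p\<^sup>2)) \<longleftrightarrow> [int (j + 1) = g p] (mod int (p\<^sup>2))"
        if p: "p \<in> primes" for p j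
      proof -
        have "(h \<otimes>\<^bsub>G_group\<^esub> g) p = ((- 1) mod int (p\<^sup>2) + g p) mod int (p\<^sup>2)"
          using p primes_ge_2[OF p] by (simp add: G_group_def h_def mult_integer_mod_group)
        then have "[int j = (h \<otimes>\<^bsub>G_group\<^esub> g) p] (mod int (p\<^sup>2)) \<longleftrightarrow> [int j = - 1 + g p] (mod int (p\<^sup>2))"
          by (simp add: cong_def mod_simps)
        also have "\<dots> \<longleftrightarrow> [int j + 1 = - 1 + g p + 1] (mod int (p\<^sup>2))"
          by (rule cong_add_rcancel[symmetric])
        finally show ?thesis by (simp add: add.commute)
      qed
      then show ?thesis unfolding sieve_relation_def shift_relation_def small_primes_def by auto
    qed
    then have "(\<lambda>g. h \<otimes>\<^bsub>G_group\<^esub> g) ` ?F k \<subseteq> ?F (Suc k)"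
      using h shift_square_multiples[of N k] by (auto simp: space_m simp del: One_nat_def)
    then have "emeasure m ((\<lambda>g. h \<otimes>\<^bsub>G_group\<^esub> g) ` ?F k) \<le> emeasure m (?F (Suc k))"
      by (rule emeasure_mono[OF _ F])
    moreover have "emeasure m ((\<lambda>g. h \<otimes>\<^bsub>G_group\<^esub> g) ` ?F k) = emeasure m (?F k)"
      using haar h F unfolding normalized_haar_measure_def by blast
    ultimately show ?thesis by (simp add: m.emeasure_eq_measure)
  qed
  have sub: "sieve_relation N ` space m \<subseteq> square_multiples N ` {..<modulus N}"
    using sieve_relation_is_square_multiples by blast
  from m.sum_fibre_prob[OF simple_function_sieve_relation _ this]
  show "(\<Sum>k<modulus N. fibre_prob m (sieve_relation N) (square_multiples N k)) = 1"
    by (simp add: sum.reindex[OF inj_on_square_multiples])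
qed (simp_all add: square_multiples_add_modulus)

lemma integral_coin_weight_sieve:
  "(\<integral>g. coin_weight n (sieve_relation N g) w \<partial>m) = phase_average N n w"
proof -
  have sub: "sieve_relation N ` space m \<subseteq> square_multiples N ` {..<modulus N}"
    using sieve_relation_is_square_multiples by blast
  have "(\<integral>g. coin_weight n (sieve_relation N g) w \<partial>m) =
      (\<Sum>R\<in>square_multiples N ` {..<modulus N}. fibre_prob m (sieve_relation N) R * coin_weight n R w)"
    by (rule m.simple_function_expectation(2)[OF simple_function_sieve_relation _ sub]) simp
  also have "\<dots> = phase_average N n w"
    by (simp add: sum.reindex[OF inj_on_square_multiples] sieve_relation_uniform phase_average_def sum_divide_distrib)
  finally show ?thesis .
qed

lemma simple_function_sieve_pattern: "simple_function m (\<lambda>g. {j\<in>{1..n}. sieved g j})"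
  by (rule simple_function_Collect) (auto intro: sets_sieved)

lemma coin_weight_full_sieve:
  "coin_weight n (full_sieve g) w = (\<lambda>F. if \<forall>j\<in>{1..n}. w j = 1 \<longrightarrow> j \<notin> F then (1 / 2) ^ card ({1..n} - F) else 0) {j\<in>{1..n}. sieved g j}"
proof -
  have "{j\<in>{1..n}. \<not> sieved g j} = {1..n} - {j\<in>{1..n}. sieved g j}" by auto
  then show ?thesis by (auto simp: coin_weight_def num_survivors_def survives_full_sieve)
qed

lemma integrable_coin_weight: "integrable m (\<lambda>g. coin_weight n (full_sieve g) w)"
  unfolding coin_weight_full_sieve
  by (rule m.simple_function_expectation(1)[OF simple_function_sieve_pattern
        simple_function_image_finite[OF simple_function_sieve_pattern] order_refl])

text \<open>
  A position sieved by \<open>g\<close> is sieved by some prime, so for each \<open>g\<close> the sieve by the primes up to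
  \<open>N\<close> agrees with the full one on an initial segment as soon as \<open>N\<close> is large; dominated
  convergence applies.
\<close>

lemma phase_average_LIMSEQ:
  "(\<lambda>N. phase_average N n w) \<longlonglongrightarrow> (\<integral>g. coin_weight n (full_sieve g) w \<partial>m)"
  unfolding integral_coin_weight_sieve[symmetric]
proof (rule integral_dominated_convergence[where w = "\<lambda>_. 1"])
  show "(\<lambda>g. coin_weight n (full_sieve g) w) \<in> borel_measurable m"
    by (rule borel_measurable_integrable[OF integrable_coin_weight])
  show "(\<lambda>g. coin_weight n (sieve_relation N g) w) \<in> borel_measurable m" for N
    by (rule borel_measurable_integrable, rule m.simple_function_expectation(1)[OF simple_function_sieve_relation
        simple_function_image_finite[OF simple_function_sieve_relation] order_refl])
  show "AE g in m. norm (coin_weight n (sieve_relation N g) w) \<le> 1" for N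
    by (simp add: coin_weight_def power_le_one)
  show "AE g in m. (\<lambda>N. coin_weight n (sieve_relation N g) w) \<longlonglongrightarrow> coin_weight n (full_sieve g) w"
  proof (rule AE_I2)
    fix g
    have ev: "eventually (\<lambda>N. survives (sieve_relation N g) j = survives (full_sieve g) j) sequentially" for j
    proof (cases "sieved g j")
      case True
      then obtain p where p: "p \<in> primes" "[int j = g p] (mod int (p\<^sup>2))" by (auto simp: sieved_def)
      show ?thesis
      proof (rule eventually_sequentiallyI)
        fix N assume "p \<le> N"
        then have "(p, j) \<in> sieve_relation N g" using p by (simp add: sieve_relation_def small_primes_def)
        then have "\<not> survives (sieve_relation N g) j" unfolding survives_def by blast
        then show "survives (sieve_relation N g) j = survives (full_sieve g) j"
          using True by (simp add: survives_full_sieve)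
      qed
    next
      case False
      then have "survives (sieve_relation N g) j" for N
        unfolding survives_def sieve_relation_def small_primes_def sieved_def by blast
      then show ?thesis using False by (simp add: survives_full_sieve)
    qed
    have "eventually (\<lambda>N. \<forall>j\<in>{1..n}. survives (sieve_relation N g) j = survives (full_sieve g) j) sequentially"
      using ev by (intro eventually_ball_finite) auto
    then have "eventually (\<lambda>N. coin_weight n (sieve_relation N g) w = coin_weight n (full_sieve g) w) sequentially"
    proof eventually_elim
      case (elim N)
      then have "{j\<in>{1..n}. survives (sieve_relation N g) j} = {j\<in>{1..n}. survives (full_sieve g) j}" by blast
      then show ?case using elim by (simp add: coin_weight_def num_survivors_def)
    qed
    then show "(\<lambda>N. coin_weight n (sieve_relation N g) w) \<longlonglongrightarrow> coin_weight n (full_sieve g) w"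
      by (rule tendsto_eventually)
  qed
qed simp

text \<open>
  The coordinate that is read depends measurably on \<open>g\<close> and takes countably many values. The
  default 0 at index 0 only serves to make the reading map total.
\<close>

lemma measurable_insertion_apply:
  assumes j: "j \<ge> 1"
  shows "(\<lambda>\<omega>. insertion \<omega> j) \<in> measurable (m \<Otimes>\<^sub>M bernoulli_half) (count_space UNIV)"
proof -
  have comp: "(\<lambda>y. if i \<ge> 1 then y i else 0) \<in> measurable bernoulli_half (count_space UNIV)" for i
  proof (cases "i \<ge> 1")
    case True
    then have "(\<lambda>y. y i) \<in> measurable bernoulli_half (uniform_count_measure {0, 1})"
      unfolding bernoulli_half_def by (intro measurable_component_singleton) simp
    moreover have "(\<lambda>a. a) \<in> measurable (uniform_count_measure {0, 1 :: nat}) (count_space UNIV)"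
      by (auto simp: measurable_def sets_uniform_count_measure space_uniform_count_measure)
    ultimately have "(\<lambda>y. y i) \<in> measurable bernoulli_half (count_space UNIV)"
      by (rule measurable_compose)
    then show ?thesis using True by simp
  qed simp
  have num: "(\<lambda>g. j - num_sieved g j) \<in> measurable m (count_space UNIV)"
    unfolding num_sieved_def
    by (rule measurable_simple_function, rule simple_function_compose1[OF simple_function_sieve_pattern])
  have [measurable]: "Measurable.pred m (\<lambda>g. sieved g j)"
    using sets_sieved[of j] by (simp add: pred_def)
  have "(\<lambda>\<omega>. if sieved (fst \<omega>) j then 0 else
      (\<lambda>i \<omega>. if i \<ge> 1 then snd \<omega> i else 0) (j - num_sieved (fst \<omega>) j) \<omega>)
    \<in> measurable (m \<Otimes>\<^sub>M bernoulli_half) (count_space UNIV)"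
  proof (rule measurable_If)
    show "(\<lambda>\<omega>. (\<lambda>i \<omega>. if i \<ge> 1 then snd \<omega> i else 0) (j - num_sieved (fst \<omega>) j) \<omega>)
      \<in> measurable (m \<Otimes>\<^sub>M bernoulli_half) (count_space UNIV)"
      by (rule measurable_compose_countable[OF measurable_compose[OF measurable_snd comp]
            measurable_compose[OF measurable_fst num]])
    show "{x \<in> space (m \<Otimes>\<^sub>M bernoulli_half). sieved (fst x) j} \<in> sets (m \<Otimes>\<^sub>M bernoulli_half)"
      by measurable
  qed simp
  moreover have "insertion \<omega> j = (if sieved (fst \<omega>) j then 0 else
      (\<lambda>i \<omega>. if i \<ge> 1 then snd \<omega> i else 0) (j - num_sieved (fst \<omega>) j) \<omega>)" for \<omega>
    using unsieved_index_pos[OF j, of "fst \<omega>"] insertion_apply[OF j, of "fst \<omega>" "snd \<omega>"] by simp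
  ultimately show ?thesis by simp
qed

lemma sets_insertion_word:
  "{\<omega> \<in> space (m \<Otimes>\<^sub>M bernoulli_half). \<forall>j\<in>{1..n}. insertion \<omega> j = w j} \<in> sets (m \<Otimes>\<^sub>M bernoulli_half)"
proof (rule sets.sets_Collect_finite_All)
  fix j assume "j \<in> {1..n}"
  then have "(\<lambda>\<omega>. insertion \<omega> j) -` {w j} \<inter> space (m \<Otimes>\<^sub>M bernoulli_half) \<in> sets (m \<Otimes>\<^sub>M bernoulli_half)"
    by (intro measurable_sets[OF measurable_insertion_apply]) auto
  then show "{\<omega> \<in> space (m \<Otimes>\<^sub>M bernoulli_half). insertion \<omega> j = w j} \<in> sets (m \<Otimes>\<^sub>M bernoulli_half)"
    by (simp add: vimage_def Int_def conj_commute)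
qed simp

lemma measurable_insertion: "insertion \<in> measurable (m \<Otimes>\<^sub>M bernoulli_half) (borel_of squarefree_flow)"
proof (rule measurable_sigma_sets[OF sets_borel_flow])
  show "cylinders \<subseteq> Pow flow" using cyl_subset by (auto simp: cylinders_def)
  show ran: "insertion \<in> space (m \<Otimes>\<^sub>M bernoulli_half) \<rightarrow> flow"
    using insertion_in_flow by (auto simp: space_pair_measure)
  fix C assume "C \<in> cylinders"
  then obtain n x where "C = cyl n x" by (auto simp: cylinders_def)
  then have "insertion -` C \<inter> space (m \<Otimes>\<^sub>M bernoulli_half) =
      {\<omega> \<in> space (m \<Otimes>\<^sub>M bernoulli_half). \<forall>j\<in>{1..n}. insertion \<omega> j = x j}"
    using ran by (auto simp: cyl_def word_eq_iff)
  then show "insertion -` C \<inter> space (m \<Otimes>\<^sub>M bernoulli_half) \<in> sets (m \<Otimes>\<^sub>M bernoulli_half)"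
    by (simp only: sets_insertion_word)
qed

definition insertion_law :: "(nat \<Rightarrow> nat) measure" where
  "insertion_law = distr (m \<Otimes>\<^sub>M bernoulli_half) (borel_of squarefree_flow) insertion"

lemma sets_insertion_law [simp]: "sets insertion_law = sets (borel_of squarefree_flow)"
  by (simp add: insertion_law_def)

lemma space_insertion_law: "space insertion_law = flow"
  by (simp add: insertion_law_def)

lemma prob_space_insertion_law: "prob_space insertion_law"
proof -
  interpret B: prob_space bernoulli_half by (rule prob_space_bernoulli)
  interpret pair_prob_space m bernoulli_half ..
  show ?thesis unfolding insertion_law_def by (rule prob_space_distr[OF measurable_insertion])
qed

lemma insertion_law_word:
  assumes w: "w \<in> words n"
  shows "fibre_prob insertion_law (word n) w = (\<integral>g. coin_weight n (full_sieve g) w \<partial>m)"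
proof -
  interpret B: prob_space bernoulli_half by (rule prob_space_bernoulli)
  let ?E = "{\<omega> \<in> space (m \<Otimes>\<^sub>M bernoulli_half). \<forall>j\<in>{1..n}. insertion \<omega> j = w j}"
  have weq: "word n x = w \<longleftrightarrow> (\<forall>j\<in>{1..n}. x j = w j)" for x
  proof -
    have "w = word n w" using w unfolding word_def words_def by (metis PiE_restrict)
    then show ?thesis using word_eq_iff by metis
  qed
  have "emeasure insertion_law (word n -` {w} \<inter> flow) = emeasure (m \<Otimes>\<^sub>M bernoulli_half)
      (insertion -` (word n -` {w} \<inter> flow) \<inter> space (m \<Otimes>\<^sub>M bernoulli_half))"
    unfolding insertion_law_def by (rule emeasure_distr[OF measurable_insertion vimage_word_sets])
  also have "insertion -` (word n -` {w} \<inter> flow) \<inter> space (m \<Otimes>\<^sub>M bernoulli_half) = ?E"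
  proof -
    have "insertion \<omega> \<in> flow" if "\<omega> \<in> space (m \<Otimes>\<^sub>M bernoulli_half)" for \<omega>
      using that insertion_in_flow by (auto simp: space_pair_measure)
    then show ?thesis
      unfolding set_eq_iff vimage_eq Int_iff singleton_iff mem_Collect_eq weq by blast
  qed
  also have "emeasure (m \<Otimes>\<^sub>M bernoulli_half) ?E = (\<integral>\<^sup>+ g. emeasure bernoulli_half (Pair g -` ?E) \<partial>m)"
    by (rule B.emeasure_pair_measure_alt[OF sets_insertion_word])
  also have "\<dots> = (\<integral>\<^sup>+ g. ennreal (coin_weight n (full_sieve g) w) \<partial>m)"
  proof (rule nn_integral_cong)
    fix g assume "g \<in> space m"
    then have "Pair g -` ?E = {y\<in>space bernoulli_half. \<forall>j\<in>{1..n}. insertion (g, y) j = w j}"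
      by (auto simp: space_pair_measure)
    then show "emeasure bernoulli_half (Pair g -` ?E) = ennreal (coin_weight n (full_sieve g) w)"
      using bernoulli_insertion_word[OF w, of g] by (simp add: B.emeasure_eq_measure)
  qed
  also have "\<dots> = ennreal (\<integral>g. coin_weight n (full_sieve g) w \<partial>m)"
    by (rule nn_integral_eq_integral[OF integrable_coin_weight]) simp
  finally show ?thesis by (simp add: measure_def space_insertion_law)
qed

theorem insertion_law_word_LIMSEQ:
  "w \<in> words n \<Longrightarrow> (\<lambda>N. phase_average N n w) \<longlonglongrightarrow> fibre_prob insertion_law (word n) w"
  using phase_average_LIMSEQ insertion_law_word by simp

end

section \<open>Invariance and entropy of the insertion law\<close>

definition word_cons :: "nat \<Rightarrow> nat \<Rightarrow> (nat \<Rightarrow> nat) \<Rightarrow> (nat \<Rightarrow> nat)" where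
  "word_cons n a w = (\<lambda>j\<in>{1..Suc n}. if j = 1 then a else w (j - 1))"

lemma interval_1_Suc: "{1..Suc n} = insert 1 (Suc ` {1..n})"
  by auto

lemma ball_1_Suc: "(\<forall>j\<in>{1..Suc n}. P j) \<longleftrightarrow> P 1 \<and> (\<forall>j\<in>{1..n}. P (Suc j))"
  unfolding interval_1_Suc by blast

lemma word_cons_in_words:
  assumes "w \<in> words n" "a \<in> {0, 1}" shows "word_cons n a w \<in> words (Suc n)"
  unfolding words_def
proof (rule PiE_I)
  fix j assume j: "j \<in> {1..Suc n}"
  then have "j - 1 \<in> {1..n}" if "j \<noteq> 1" using that by auto
  then have "w (j - 1) \<in> {0, 1}" if "j \<noteq> 1" using that PiE_mem assms(1) unfolding words_def by metis
  then show "word_cons n a w j \<in> {0, 1}" using j assms(2) by (auto simp: word_cons_def)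
next
  fix j assume "j \<notin> {1..Suc n}"
  then show "word_cons n a w j = undefined" unfolding word_cons_def restrict_def by (rule if_not_P)
qed

lemma num_survivors_Suc:
  "num_survivors (Suc n) R = (if survives R 1 then 1 else 0) + num_survivors n (shift_relation 1 R)"
proof -
  have "{j\<in>{1..Suc n}. survives R j} = (if survives R 1 then {1} else {}) \<union> Suc ` {j\<in>{1..n}. survives R (Suc j)}"
    unfolding interval_1_Suc by (auto simp del: image_Suc_atLeastAtMost)
  then have "num_survivors (Suc n) R = card ((if survives R 1 then {1} else {}) \<union> Suc ` {j\<in>{1..n}. survives R (Suc j)})"
    by (simp only: num_survivors_def)
  also have "\<dots> = card (if survives R 1 then {1 :: nat} else {}) + card (Suc ` {j\<in>{1..n}. survives R (Suc j)})"
    by (intro card_Un_disjoint) auto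
  finally show ?thesis by (simp add: card_image num_survivors_def survives_shift_relation)
qed

lemma coin_weight_cons:
  "coin_weight (Suc n) R (word_cons n 0 w) + coin_weight (Suc n) R (word_cons n 1 w) =
    coin_weight n (shift_relation 1 R) w"
proof -
  have "(\<forall>j\<in>{1..Suc n}. word_cons n a w j = 1 \<longrightarrow> survives R j) \<longleftrightarrow>
      (a = 1 \<longrightarrow> survives R 1) \<and> (\<forall>j\<in>{1..n}. w j = 1 \<longrightarrow> survives (shift_relation 1 R) j)" for a
    unfolding ball_1_Suc by (simp add: word_cons_def survives_shift_relation)
  then show ?thesis by (simp add: coin_weight_def num_survivors_Suc)
qed

text \<open>
  Summing over the first symbol moves every phase by one, which permutes the phases.
\<close>

lemma phase_average_cons:
  "phase_average N (Suc n) (word_cons n 0 w) + phase_average N (Suc n) (word_cons n 1 w) = phase_average N n w"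
proof -
  let ?f = "\<lambda>k. coin_weight n (square_multiples N k) w"
  have "(\<Sum>k<modulus N. ?f (Suc k)) = (\<Sum>k<modulus N. ?f k)"
  proof -
    have "?f 0 + (\<Sum>k<modulus N. ?f (Suc k)) = (\<Sum>k<Suc (modulus N). ?f k)"
      by (rule sum.lessThan_Suc_shift[symmetric])
    also have "\<dots> = (\<Sum>k<modulus N. ?f k) + ?f (0 + modulus N)" by simp
    also have "?f (0 + modulus N) = ?f 0" by (simp only: square_multiples_add_modulus)
    finally show ?thesis by linarith
  qed
  moreover have "coin_weight (Suc n) (square_multiples N k) (word_cons n 0 w)
      + coin_weight (Suc n) (square_multiples N k) (word_cons n 1 w) = ?f (Suc k)" for k
    unfolding coin_weight_cons shift_square_multiples ..
  ultimately show ?thesis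
    unfolding phase_average_def add_divide_distrib[symmetric] sum.distrib[symmetric] by simp
qed

lemma phase_average_nonneg [simp]: "phase_average N n w \<ge> 0"
  unfolding phase_average_def by (intro divide_nonneg_nonneg sum_nonneg) auto

lemma sum_num_survivors_phases:
  "(\<Sum>k<modulus N. real (num_survivors n (square_multiples N k))) = real n * (real (modulus N) * sieve_density N)"
proof -
  let ?s = "\<lambda>k j. survives (square_multiples N k) j"
  have card_if: "real (card {i\<in>A. P i}) = (\<Sum>i\<in>A. if P i then 1 else 0)" if "finite A" for A and P :: "nat \<Rightarrow> bool"
    using that by (simp add: sum.If_cases Int_def)
  have "(\<Sum>k<modulus N. real (num_survivors n (square_multiples N k))) =
      (\<Sum>k<modulus N. \<Sum>j\<in>{1..n}. if ?s k j then 1 else 0)"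
    unfolding num_survivors_def by (simp only: card_if finite_atLeastAtMost)
  also have "\<dots> = (\<Sum>j\<in>{1..n}. \<Sum>k<modulus N. if ?s k j then 1 else 0)" by (rule sum.swap)
  also have "\<dots> = (\<Sum>j\<in>{1..n}. real (card {k\<in>{..<modulus N}. ?s k j}))"
    by (simp only: card_if finite_lessThan)
  also have "\<dots> = (\<Sum>j\<in>{1..n}. real (modulus N) * sieve_density N)"
    by (simp only: card_phases_surviving)
  finally show ?thesis by simp
qed

text \<open>
  Entropy is concave: that of the mixture over the phases is at least the mean of the entropies
  \<open>num_survivors n R * ln 2\<close> of the fair coins for each phase.
\<close>

lemma phase_average_entropy:
  "- (\<Sum>w\<in>words n. phase_average N n w * ln (phase_average N n w)) \<ge> real n * sieve_density N * ln 2"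
proof -
  let ?Q = "modulus N"
  let ?p = "\<lambda>k w. coin_weight n (square_multiples N k) w" and ?q = "phase_average N n"
  have sumq: "(\<Sum>w\<in>words n. ?q w) = 1"
  proof -
    have "(\<Sum>w\<in>words n. ?q w) = (\<Sum>w\<in>words n. \<Sum>k<?Q. ?p k w) / real ?Q"
      by (simp add: phase_average_def sum_divide_distrib)
    also have "(\<Sum>w\<in>words n. \<Sum>k<?Q. ?p k w) = (\<Sum>k<?Q. \<Sum>w\<in>words n. ?p k w)" by (rule sum.swap)
    finally show ?thesis by (simp add: sum_coin_weight)
  qed
  have one: "real (num_survivors n (square_multiples N k)) * ln 2 \<le> - (\<Sum>w\<in>words n. ?p k w * ln (?q w))"
    if k: "k < ?Q" for k
  proof -
    have pos: "?q w > 0" if "?p k w > 0" for w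
    proof -
      have "?p k w \<le> (\<Sum>k<?Q. ?p k w)" using k by (intro member_le_sum) auto
      then show ?thesis unfolding phase_average_def using that by (intro divide_pos_pos) auto
    qed
    have "?p k w - ?q w \<le> ?p k w * ln (?p k w) - ?p k w * ln (?q w)" for w
    proof -
      have "?p k w - ?q w + (sqrt (?p k w) - sqrt (?q w))\<^sup>2 \<le> ?p k w * ln (?p k w) - ?p k w * ln (?q w)"
        using pos[of w] by (intro relative_entropy_term_ge) auto
      then show ?thesis using zero_le_power2[of "sqrt (?p k w) - sqrt (?q w)"] by linarith
    qed
    then have "(\<Sum>w\<in>words n. ?p k w - ?q w) \<le> (\<Sum>w\<in>words n. ?p k w * ln (?p k w) - ?p k w * ln (?q w))"
      by (rule sum_mono)
    then have "- (\<Sum>w\<in>words n. ?p k w * ln (?p k w)) \<le> - (\<Sum>w\<in>words n. ?p k w * ln (?q w))"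
      by (simp add: sum_subtractf sumq sum_coin_weight)
    moreover have "(\<Sum>w\<in>words n. ?p k w * ln (?p k w)) = - (real (num_survivors n (square_multiples N k)) * ln 2)"
    proof -
      have "(\<Sum>w\<in>words n. ?p k w * ln (?p k w)) =
          (\<Sum>w\<in>words n. ?p k w * - (real (num_survivors n (square_multiples N k)) * ln 2))"
        by (intro sum.cong refl) (simp add: coin_weight_def ln_realpow ln_div)
      also have "\<dots> = (\<Sum>w\<in>words n. ?p k w) * - (real (num_survivors n (square_multiples N k)) * ln 2)"
        by (rule sum_distrib_right[symmetric])
      finally show ?thesis by (simp add: sum_coin_weight)
    qed
    ultimately show ?thesis by linarith
  qed
  have "real n * (real ?Q * sieve_density N) * ln 2 = (\<Sum>k<?Q. real (num_survivors n (square_multiples N k)) * ln 2)"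
    by (simp add: sum_num_survivors_phases[symmetric] sum_distrib_right)
  also have "\<dots> \<le> (\<Sum>k<?Q. - (\<Sum>w\<in>words n. ?p k w * ln (?q w)))"
    using one by (intro sum_mono) auto
  also have "\<dots> = - (\<Sum>w\<in>words n. (\<Sum>k<?Q. ?p k w) * ln (?q w))"
    by (simp add: sum_negf sum_distrib_right sum.swap[of _ "words n"])
  also have "\<dots> = - (\<Sum>w\<in>words n. real ?Q * ?q w * ln (?q w))"
    by (simp add: phase_average_def)
  also have "\<dots> = real ?Q * (- (\<Sum>w\<in>words n. ?q w * ln (?q w)))"
    by (simp add: sum_distrib_left mult.assoc)
  finally have "real ?Q * (real n * sieve_density N * ln 2) \<le> real ?Q * (- (\<Sum>w\<in>words n. ?q w * ln (?q w)))"
    by (simp add: algebra_simps)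
  then show ?thesis by (subst (asm) mult_le_cancel_left_pos) auto
qed

lemma tendsto_xlnx:
  fixes p :: "nat \<Rightarrow> real"
  assumes p: "p \<longlonglongrightarrow> q" and pos: "\<And>N. p N \<ge> 0"
  shows "(\<lambda>N. p N * ln (p N)) \<longlonglongrightarrow> q * ln q"
proof (cases "q = 0")
  case False
  then show ?thesis using p by (intro tendsto_intros) auto
next
  case True
  have "((\<lambda>x :: real. x * ln x) \<longlongrightarrow> 0) (at_right 0)" by real_asymp
  then have "((\<lambda>x :: real. x * ln x) \<longlongrightarrow> 0) (at 0 within {0..})"
    by (simp add: at_within_Ici_at_right)
  then have "((\<lambda>x :: real. x * ln x) \<longlongrightarrow> 0 * ln 0) (at 0 within {0..})" by simp
  then have "continuous (at 0 within {0..}) (\<lambda>x :: real. x * ln x)"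
    by (simp add: continuous_within)
  then have "(\<lambda>N. p N * ln (p N)) \<longlonglongrightarrow> 0 * ln 0"
    using p pos True by (intro continuous_within_tendsto_compose'[of 0 "{0..}" "\<lambda>x. x * ln x" p]) auto
  then show ?thesis using True by simp
qed

context haar
begin

lemma insertion_law_ent: "real n * squarefree_density * ln 2 \<le> ent insertion_law (word n)"
proof -
  interpret L: prob_space insertion_law by (rule prob_space_insertion_law)
  have lim: "(\<lambda>N. - (\<Sum>w\<in>words n. phase_average N n w * ln (phase_average N n w)))
      \<longlonglongrightarrow> - (\<Sum>w\<in>words n. fibre_prob insertion_law (word n) w * ln (fibre_prob insertion_law (word n) w))"
    by (intro tendsto_minus tendsto_sum tendsto_xlnx insertion_law_word_LIMSEQ) auto
  have "word n ` space insertion_law \<subseteq> words n" using word_in_words by (auto simp: space_insertion_law)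
  then have "ent insertion_law (word n) =
      - (\<Sum>w\<in>words n. fibre_prob insertion_law (word n) w * ln (fibre_prob insertion_law (word n) w))"
    by (intro L.ent_eq_sum simple_function_word) auto
  moreover have "real n * squarefree_density * ln 2 \<le> - (\<Sum>w\<in>words n. phase_average N n w * ln (phase_average N n w))" for N
  proof -
    have "real n * squarefree_density * ln 2 \<le> real n * sieve_density N * ln 2"
      using squarefree_density_le by (intro mult_right_mono mult_left_mono) auto
    then show ?thesis using phase_average_entropy[where n = n and N = N] by linarith
  qed
  ultimately show ?thesis using LIMSEQ_le_const[OF lim] by auto
qed

text \<open>
  The preimage of a cylinder under the shift is the union of the two cylinders that prepend a
  symbol, so invariance is the limit of \<open>phase_average_cons\<close>.
\<close>

lemma insertion_law_invariant: "distr insertion_law insertion_law left_shift = insertion_law"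
proof (rule flow_measure_eqI)
  interpret L: prob_space insertion_law by (rule prob_space_insertion_law)
  have ms: "left_shift \<in> measurable insertion_law insertion_law"
    using measurable_left_shift by (simp add: measurable_cong_sets[OF sets_insertion_law sets_insertion_law])
  show "prob_space insertion_law" by (rule prob_space_insertion_law)
  then show "prob_space (distr insertion_law insertion_law left_shift)"
    by (rule prob_space.prob_space_distr[OF _ ms])
  fix n x assume x: "x \<in> flow"
  let ?w = "word n x"
  have w: "?w \<in> words n" by (rule word_in_words[OF x])
  let ?F = "\<lambda>n w. word n -` {w} \<inter> flow"
  have F: "?F n w \<in> sets insertion_law" for n w by (simp add: vimage_word_sets)
  have cyl: "cyl n x = ?F n ?w" by (auto simp: cyl_def)
  have "left_shift -` cyl n x \<inter> flow = ?F (Suc n) (word_cons n 0 ?w) \<union> ?F (Suc n) (word_cons n 1 ?w)"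
  proof -
    have iff: "word n (left_shift y) = ?w \<longleftrightarrow> word (Suc n) y = word_cons n (y 1) ?w" for y
    proof -
      have "word (Suc n) y = word_cons n (y 1) ?w \<longleftrightarrow> (\<forall>j\<in>{1..Suc n}. y j = word_cons n (y 1) ?w j)"
        unfolding word_def word_cons_def by (auto simp: fun_eq_iff restrict_def)
      also have "\<dots> \<longleftrightarrow> (\<forall>j\<in>{1..n}. y (Suc j) = x j)"
        unfolding ball_1_Suc by (simp add: word_cons_def word_def)
      also have "\<dots> \<longleftrightarrow> word n (left_shift y) = ?w" by (simp add: word_eq_iff left_shift_def)
      finally show ?thesis by simp
    qed
    have first: "y 1 = a" if "word (Suc n) y = word_cons n a ?w" for y a
      using fun_cong[OF that, of 1] by (simp add: word_def word_cons_def)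
    have y01: "y 1 = 0 \<or> y 1 = 1" if "y \<in> flow" for y using flow_values[OF that, of 1] by simp
    show ?thesis
    proof (intro subset_antisym subsetI)
      fix y assume "y \<in> left_shift -` cyl n x \<inter> flow"
      then have "y \<in> flow" "word n (left_shift y) = ?w" by (auto simp: cyl_def)
      then show "y \<in> ?F (Suc n) (word_cons n 0 ?w) \<union> ?F (Suc n) (word_cons n 1 ?w)"
        using iff[of y] y01[of y] by auto
    next
      fix y assume y: "y \<in> ?F (Suc n) (word_cons n 0 ?w) \<union> ?F (Suc n) (word_cons n 1 ?w)"
      then obtain a where "word (Suc n) y = word_cons n a ?w" "y \<in> flow" by auto
      then show "y \<in> left_shift -` cyl n x \<inter> flow"
        using iff[of y] first[of y a] left_shift_flow[of y] by (simp add: cyl_def)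
    qed
  qed
  moreover have "?F (Suc n) (word_cons n 0 ?w) \<inter> ?F (Suc n) (word_cons n 1 ?w) = {}"
  proof -
    have "word_cons n 0 ?w 1 \<noteq> word_cons n 1 ?w 1" by (simp add: word_cons_def)
    then show ?thesis by auto
  qed
  ultimately have "measure (distr insertion_law insertion_law left_shift) (cyl n x) =
      fibre_prob insertion_law (word (Suc n)) (word_cons n 0 ?w) + fibre_prob insertion_law (word (Suc n)) (word_cons n 1 ?w)"
    using measure_distr[OF ms, of "cyl n x"] F L.finite_measure_Union[OF F F]
    by (simp add: space_insertion_law cyl_sets)
  moreover have "(\<lambda>N. phase_average N n ?w) \<longlonglongrightarrow>
      fibre_prob insertion_law (word (Suc n)) (word_cons n 0 ?w) + fibre_prob insertion_law (word (Suc n)) (word_cons n 1 ?w)"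
    using tendsto_add[OF insertion_law_word_LIMSEQ[OF word_cons_in_words[OF w, of 0]]
        insertion_law_word_LIMSEQ[OF word_cons_in_words[OF w, of 1]]]
    by (simp only: phase_average_cons insertI1 insertI2 simp_thms singletonI)
  moreover have "measure insertion_law (cyl n x) = fibre_prob insertion_law (word n) ?w"
    by (simp add: cyl space_insertion_law)
  ultimately show "measure (distr insertion_law insertion_law left_shift) (cyl n x) = measure insertion_law (cyl n x)"
    using LIMSEQ_unique[OF insertion_law_word_LIMSEQ[OF w]] by simp
qed simp_all

sublocale L: invariant_measure insertion_law
  using prob_space_insertion_law insertion_law_invariant
  by (simp add: invariant_measure_def invariant_measure_axioms_def)

text \<open>
  The shift moves each symbol into the first place, so the partition by the first symbol is a
  generator.
\<close>

lemma itinerary_first_symbol: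
  "itinerary left_shift (\<lambda>x. x 1) n x = itinerary left_shift (\<lambda>x. x 1) n y \<longleftrightarrow> word n x = word n y"
proof -
  have "(\<forall>i<n. x (1 + i) = y (1 + i)) \<longleftrightarrow> (\<forall>k\<in>{1..n}. x k = y k)"
  proof (intro iffI ballI allI impI)
    fix k assume "\<forall>i<n. x (1 + i) = y (1 + i)" "k \<in> {1..n}"
    then show "x k = y k" by (cases k) auto
  qed auto
  then show ?thesis by (simp add: itinerary_eq_iff word_eq_iff funpow_left_shift)
qed

lemma simple_first_symbol: "simple_function insertion_law (\<lambda>x. x 1)"
proof -
  have "simple_function insertion_law (\<lambda>x. word 1 x 1)"
    by (rule simple_function_compose1[OF L.simple_word])
  then show ?thesis by (simp add: word_def)
qed

lemma insertion_law_entropy_ge: "ereal (squarefree_density * ln 2) \<le> measure_entropy insertion_law left_shift"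
proof -
  let ?f = "\<lambda>x :: nat \<Rightarrow> nat. x 1"
  define P where "P = (\<lambda>x. {y\<in>space insertion_law. ?f y = ?f x}) ` space insertion_law"
  have "finite P"
  proof -
    have "P = (\<lambda>v. {y\<in>space insertion_law. ?f y = v}) ` (?f ` space insertion_law)"
      by (simp add: P_def image_image)
    then show ?thesis using simple_functionD(1)[OF simple_first_symbol] by simp
  qed
  moreover have "partition_on (space insertion_law) P"
    unfolding partition_on_def disjoint_def P_def by fastforce
  moreover have "P \<subseteq> sets insertion_law"
  proof
    fix A assume "A \<in> P"
    then obtain x where "A = ?f -` {?f x} \<inter> space insertion_law" by (auto simp: P_def)
    then show "A \<in> sets insertion_law" using simple_functionD(2)[OF simple_first_symbol] by simp
  qed
  ultimately have "entropy_wrt_partition insertion_law left_shift P \<le> measure_entropy insertion_law left_shift"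
    unfolding measure_entropy_def by (intro SUP_upper) auto
  moreover have "entropy_wrt_partition insertion_law left_shift P =
      limsup (\<lambda>n. ereal (ent insertion_law (itinerary left_shift ?f n) / real n))"
    by (rule L.entropy_wrt_partition_eq[OF simple_first_symbol L.measurable_shift P_def])
  moreover have "ent insertion_law (itinerary left_shift ?f n) = ent insertion_law (word n)" for n
    by (rule determines_ent_eq) (simp_all add: determines_def itinerary_first_symbol[simplified])
  moreover have "ereal (squarefree_density * ln 2) \<le> limsup (\<lambda>n. ereal (ent insertion_law (word n) / real n))"
  proof -
    have "ereal (squarefree_density * ln 2) \<le> liminf (\<lambda>n. ereal (ent insertion_law (word n) / real n))"
    proof (intro Liminf_bounded eventually_sequentiallyI[of 1])
      fix n :: nat assume "1 \<le> n"
      then show "ereal (squarefree_density * ln 2) \<le> ereal (ent insertion_law (word n) / real n)"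
        using insertion_law_ent[of n] by (simp add: field_simps)
    qed
    also have "\<dots> \<le> limsup (\<lambda>n. ereal (ent insertion_law (word n) / real n))"
      by (rule Liminf_le_Limsup) simp
    finally show ?thesis .
  qed
  ultimately show ?thesis by simp
qed

lemma insertion_law_entropy: "measure_entropy insertion_law left_shift = ereal (squarefree_density * ln 2)"
  using L.measure_entropy_le insertion_law_entropy_ge by (rule antisym)

end

section \<open>Topological entropy\<close>

text \<open>
  Cover the first \<open>n\<close> positions by full periods; the last one may be incomplete.
\<close>

lemma num_survivors_le:
  "real (num_survivors n (square_multiples N k)) \<le> (real n + real (modulus N)) * sieve_density N"
proof -
  let ?Q = "modulus N" and ?S = "\<lambda>J. {j\<in>J. survives (square_multiples N k) j}"
  have blocks: "real (card (?S {1..<1 + q * ?Q})) = real q * (real ?Q * sieve_density N)" for q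
  proof (induction q)
    case (Suc q)
    define a where "a = 1 + q * ?Q"
    have aQ: "1 + Suc q * ?Q = a + ?Q" "a \<ge> 1" by (simp_all add: a_def)
    then have "?S {1..<a + ?Q} = ?S {1..<a} \<union> ?S {a..<a + ?Q}" by auto
    then have "card (?S {1..<a + ?Q}) = card (?S {1..<a} \<union> ?S {a..<a + ?Q})" by (simp only:)
    also have "\<dots> = card (?S {1..<a}) + card (?S {a..<a + ?Q})"
      by (intro card_Un_disjoint) auto
    finally have "real (card (?S {1..<1 + Suc q * ?Q})) = real (card (?S {1..<a})) + real (card (?S {a..<a + ?Q}))"
      unfolding aQ by (simp only: of_nat_add)
    also have "\<dots> = real q * (real ?Q * sieve_density N) + real ?Q * sieve_density N"
      using Suc.IH unfolding survivors_square_multiples_fraction a_def[symmetric] by (simp only:)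
    finally show ?case by (simp only: of_nat_Suc) (simp add: algebra_simps)
  qed simp
  let ?q = "n div ?Q + 1"
  have nq: "n < ?q * ?Q" using dividend_less_div_times[of ?Q n] by (simp add: algebra_simps)
  have "num_survivors n (square_multiples N k) \<le> card (?S {1..<1 + ?q * ?Q})"
    unfolding num_survivors_def using nq by (intro card_mono) auto
  then have "real (num_survivors n (square_multiples N k)) \<le> real ?q * (real ?Q * sieve_density N)"
    using blocks[of ?q] by linarith
  also have "\<dots> = (real (n div ?Q) * real ?Q + real ?Q) * sieve_density N" by (simp add: algebra_simps)
  also have "\<dots> \<le> (real n + real ?Q) * sieve_density N"
  proof (intro mult_right_mono add_right_mono)
    show "real (n div ?Q) * real ?Q \<le> real n"
      unfolding of_nat_mult[symmetric] of_nat_le_iff by (rule div_times_less_eq_dividend)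
    show "sieve_density N \<ge> 0" using sieve_density_pos[of N] by simp
  qed
  finally show ?thesis .
qed

text \<open>
  Every point of the flow is compatible with some phase: pick one missed class for each prime. For
  each of the \<open>modulus N\<close> phases the number of compatible words is a power of two.
\<close>

lemma ln_card_words_le:
  "ln (real (card (word n ` flow))) \<le> ln (real (modulus N)) + (real n + real (modulus N)) * sieve_density N * ln 2"
proof (cases "word n ` flow = {}")
  case True
  have "card (word n ` flow) = 0" unfolding True by simp
  moreover have "0 \<le> ln (real (modulus N)) + (real n + real (modulus N)) * sieve_density N * ln 2"
    using sieve_density_pos[of N] by (intro add_nonneg_nonneg mult_nonneg_nonneg ln_ge_zero) (auto simp: Suc_le_eq)
  ultimately show ?thesis by (simp only: of_nat_0 ln_0)
next
  case False
  let ?W = "\<lambda>k. {w\<in>words n. \<forall>j\<in>{1..n}. w j = 1 \<longrightarrow> survives (square_multiples N k) j}"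
  have "word n ` flow \<subseteq> (\<Union>k<modulus N. ?W k)"
  proof
    fix w assume "w \<in> word n ` flow"
    then obtain x where x: "x \<in> flow" "w = word n x" by auto
    have "\<exists>r. (p, r) \<in> missed N x" if "p \<in> small_primes N" for p
      using residues_missed_nonempty[OF x(1) that] unfolding residues_def
      by (metis (no_types, lifting) card.empty empty_Collect_eq not_one_le_zero)
    then obtain r where r: "\<And>p. p \<in> small_primes N \<Longrightarrow> (p, r p) \<in> missed N x" by metis
    define R where "R = sieve_relation N (\<lambda>p. int (r p))"
    have "R \<subseteq> missed N x"
    proof
      fix v assume "v \<in> R"
      then obtain p j where v: "v = (p, j)" "p \<in> small_primes N" "[int j = int (r p)] (mod int (p\<^sup>2))"
        unfolding R_def sieve_relation_def by blast
      have "[j = r p] (mod p\<^sup>2)" using v(3) by (simp only: cong_int_iff)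
      then have "j mod p\<^sup>2 = r p mod p\<^sup>2" by (simp only: cong_def)
      then show "v \<in> missed N x" using r[OF v(2)] v(1) by (simp add: missed_def)
    qed
    then have "survives R j" if "survives (missed N x) j" for j using that by (auto simp: survives_def)
    moreover obtain k where "k < modulus N" "R = square_multiples N k"
      using sieve_relation_is_square_multiples unfolding R_def by blast
    moreover have "survives (missed N x) j" if "j \<in> {1..n}" "word n x j = 1" for j
      using that by (intro supp_survives) (simp add: supp_def word_def)
    ultimately have "k < modulus N" "w \<in> ?W k" using word_in_words[OF x(1)] x(2) by auto
    then show "w \<in> (\<Union>k<modulus N. ?W k)" by blast
  qed
  then have "card (word n ` flow) \<le> card (\<Union>k<modulus N. ?W k)"
    by (intro card_mono finite_UN_I) auto
  also have "\<dots> \<le> (\<Sum>k<modulus N. card (?W k))" by (rule card_UN_le) simp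
  finally have "real (card (word n ` flow)) \<le> real (\<Sum>k<modulus N. 2 ^ num_survivors n (square_multiples N k))"
    unfolding card_words_on_survivors of_nat_le_iff .
  then have "real (card (word n ` flow)) \<le> (\<Sum>k<modulus N. 2 ^ num_survivors n (square_multiples N k))"
    by simp
  also have "\<dots> \<le> (\<Sum>k<modulus N. 2 powr ((real n + real (modulus N)) * sieve_density N))"
    using num_survivors_le by (intro sum_mono) (simp add: powr_realpow[symmetric])
  also have "\<dots> = real (modulus N) * 2 powr ((real n + real (modulus N)) * sieve_density N)" by simp
  finally have le: "real (card (word n ` flow)) \<le> real (modulus N) * 2 powr ((real n + real (modulus N)) * sieve_density N)" .
  have "word n ` flow \<subseteq> words n" using word_in_words by auto
  then have "finite (word n ` flow)" by (rule finite_subset) simp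
  then have "real (card (word n ` flow)) > 0" using False by (simp add: card_gt_0_iff)
  then have "ln (real (card (word n ` flow))) \<le> ln (real (modulus N) * 2 powr ((real n + real (modulus N)) * sieve_density N))"
    using le by (intro ln_mono) auto
  also have "\<dots> = ln (real (modulus N)) + (real n + real (modulus N)) * sieve_density N * ln 2"
    by (simp add: ln_mult ln_powr)
  finally show ?thesis .
qed

text \<open>A Lebesgue number for the cover, measured in the length of cylinders.\<close>

lemma cover_lebesgue_number:
  assumes op: "\<And>V. V \<in> U \<Longrightarrow> openin squarefree_flow V" and cov: "\<Union>U = flow"
  obtains l where "\<And>x. x \<in> flow \<Longrightarrow> \<exists>V\<in>U. cyl l x \<subseteq> V"
proof -
  let ?C = "{cyl n x | n x. x \<in> flow \<and> (\<exists>V\<in>U. cyl n x \<subseteq> V)}"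
  have "\<forall>C\<in>?C. openin squarefree_flow C" using openin_cyl by auto
  moreover have "\<Union>?C = flow"
  proof (intro subset_antisym subsetI)
    fix x assume x: "x \<in> flow"
    then obtain V where V: "V \<in> U" "x \<in> V" using cov by blast
    then obtain n where "cyl n x \<subseteq> V" using op openin_flow_iff by blast
    then show "x \<in> \<Union>?C" using x V cyl_self by blast
  qed (use cyl_subset in auto)
  ultimately obtain F where F: "finite F" "F \<subseteq> ?C" "\<Union>F = flow"
    using compact_squarefree_flow unfolding compact_space by meson
  have "\<forall>C\<in>F. \<exists>n. \<exists>x. C = cyl n x \<and> (\<exists>V\<in>U. C \<subseteq> V)" using F(2) by blast
  then obtain n where n: "\<And>C. C \<in> F \<Longrightarrow> \<exists>x. C = cyl (n C) x \<and> (\<exists>V\<in>U. C \<subseteq> V)" by metis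
  show thesis
  proof (rule that[of "Max (insert 0 (n ` F))"])
    fix x assume "x \<in> flow"
    then obtain C where C: "C \<in> F" "x \<in> C" using F(3) by blast
    then obtain y V where y: "C = cyl (n C) y" "V \<in> U" "C \<subseteq> V" using n by blast
    have "n C \<le> Max (insert 0 (n ` F))" using F(1) C(1) by (intro Max_ge) auto
    then have "cyl (Max (insert 0 (n ` F))) x \<subseteq> cyl (n C) x" by (rule cyl_mono)
    also have "cyl (n C) x = C"
    proof -
      have "word (n C) x = word (n C) y" using C(2) by (subst (asm) y(1)) (simp add: cyl_def)
      then show ?thesis by (subst (2) y(1)) (simp add: cyl_def)
    qed
    finally show "\<exists>V\<in>U. cyl (Max (insert 0 (n ` F))) x \<subseteq> V" using y by blast
  qed
qed

lemma cyl_in_iterated_join: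
  assumes l: "\<And>x. x \<in> flow \<Longrightarrow> \<exists>V\<in>U. cyl l x \<subseteq> V" and x: "x \<in> flow"
  shows "\<exists>A\<in>iterated_join flow left_shift U n. cyl (l + n) x \<subseteq> A"
proof (induction n)
  case 0
  then show ?case using cyl_subset by simp
next
  case (Suc n)
  then obtain A where A: "A \<in> iterated_join flow left_shift U n" "cyl (l + n) x \<subseteq> A" by blast
  obtain V where V: "V \<in> U" "cyl l ((left_shift ^^ n) x) \<subseteq> V"
    using l[OF funpow_left_shift_flow[OF x]] by blast
  have "cyl (l + Suc n) x \<subseteq> A" using A(2) cyl_mono[of "l + n" "l + Suc n" x] by auto
  moreover have "cyl (l + Suc n) x \<subseteq> (left_shift ^^ n) -` V \<inter> flow"
  proof
    fix y assume "y \<in> cyl (l + Suc n) x"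
    then have y: "y \<in> flow" "word (l + Suc n) y = word (l + Suc n) x" by (auto simp: cyl_def)
    have "word (l + n) y = word (l + n) x" by (rule word_le[OF y(2)]) simp
    then have "(left_shift ^^ n) y \<in> cyl l ((left_shift ^^ n) x)"
      using funpow_left_shift_flow[OF y(1)] word_funpow_left_shift[of l n y x] by (simp add: cyl_def)
    then show "y \<in> (left_shift ^^ n) -` V \<inter> flow" using V(2) y(1) by blast
  qed
  moreover have "A \<inter> ((left_shift ^^ n) -` V \<inter> flow) \<in> iterated_join flow left_shift U (Suc n)"
    unfolding iterated_join.simps using A(1) V(1) by blast
  ultimately show ?case by blast
qed

lemma entropy_wrt_cover_le:
  assumes op: "\<And>V. V \<in> U \<Longrightarrow> openin squarefree_flow V" and cov: "\<Union>U = flow"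
  shows "entropy_wrt_cover squarefree_flow left_shift U \<le> ereal (sieve_density N * ln 2)"
proof -
  obtain l where l: "\<And>x. x \<in> flow \<Longrightarrow> \<exists>V\<in>U. cyl l x \<subseteq> V"
    using cover_lebesgue_number[OF op cov] by blast
  let ?m = "\<lambda>n. min_subcover_card flow (iterated_join flow left_shift U n)"
  let ?Q = "real (modulus N)" and ?d = "sieve_density N"
  have card_le: "?m n \<le> card (word (l + n) ` flow)" for n
  proof -
    obtain A where A: "\<And>x. x \<in> flow \<Longrightarrow> A x \<in> iterated_join flow left_shift U n \<and> cyl (l + n) x \<subseteq> A x"
      using cyl_in_iterated_join[of U l _ n] l by metis
    define s where "s = (\<lambda>w. SOME x. x \<in> flow \<and> word (l + n) x = w)"
    have s: "s (word (l + n) x) \<in> flow \<and> word (l + n) (s (word (l + n) x)) = word (l + n) x" if "x \<in> flow" for x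
      unfolding s_def by (rule someI[of _ x]) (use that in simp)
    let ?V = "(\<lambda>w. A (s w)) ` (word (l + n) ` flow)"
    have fin: "finite (word (l + n) ` flow)"
      by (rule finite_subset[OF _ finite_words[of "l + n"]]) (use word_in_words in auto)
    have "?V \<subseteq> iterated_join flow left_shift U n" using A s by auto
    moreover have "flow \<subseteq> \<Union>?V"
    proof
      fix x assume x: "x \<in> flow"
      then have "x \<in> cyl (l + n) (s (word (l + n) x))" using s[OF x] by (simp add: cyl_def)
      then show "x \<in> \<Union>?V" using A[of "s (word (l + n) x)"] s[OF x] x by blast
    qed
    ultimately have "card ?V \<in> {card V | V. V \<subseteq> iterated_join flow left_shift U n \<and> finite V \<and> flow \<subseteq> \<Union>V}"
      using fin by blast
    then have "?m n \<le> card ?V" unfolding min_subcover_card_def by (rule wellorder_Inf_le1)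
    also have "\<dots> \<le> card (word (l + n) ` flow)" using fin by (rule card_image_le)
    finally show ?thesis .
  qed
  have bound: "ln (real (?m n)) \<le> ln ?Q + (real (l + n) + ?Q) * ?d * ln 2" for n
  proof (cases "?m n = 0")
    case True
    have "0 \<le> ln ?Q + (real (l + n) + ?Q) * ?d * ln 2"
      using sieve_density_pos[of N] by (intro add_nonneg_nonneg mult_nonneg_nonneg ln_ge_zero) (auto simp: Suc_le_eq)
    then show ?thesis using True by simp
  next
    case False
    then have "ln (real (?m n)) \<le> ln (real (card (word (l + n) ` flow)))"
      using card_le[of n] by (intro ln_mono) auto
    then show ?thesis using ln_card_words_le[of "l + n" N] by linarith
  qed
  let ?c = "ln ?Q + (real l + ?Q) * ?d * ln 2"
  have "entropy_wrt_cover squarefree_flow left_shift U \<le> limsup (\<lambda>n. ereal (?d * ln 2 + ?c / real n))"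
    unfolding entropy_wrt_cover_def
  proof (intro Limsup_mono eventually_sequentiallyI[of 1])
    fix n :: nat assume "1 \<le> n"
    then have "?d * ln 2 + ?c / real n = (ln ?Q + (real (l + n) + ?Q) * ?d * ln 2) / real n"
      by (simp add: field_simps)
    then show "ereal (ln (real (?m n)) / real n) \<le> ereal (?d * ln 2 + ?c / real n)"
      using bound[of n] by (simp only: ereal_less_eq divide_right_mono of_nat_0_le_iff)
  qed
  also have "\<dots> = ereal (?d * ln 2)"
  proof (intro lim_imp_Limsup)
    have "(\<lambda>n. ?d * ln 2 + ?c / real n) \<longlonglongrightarrow> ?d * ln 2 + 0"
      by (intro tendsto_intros lim_const_over_n)
    then show "(\<lambda>n. ereal (?d * ln 2 + ?c / real n)) \<longlonglongrightarrow> ereal (?d * ln 2)" by simp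
  qed simp
  finally show ?thesis .
qed

context haar
begin

text \<open>
  The cylinders of length \<open>n\<close> are pairwise disjoint, so a subcover needs one for each word, and the
  number of words is at least the exponential of the entropy of any random word.
\<close>

lemma topological_entropy_ge:
  "ereal (squarefree_density * ln 2) \<le> topological_entropy squarefree_flow left_shift"
proof -
  let ?f = "\<lambda>x :: nat \<Rightarrow> nat. x 1"
  define P where "P = (\<lambda>x. {y\<in>flow. ?f y = ?f x}) ` flow"
  have eq1: "{y\<in>flow. ?f y = ?f x} = cyl 1 x" for x by (auto simp: cyl_def word_eq_iff)
  have P: "(\<forall>V\<in>P. openin squarefree_flow V) \<and> \<Union>P = flow"
    unfolding P_def eq1 using openin_cyl cyl_self cyl_subset by blast
  let ?J = "iterated_join flow left_shift P"
  have cells: "?J n - {{}} = (\<lambda>x. cyl n x) ` flow - {{}}" for n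
    using iterated_join_nonempty_cells[OF left_shift_flow P_def, where n = n]
    by (simp add: itinerary_first_symbol[simplified] cyl_def)
  have ne: "cyl n x \<noteq> {}" if "x \<in> flow" for n x using cyl_self[OF that] by blast
  have card_ge: "card (word n ` flow) \<le> min_subcover_card flow (?J n)" for n
  proof -
    let ?K = "{card V | V. V \<subseteq> ?J n \<and> finite V \<and> flow \<subseteq> \<Union>V}"
    have finw: "finite (word n ` flow)"
      by (rule finite_subset[OF _ finite_words[of n]]) (use word_in_words in auto)
    have "cyl n ` flow = (\<lambda>w. {y\<in>flow. word n y = w}) ` (word n ` flow)"
      by (simp add: cyl_def image_image)
    then have "finite (cyl n ` flow)" using finw by simp
    moreover have "cyl n ` flow \<subseteq> ?J n" using cells[of n] ne by blast
    moreover have "flow \<subseteq> \<Union>(cyl n ` flow)" using cyl_self by blast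
    ultimately have "?K \<noteq> {}" by blast
    then have "Inf ?K \<in> ?K" by (rule Inf_nat_def1)
    then obtain V where V: "Inf ?K = card V" "V \<subseteq> ?J n" "finite V" "flow \<subseteq> \<Union>V" by blast
    have "(\<lambda>w. {y\<in>flow. word n y = w}) ` (word n ` flow) \<subseteq> V"
    proof
      fix C assume "C \<in> (\<lambda>w. {y\<in>flow. word n y = w}) ` (word n ` flow)"
      then obtain x where x: "x \<in> flow" "C = cyl n x" by (auto simp: cyl_def)
      then obtain D where D: "D \<in> V" "x \<in> D" using V(4) by blast
      then have "D \<in> ?J n - {{}}" using V(2) by blast
      then obtain y where "D = cyl n y" using cells[of n] by blast
      then have "D = C" using D(2) x by (auto simp: cyl_def)
      then show "C \<in> V" using D(1) by simp
    qed
    then have "card ((\<lambda>w. {y\<in>flow. word n y = w}) ` (word n ` flow)) \<le> card V"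
      using V(3) by (intro card_mono)
    moreover have "inj_on (\<lambda>w. {y\<in>flow. word n y = w}) (word n ` flow)"
      by (rule inj_onI) blast
    ultimately show ?thesis using V(1) by (simp add: card_image min_subcover_card_def)
  qed
  have "real n * squarefree_density * ln 2 \<le> ln (real (min_subcover_card flow (?J n)))" for n
  proof -
    have finw: "finite (word n ` flow)"
      by (rule finite_subset[OF _ finite_words[of n]]) (use word_in_words in auto)
    have "real n * squarefree_density * ln 2 \<le> ent insertion_law (word n)" by (rule insertion_law_ent)
    also have "\<dots> \<le> ln (real (card (word n ` flow)))"
      using finw by (intro L.ent_le_card L.simple_word) (auto simp: space_insertion_law)
    also have "\<dots> \<le> ln (real (min_subcover_card flow (?J n)))"
    proof -
      have "word n ` flow \<noteq> {}" using L.not_empty by (simp add: space_insertion_law)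
      then have "card (word n ` flow) > 0" using finw by (simp add: card_gt_0_iff)
      then show ?thesis using card_ge[of n] by (intro ln_mono) auto
    qed
    finally show ?thesis .
  qed
  then have "ereal (squarefree_density * ln 2) \<le> ereal (ln (real (min_subcover_card flow (?J n))) / real n)" if "n \<ge> 1" for n
    using that by (simp add: field_simps)
  then have "ereal (squarefree_density * ln 2) \<le> liminf (\<lambda>n. ereal (ln (real (min_subcover_card flow (?J n))) / real n))"
    by (intro Liminf_bounded eventually_sequentiallyI[of 1])
  also have "\<dots> \<le> entropy_wrt_cover squarefree_flow left_shift P"
    unfolding entropy_wrt_cover_def by (rule Liminf_le_Limsup) simp
  also have "\<dots> \<le> topological_entropy squarefree_flow left_shift"
    unfolding topological_entropy_def using P by (intro SUP_upper) simp
  finally show ?thesis .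
qed

lemma topological_entropy_eq:
  "topological_entropy squarefree_flow left_shift = ereal (squarefree_density * ln 2)"
proof (rule antisym[OF _ topological_entropy_ge])
  have "topological_entropy squarefree_flow left_shift \<le> ereal (sieve_density N * ln 2)" for N
    unfolding topological_entropy_def by (intro SUP_least entropy_wrt_cover_le) auto
  moreover have "(\<lambda>N. ereal (sieve_density N * ln 2)) \<longlonglongrightarrow> ereal (squarefree_density * ln 2)"
    by (intro tendsto_intros sieve_density_LIMSEQ)
  ultimately show "topological_entropy squarefree_flow left_shift \<le> ereal (squarefree_density * ln 2)"
    using LIMSEQ_le_const by blast
qed

lemma insertion_law_maximal: "measure_of_maximal_entropy squarefree_flow left_shift insertion_law"
  unfolding measure_of_maximal_entropy_def invariant_borel_prob_iff
  using L.invariant_measure_axioms insertion_law_entropy topological_entropy_eq by simp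

lemma maximal_measure_unique:
  assumes "measure_of_maximal_entropy squarefree_flow left_shift \<mu>"
  shows "\<mu> = insertion_law"
proof -
  have inv: "invariant_measure \<mu>" and
    ent: "measure_entropy \<mu> left_shift = topological_entropy squarefree_flow left_shift"
    using assms unfolding measure_of_maximal_entropy_def invariant_borel_prob_iff by blast+
  interpret maximal_measure \<mu>
    by (intro maximal_measure.intro maximal_measure_axioms.intro inv) (simp only: ent topological_entropy_eq)
  show ?thesis
  proof (rule flow_measure_eqI[OF sets_eq sets_insertion_law prob_space_axioms prob_space_insertion_law])
    fix n x assume x: "x \<in> flow"
    have w: "word n x \<in> words n" by (rule word_in_words[OF x])
    have "cyl n x = word n -` {word n x} \<inter> flow" by (auto simp: cyl_def)
    then show "measure \<mu> (cyl n x) = measure insertion_law (cyl n x)"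
      using LIMSEQ_unique[OF maximal_word_prob[OF w] insertion_law_word_LIMSEQ[OF w]]
      by (simp add: space_eq space_insertion_law)
  qed
qed

end

theorem theorem3p10:
  fixes m :: "(nat \<Rightarrow> int) measure"
  assumes "normalized_haar_measure G_group G_topology m"
  shows "{\<mu>. measure_of_maximal_entropy squarefree_flow left_shift \<mu>} =
    {distr (m \<Otimes>\<^sub>M bernoulli_half) (borel_of squarefree_flow) insertion}"
proof -
  interpret haar m using assms by (rule haar.intro)
  show ?thesis
    using insertion_law_maximal maximal_measure_unique unfolding insertion_law_def[symmetric] by blast
qed

end
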